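(* Let $K(\varepsilon)$ be a real symmetric $n\times n$ analytic matrix perturbation, partitioned as $$K(\varepsilon)=\Delta(\varepsilon)\begin{pmatrix}H_{11}(\varepsilon)&H_{12}(\varepsilon)\\H_{21}(\varepsilon)&H_{22}(\varepsilon)\end{pmatrix}\Delta(\varepsilon),$$ where $H_{11}(\varepsilon)$ and $H_{22}(\varepsilon)$ are symmetric of size $m\times m$ and $(n-m)\times(n-m)$, $H_{21}(\varepsilon)=H_{12}(\varepsilon)^T$, $H_{11}(0)$ is invertible, and $$\Delta(\varepsilon)=\begin{pmatrix}\Delta_m(\varepsilon)&\\&\varepsilon^{s/2}I_{n-m}\end{pmatrix},\qquad \Delta_m(\varepsilon)=\mathrm{diag}(\varepsilon^{\gamma_1},\dots,\varepsilon^{\gamma_m}),$$ with $\gamma_1\le\dots\le\gamma_m<\frac s2$ and $s$ an integer. Define $$K'(\varepsilon)=\begin{pmatrix}\Delta_m(\varepsilon)H_{11}(\varepsilon)\Delta_m(\varepsilon)&0\\0&\varepsilon^{s}\left(H_{22}(\varepsilon)-H_{21}(\varepsilon)H_{11}(\varepsilon)^{-1}H_{12}(\varepsilon)\right)\end{pmatrix}.$$ Then $K$ and $K'$ are asymptotically equivalent at all orders, i.e. their asymptotic spectral equivalents coincide: $\underline K(\varepsilon)=\underline{K'}(\varepsilon)$.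
   Context: The blocks $H_{ij}(\varepsilon)$ are defined for small $\varepsilon\ge0$ and continuous at $\varepsilon=0$; the identities hold for small $\varepsilon>0$. Asymptotic spectral equivalent (ASE): for a real symmetric matrix $K(\varepsilon)$ analytic near $\varepsilon=0$, take analytic eigenvalues $\lambda_k(\varepsilon)$ and analytic orthonormal eigenvectors $u_k(\varepsilon)$ (Rellich's theorem). If $\lambda_k\not\equiv0$, write $\lambda_k(\varepsilon)=\varepsilon^{\alpha}(\tilde\lambda_k+O(\varepsilon))$ with $\tilde\lambda_k\neq0$, and set $\mathrm{lt}(\lambda_k)=\tilde\lambda_k\varepsilon^\alpha$; if $\lambda_k\equiv0$ set $\mathrm{lt}(\lambda_k)=0$. The ASE is $\underline K(\varepsilon)=\sum_k\mathrm{lt}(\lambda_k)(\varepsilon)\,u_k(0)u_k(0)^T$ (independent of choices). ($K'$ is analytic because, for small $\varepsilon>0$, its diagonal blocks are the leading block of $K$ and the corresponding Schur complement of $K$, which is bounded and hence extends analytically to $\varepsilon=0$.) *)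

theory Defs
  imports
    "HOL-Analysis.FPS_Convergence"
    "HOL-Library.Landau_Symbols"
    "Jordan_Normal_Form.Gauss_Jordan_Elimination"
    "Jordan_Normal_Form.Char_Poly"
begin

definition analytic_at_0 :: "(real \<Rightarrow> real) \<Rightarrow> bool" where
  "analytic_at_0 f \<longleftrightarrow> (\<exists>F. f has_fps_expansion F)"

definition sym_analytic_mat :: "nat \<Rightarrow> (real \<Rightarrow> real mat) \<Rightarrow> bool" where
  "sym_analytic_mat n K \<longleftrightarrow>
     (\<forall>\<^sub>F \<epsilon> in nhds 0. K \<epsilon> \<in> carrier_mat n n \<and> transpose_mat (K \<epsilon>) = K \<epsilon>) \<and>
     (\<forall>i<n. \<forall>j<n. analytic_at_0 (\<lambda>\<epsilon>. K \<epsilon> $$ (i, j)))"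

definition analytic_eigensystem ::
  "nat \<Rightarrow> (real \<Rightarrow> real mat) \<Rightarrow> (nat \<Rightarrow> real \<Rightarrow> real) \<Rightarrow> (nat \<Rightarrow> real \<Rightarrow> real vec) \<Rightarrow> bool" where
  "analytic_eigensystem n K lam u \<longleftrightarrow>
     (\<forall>k<n. analytic_at_0 (lam k)) \<and>
     (\<forall>k<n. \<forall>i<n. analytic_at_0 (\<lambda>\<epsilon>. vec_index (u k \<epsilon>) i)) \<and>
     (\<forall>\<^sub>F \<epsilon> in nhds 0.
        (\<forall>k<n. u k \<epsilon> \<in> carrier_vec n \<and> eigenvector (K \<epsilon>) (u k \<epsilon>) (lam k \<epsilon>)) \<and>
        (\<forall>j<n. \<forall>k<n. u j \<epsilon> \<bullet> u k \<epsilon> = (if j = k then 1 else 0)))"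

definition lead_term :: "(real \<Rightarrow> real) \<Rightarrow> real \<Rightarrow> real" where
  "lead_term f =
     (if \<forall>\<^sub>F \<epsilon> in nhds 0. f \<epsilon> = 0 then (\<lambda>\<epsilon>. 0)
      else (THE g. \<exists>(\<alpha>::nat) c r. c \<noteq> 0 \<and> r \<in> O[at 0](\<lambda>\<epsilon>. \<epsilon>) \<and>
                     (\<forall>\<^sub>F \<epsilon> in at 0. f \<epsilon> = \<epsilon> ^ \<alpha> * (c + r \<epsilon>)) \<and>
                     g = (\<lambda>\<epsilon>. c * \<epsilon> ^ \<alpha>)))"

text \<open>The asymptotic spectral equivalent. An analytic eigensystem exists by Rellich's theorem,
  and the result does not depend on which one is chosen.\<close>

definition ase :: "nat \<Rightarrow> (real \<Rightarrow> real mat) \<Rightarrow> real \<Rightarrow> real mat" where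
  "ase n K = (let (lam, u) = (SOME (lam, u). analytic_eigensystem n K lam u) in
     (\<lambda>\<epsilon>. mat n n (\<lambda>(i, j).
        \<Sum>k<n. lead_term (lam k) \<epsilon> * (vec_index (u k 0) i * vec_index (u k 0) j))))"

definition mat_cont_right_0 :: "nat \<Rightarrow> nat \<Rightarrow> (real \<Rightarrow> real mat) \<Rightarrow> bool" where
  "mat_cont_right_0 nr nc H \<longleftrightarrow>
     (\<forall>i<nr. \<forall>j<nc. continuous (at_right 0) (\<lambda>\<epsilon>. H \<epsilon> $$ (i, j)))"

text \<open>The exponents are indexed from 0. The scaling matrices, like \<open>K_prime\<close> below, are only
  meant for positive arguments.\<close>

definition Delta_m :: "nat \<Rightarrow> (nat \<Rightarrow> real) \<Rightarrow> real \<Rightarrow> real mat" where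
  "Delta_m m \<gamma> \<epsilon> = mat_diag m (\<lambda>i. \<epsilon> powr \<gamma> i)"

definition Delta :: "nat \<Rightarrow> nat \<Rightarrow> (nat \<Rightarrow> real) \<Rightarrow> int \<Rightarrow> real \<Rightarrow> real mat" where
  "Delta n m \<gamma> s \<epsilon> =
     four_block_mat (Delta_m m \<gamma> \<epsilon>) (0\<^sub>m m (n - m))
                    (0\<^sub>m (n - m) m) (\<epsilon> powr (real_of_int s / 2) \<cdot>\<^sub>m 1\<^sub>m (n - m))"

definition K_prime ::
  "nat \<Rightarrow> nat \<Rightarrow> (nat \<Rightarrow> real) \<Rightarrow> int \<Rightarrow>
   (real \<Rightarrow> real mat) \<Rightarrow> (real \<Rightarrow> real mat) \<Rightarrow> (real \<Rightarrow> real mat) \<Rightarrow> (real \<Rightarrow> real mat) \<Rightarrow>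
   real \<Rightarrow> real mat" where
  "K_prime n m \<gamma> s H11 H12 H21 H22 \<epsilon> =
     four_block_mat
       (Delta_m m \<gamma> \<epsilon> * H11 \<epsilon> * Delta_m m \<gamma> \<epsilon>) (0\<^sub>m m (n - m))
       (0\<^sub>m (n - m) m)
       ((\<epsilon> powi s) \<cdot>\<^sub>m (H22 \<epsilon> - H21 \<epsilon> * the (mat_inverse (H11 \<epsilon>)) * H12 \<epsilon>))"

text \<open>The defining formula of \<open>K_prime\<close> does not make sense at 0; there and at
  negative arguments the matrix perturbation is given by analytic continuation, which is unique as
  a germ.\<close>

definition sym_analytic_extension :: "nat \<Rightarrow> (real \<Rightarrow> real mat) \<Rightarrow> (real \<Rightarrow> real mat) \<Rightarrow> bool" where
  "sym_analytic_extension n F G \<longleftrightarrow>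
     sym_analytic_mat n G \<and> (\<forall>\<^sub>F \<epsilon> in at_right 0. G \<epsilon> = F \<epsilon>)"

end

theory Submission
  imports Defs "HOL-Computational_Algebra.Fundamental_Theorem_Algebra"
begin

text \<open>For \<open>\<epsilon> > 0\<close> the block factorization gives \<open>K = L K' L\<^sup>T\<close> with \<open>L\<close> unit lower triangular and
  off-diagonal block \<open>X = \<epsilon>\<^bsup>s/2\<^esup> H\<^sub>2\<^sub>1 H\<^sub>1\<^sub>1\<^bsup>-1\<^esup> \<Delta>\<^sub>m\<^bsup>-1\<^esup>\<close>, which tends to 0 because every \<open>\<gamma>\<^sub>j < s/2\<close>. Pairing
  eigenvectors through \<open>K L\<^bsup>-T\<^esup> = L K'\<close> yields \<open>\<lambda>\<^sub>j (u\<^sub>j \<bullet> L\<^bsup>-T\<^esup> u'\<^sub>k) = \<lambda>'\<^sub>k (u\<^sub>j \<bullet> L u'\<^sub>k)\<close>. Both inner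
  products tend to \<open>u\<^sub>j(0) \<bullet> u'\<^sub>k(0)\<close>, so the leading terms of \<open>\<lambda>\<^sub>j\<close> and \<open>\<lambda>'\<^sub>k\<close> coincide unless the
  limiting eigenvectors are orthogonal, and expanding one eigenbasis in the other identifies the two
  spectral equivalents. The matrix \<open>K'\<close> extends analytically since \<open>X\<close> is a bounded quotient of
  analytic functions.

  Analytic eigensystems exist by induction on the dimension. A symmetric matrix that is not a
  scalar function times the identity is, up to a scalar shift, \<open>\<epsilon>\<^sup>k\<close> times a matrix whose value at 0
  has at least two distinct eigenvalues, and such a matrix is block diagonalized by a convergent
  orthogonal matrix. The latter solves a quadratic fixed point equation for power series.\<close>

subsection \<open>Fixed points of causal maps on power series\<close>

text \<open>Since \<open>ase\<close> selects an eigensystem with \<open>SOME\<close>, nothing is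
  known about it before existence is established; hence Rellich's theorem has to be proved for
  convergent series. The obstacle is multiplicity: eigenvalues that coincide at 0 may separate only
  at a higher order, so an implicit function argument for single eigenpairs fails. Whole clusters of
  eigenvalues are separated instead, and the recursion terminates because of the choice of the
  shift: subtracting a diagonal entry leaves a zero on the diagonal, and a nonzero lowest order
  coefficient matrix with a zero on the diagonal cannot be scalar. Convergence is controlled by
  weighted sums of absolute coefficients, truncated at \<open>N\<close> so that they make sense for
  every formal series; a bound uniform in \<open>N\<close> is convergence. The comparison of
  \<open>K\<close> and \<open>K'\<close> pairs no eigenvalues: overlaps of limiting eigenvectors
  decide which leading terms must agree. The blocks \<open>H\<close> are only continuous, and only
  from the right, so all analyticity has to be drawn from \<open>K\<close>.\<close>

definition fps_psum :: "real \<Rightarrow> nat \<Rightarrow> real fps \<Rightarrow> real" where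
  "fps_psum r N f = (\<Sum>n<N. \<bar>fps_nth f n\<bar> * r ^ n)"

lemma fps_psum_nonneg: "0 \<le> r \<Longrightarrow> 0 \<le> fps_psum r N f"
  by (simp add: fps_psum_def sum_nonneg)

lemma fps_psum_0 [simp]: "fps_psum r N 0 = 0"
  by (simp add: fps_psum_def)

lemma fps_psum_uminus [simp]: "fps_psum r N (- f) = fps_psum r N f"
  by (simp add: fps_psum_def)

lemma fps_psum_add_le: "0 \<le> r \<Longrightarrow> fps_psum r N (f + g) \<le> fps_psum r N f + fps_psum r N g"
  unfolding fps_psum_def sum.distrib[symmetric]
  by (intro sum_mono) (simp add: distrib_right[symmetric] mult_right_mono abs_triangle_ineq)

lemma fps_psum_diff_le: "0 \<le> r \<Longrightarrow> fps_psum r N (f - g) \<le> fps_psum r N f + fps_psum r N g"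
  using fps_psum_add_le[of r N f "- g"] by simp

lemma fps_psum_const_mult: "fps_psum r N (fps_const c * f) = \<bar>c\<bar> * fps_psum r N f"
  by (simp add: fps_psum_def sum_distrib_left abs_mult mult.assoc)

lemma fps_psum_sum_le:
  "0 \<le> r \<Longrightarrow> fps_psum r N (\<Sum>k\<in>A. f k) \<le> (\<Sum>k\<in>A. fps_psum r N (f k))"
proof (induction A rule: infinite_finite_induct)
  case (insert x F)
  then show ?case
    using fps_psum_add_le[of r N "f x" "sum f F"] by simp
qed simp_all

text \<open>The index pairs of the truncated Cauchy product form the triangle
  \<open>i + j < N\<close>, which lies in the square of pairs of the product of the two sums; all
  terms are nonnegative.\<close>

lemma fps_psum_mult_le:
  assumes "0 \<le> r"
  shows "fps_psum r N (f * g) \<le> fps_psum r N f * fps_psum r N g"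
proof -
  define p where "p = (\<lambda>i j. (\<bar>fps_nth f i\<bar> * r ^ i) * (\<bar>fps_nth g j\<bar> * r ^ j))"
  have p_nonneg: "0 \<le> p i j" for i j
    using assms by (simp add: p_def)
  have "fps_psum r N (f * g) \<le> (\<Sum>n<N. \<Sum>i\<le>n. p i (n - i))"
    unfolding fps_psum_def
  proof (intro sum_mono)
    fix n
    have "\<bar>fps_nth (f * g) n\<bar> \<le> (\<Sum>i\<le>n. \<bar>fps_nth f i\<bar> * \<bar>fps_nth g (n - i)\<bar>)"
      unfolding fps_mult_nth atLeast0AtMost
      by (rule order_trans[OF sum_abs]) (simp add: abs_mult)
    then have "\<bar>fps_nth (f * g) n\<bar> * r ^ n \<le> (\<Sum>i\<le>n. \<bar>fps_nth f i\<bar> * \<bar>fps_nth g (n - i)\<bar>) * r ^ n"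
      using assms by (intro mult_right_mono) simp_all
    also have "\<dots> = (\<Sum>i\<le>n. p i (n - i))"
      unfolding sum_distrib_right
    proof (rule sum.cong[OF refl])
      fix i assume "i \<in> {..n}"
      then have "r ^ n = r ^ i * r ^ (n - i)"
        by (simp add: power_add[symmetric])
      then show "\<bar>fps_nth f i\<bar> * \<bar>fps_nth g (n - i)\<bar> * r ^ n = p i (n - i)"
        by (simp add: p_def)
    qed
    finally show "\<bar>fps_nth (f * g) n\<bar> * r ^ n \<le> (\<Sum>i\<le>n. p i (n - i))" .
  qed
  also have "\<dots> = (\<Sum>(i, j)\<in>{(i, j). i + j < N}. p i j)"
    by (rule sum.triangle_reindex[symmetric])
  also have "\<dots> \<le> (\<Sum>(i, j)\<in>{..<N} \<times> {..<N}. p i j)"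
    by (rule sum_mono2) (auto simp: p_nonneg)
  also have "\<dots> = fps_psum r N f * fps_psum r N g"
    by (simp add: fps_psum_def sum_product sum.cartesian_product p_def)
  finally show ?thesis .
qed

lemma fps_conv_radius_pos_if_psum_bounded:
  assumes "r > 0" and "\<And>N. fps_psum r N f \<le> M"
  shows "fps_conv_radius f > 0"
proof -
  have "summable (\<lambda>n. \<bar>fps_nth f n\<bar> * r ^ n)"
  proof (rule bounded_imp_summable)
    show "0 \<le> \<bar>fps_nth f n\<bar> * r ^ n" for n
      using assms(1) by simp
    show "(\<Sum>k\<le>n. \<bar>fps_nth f k\<bar> * r ^ k) \<le> M" for n
      using assms(2)[of "Suc n"] by (simp add: fps_psum_def lessThan_Suc_atMost)
  qed
  then have "summable (\<lambda>n. fps_nth f n * r ^ n)"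
    using assms(1) summable_rabs_cancel[of "\<lambda>n. fps_nth f n * r ^ n"] by (simp add: abs_mult)
  then have "conv_radius (fps_nth f) \<ge> norm r"
    by (rule conv_radius_geI)
  then show ?thesis
    using assms(1) by (simp add: fps_conv_radius_def order.strict_trans2[where b = "ereal r"])
qed

text \<open>Passing from radius \<open>\<rho>\<close> to \<open>t * \<rho>\<close> with
  \<open>t \<le> 1\<close> multiplies each term of positive degree by at most \<open>t\<close>, and
  there is no term of degree 0. So one radius serves all truncations.\<close>

lemma fps_psum_small:
  assumes "fps_conv_radius f > 0" and "fps_nth f 0 = 0" and "\<epsilon> > 0"
  shows "\<exists>r0>0. \<forall>r N. 0 \<le> r \<and> r \<le> r0 \<longrightarrow> fps_psum r N f \<le> \<epsilon>"
proof -
  obtain \<rho> where \<rho>: "\<rho> > 0" "ereal \<rho> < fps_conv_radius f"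
    using ereal_dense2[OF assms(1)] by auto
  have "summable (\<lambda>n. norm (fps_nth f n * \<rho> ^ n))"
    using \<rho> by (intro norm_summable_fps) simp
  then have summ: "summable (\<lambda>n. \<bar>fps_nth f n\<bar> * \<rho> ^ n)"
    using \<rho>(1) by (simp add: abs_mult)
  define M where "M = (\<Sum>n. \<bar>fps_nth f n\<bar> * \<rho> ^ n)"
  have M: "fps_psum \<rho> N f \<le> M" for N
    unfolding fps_psum_def M_def using summ \<rho>(1) by (intro sum_le_suminf) auto
  have M0: "M \<ge> 0"
    using M[of 0] by (simp add: fps_psum_def)
  \<comment> \<open>The minimum with 1 gives \<open>t ^ n \<le> t\<close> for positive
    \<open>n\<close>; the \<open>M + 1\<close> keeps the quotient meaningful when \<open>M\<close>
    is 0.\<close>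
  define t where "t = min 1 (\<epsilon> / (M + 1))"
  have t: "0 < t" "t \<le> 1" "t * M \<le> \<epsilon>"
  proof -
    show "0 < t" "t \<le> 1"
      using assms(3) M0 by (auto simp: t_def)
    have "t * M \<le> \<epsilon> / (M + 1) * (M + 1)"
      using M0 assms(3) by (intro mult_mono) (auto simp: t_def)
    then show "t * M \<le> \<epsilon>"
      using M0 by simp
  qed
  show ?thesis
  proof (intro exI[of _ "t * \<rho>"] conjI allI impI)
    show "t * \<rho> > 0"
      using t \<rho> by simp
    fix r N assume r: "0 \<le> r \<and> r \<le> t * \<rho>"
    have "fps_psum r N f \<le> t * fps_psum \<rho> N f"
      unfolding fps_psum_def sum_distrib_left
    proof (intro sum_mono)
      fix n
      have "r ^ n \<le> (t * \<rho>) ^ n"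
        using r by (intro power_mono) auto
      also have "\<dots> \<le> t * \<rho> ^ n" if "n \<noteq> 0"
        using that t \<rho>(1) power_decreasing[of 1 n t]
        by (simp add: power_mult_distrib mult_right_mono)
      finally show "\<bar>fps_nth f n\<bar> * r ^ n \<le> t * (\<bar>fps_nth f n\<bar> * \<rho> ^ n)"
        using assms(2) by (cases "n = 0") (auto simp: mult.left_commute[of t] mult_left_mono)
    qed
    also have "\<dots> \<le> t * M"
      using M t by (intro mult_left_mono) auto
    finally show "fps_psum r N f \<le> \<epsilon>"
      using t by simp
  qed
qed

text \<open>Causality makes the Picard iteration stabilise coefficientwise, and the bound on the partial
  sums, valid for every iterate, makes the limit converge.\<close>

lemma fps_fixed_point:
  fixes \<Phi> :: "('j \<Rightarrow> real fps) \<Rightarrow> 'j \<Rightarrow> real fps" and J :: "'j set"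
  defines "\<B> \<equiv> \<lambda>r \<eta>. {x. \<forall>j\<in>J. fps_nth (x j) 0 = 0 \<and> (\<forall>N. fps_psum r N (x j) \<le> \<eta>)}"
  assumes "r > 0" "\<eta> \<ge> 0"
    and maps: "\<And>x. x \<in> \<B> r \<eta> \<Longrightarrow> \<Phi> x \<in> \<B> r \<eta>"
    and causal: "\<And>x y n j. x \<in> \<B> r \<eta> \<Longrightarrow> y \<in> \<B> r \<eta> \<Longrightarrow>
        (\<And>j. j \<in> J \<Longrightarrow> fps_X ^ n dvd x j - y j) \<Longrightarrow> j \<in> J \<Longrightarrow> fps_X ^ Suc n dvd \<Phi> x j - \<Phi> y j"
  shows "\<exists>x\<in>\<B> r \<eta>. \<forall>j\<in>J. \<Phi> x j = x j"
proof -
  define it where "it = (\<lambda>n. (\<Phi> ^^ n) (\<lambda>_. 0))"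
  have it_Suc: "it (Suc n) = \<Phi> (it n)" for n
    by (simp add: it_def)
  have itB: "it n \<in> \<B> r \<eta>" for n
    by (induction n) (use assms maps in \<open>auto simp: it_def \<B>_def\<close>)
  have step: "j \<in> J \<Longrightarrow> fps_X ^ n dvd it (Suc n) j - it n j" for n j
  proof (induction n arbitrary: j)
    case (Suc n)
    then show ?case
      using causal[OF itB[of "Suc n"] itB[of n], of n j] by (simp add: it_Suc)
  qed simp
  have tail: "fps_X ^ n dvd it (n + k) j - it n j" if "j \<in> J" for n k j
  proof (induction k)
    case (Suc k)
    have "fps_X ^ n dvd it (Suc (n + k)) j - it (n + k) j"
      using step[OF that, of "n + k"] by (meson dvd_trans le_add1 le_imp_power_dvd)
    from dvd_add[OF this Suc] show ?case
      by simp
  qed simp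
  have dvd_nth: "fps_nth f i = fps_nth g i" if "fps_X ^ n dvd f - g" "i < n" for f g :: "real fps" and n i
  proof -
    from that(1) obtain h where "f - g = fps_X ^ n * h"
      by (elim dvdE)
    then have "fps_nth (f - g) i = 0"
      using that(2) by (simp add: fps_X_power_mult_nth)
    then show ?thesis
      by simp
  qed
  have nth_dvd: "fps_X ^ n dvd f - g" if "\<And>i. i < n \<Longrightarrow> fps_nth f i = fps_nth g i" for f g :: "real fps" and n
  proof -
    have "f - g = fps_shift n (f - g) * fps_X ^ n"
      by (rule fps_ext) (use that in \<open>auto simp: fps_X_power_mult_right_nth\<close>)
    then show ?thesis
      by (metis dvd_triv_right)
  qed
  \<comment> \<open>Coefficient \<open>n\<close> is read off iterate \<open>Suc n\<close>, from
    which on it no longer changes.\<close>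
  define x where "x = (\<lambda>j. Abs_fps (\<lambda>n. fps_nth (it (Suc n) j) n))"
  have x_nth: "fps_nth (x j) i = fps_nth (it n j) i" if "j \<in> J" "i < n" for i j n
    using dvd_nth[OF tail[OF that(1), of "Suc i" "n - Suc i"], of i] that by (simp add: x_def)
  have x_it: "fps_X ^ n dvd x j - it n j" if "j \<in> J" for n j
    using x_nth that by (intro nth_dvd) auto
  have xB: "x \<in> \<B> r \<eta>"
    unfolding \<B>_def
  proof (intro CollectI ballI conjI allI)
    fix j N assume j: "j \<in> J"
    show "fps_nth (x j) 0 = 0"
      using x_nth[OF j, of 0 1] itB[of 1] j by (simp add: \<B>_def)
    \<comment> \<open>The truncated sum sees only coefficients below \<open>N\<close>, where the
      limit agrees with iterate \<open>N\<close>; the bound passes to the limit by equality.\<close>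
    have "fps_psum r N (x j) = fps_psum r N (it N j)"
      unfolding fps_psum_def using x_nth[OF j] by (intro sum.cong) auto
    then show "fps_psum r N (x j) \<le> \<eta>"
      using itB[of N] j by (simp add: \<B>_def)
  qed
  have "\<Phi> x j = x j" if j: "j \<in> J" for j
  proof (rule fps_ext)
    fix n
    have "fps_nth (\<Phi> x j) n = fps_nth (\<Phi> (it n) j) n"
      using causal[OF xB itB[of n] x_it[of _ n] j] by (intro dvd_nth) auto
    also have "\<dots> = fps_nth (x j) n"
      using x_nth[OF j, of n "Suc n"] by (simp add: it_Suc)
    finally show "fps_nth (\<Phi> x j) n = fps_nth (x j) n" .
  qed
  with xB show ?thesis
    by blast
qed

subsection \<open>Block splitting of symmetric power series matrices\<close>

lemma fps_conv_radius_pos_add: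
  "fps_conv_radius f > 0 \<Longrightarrow> fps_conv_radius g > 0 \<Longrightarrow> fps_conv_radius (f + g) > 0"
  by (rule less_le_trans[OF _ fps_conv_radius_add]) simp

lemma fps_conv_radius_pos_diff:
  "fps_conv_radius f > 0 \<Longrightarrow> fps_conv_radius g > 0 \<Longrightarrow> fps_conv_radius (f - g) > 0"
  by (rule less_le_trans[OF _ fps_conv_radius_diff]) simp

lemma fps_conv_radius_pos_mult:
  "fps_conv_radius f > 0 \<Longrightarrow> fps_conv_radius g > 0 \<Longrightarrow> fps_conv_radius (f * g) > 0"
  for f g :: "'a :: {banach, real_normed_field} fps"
  by (rule less_le_trans[OF _ fps_conv_radius_mult]) simp

lemma fps_conv_radius_pos_sum:
  "(\<And>k. k \<in> A \<Longrightarrow> fps_conv_radius (f k) > 0) \<Longrightarrow> fps_conv_radius (\<Sum>k\<in>A. f k) > 0"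
  by (induction A rule: infinite_finite_induct) (auto intro: fps_conv_radius_pos_add)

text \<open>Square matrices over a finite index set are functions of two indices. Their values outside
  the index set carry no meaning.\<close>

definition mmul :: "'i set \<Rightarrow> ('i \<Rightarrow> 'i \<Rightarrow> 'a) \<Rightarrow> ('i \<Rightarrow> 'i \<Rightarrow> 'a) \<Rightarrow> 'i \<Rightarrow> 'i \<Rightarrow> 'a :: comm_ring_1"
  where "mmul I a b i j = (\<Sum>k\<in>I. a i k * b k j)"

definition dmat :: "('i \<Rightarrow> 'a) \<Rightarrow> 'i \<Rightarrow> 'i \<Rightarrow> 'a :: comm_ring_1"
  where "dmat d i j = (if i = j then d i else 0)"

definition mtr :: "('i \<Rightarrow> 'i \<Rightarrow> 'a) \<Rightarrow> 'i \<Rightarrow> 'i \<Rightarrow> 'a"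
  where "mtr a i j = a j i"

text \<open>Equality has to be relative to \<open>I\<close>, since already multiplication by the
  identity fails to reproduce entries outside \<open>I\<close>. Index sets in place of dimensions
  let the recursions pass to arbitrary subsets without renumbering.\<close>

definition meq :: "'i set \<Rightarrow> ('i \<Rightarrow> 'i \<Rightarrow> 'a) \<Rightarrow> ('i \<Rightarrow> 'i \<Rightarrow> 'a) \<Rightarrow> bool"
  where "meq I a b \<longleftrightarrow> (\<forall>i\<in>I. \<forall>j\<in>I. a i j = b i j)"

lemma meq_refl [simp]: "meq I a a"
  by (simp add: meq_def)

lemma meq_sym: "meq I a b \<Longrightarrow> meq I b a"
  by (simp add: meq_def)

lemma meq_trans [trans]: "meq I a b \<Longrightarrow> meq I b c \<Longrightarrow> meq I a c"
  by (simp add: meq_def)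

lemma meqD: "meq I a b \<Longrightarrow> i \<in> I \<Longrightarrow> j \<in> I \<Longrightarrow> a i j = b i j"
  by (simp add: meq_def)

lemma mmul_cong: "meq I a a' \<Longrightarrow> meq I b b' \<Longrightarrow> meq I (mmul I a b) (mmul I a' b')"
  by (simp add: meq_def mmul_def)

lemma mmul_assoc: "mmul I (mmul I a b) c = mmul I a (mmul I b c)"
proof (intro ext)
  fix i j
  have "mmul I (mmul I a b) c i j = (\<Sum>k\<in>I. \<Sum>l\<in>I. a i l * b l k * c k j)"
    by (simp add: mmul_def sum_distrib_right)
  also have "\<dots> = (\<Sum>l\<in>I. \<Sum>k\<in>I. a i l * b l k * c k j)"
    by (rule sum.swap)
  finally show "mmul I (mmul I a b) c i j = mmul I a (mmul I b c) i j"
    by (simp add: mmul_def sum_distrib_left mult.assoc)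
qed

lemma mtr_mmul: "mtr (mmul I a b) = mmul I (mtr b) (mtr a)"
  by (simp add: fun_eq_iff mmul_def mtr_def mult.commute)

lemma mtr_mtr [simp]: "mtr (mtr a) = a"
  by (simp add: fun_eq_iff mtr_def)

lemma mtr_dmat [simp]: "mtr (dmat d) = dmat d"
  by (auto simp: fun_eq_iff mtr_def dmat_def)

lemma mtr_cong: "meq I a b \<Longrightarrow> meq I (mtr a) (mtr b)"
  by (simp add: meq_def mtr_def)

lemma mmul_dmat_left: "finite I \<Longrightarrow> i \<in> I \<Longrightarrow> mmul I (dmat d) a i j = d i * a i j"
  by (simp add: mmul_def dmat_def if_distrib[of "\<lambda>x. x * _"] cong: if_cong)

lemma mmul_dmat_right: "finite I \<Longrightarrow> j \<in> I \<Longrightarrow> mmul I a (dmat d) i j = a i j * d j"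
  by (simp add: mmul_def dmat_def if_distrib[of "\<lambda>x. _ * x"] cong: if_cong)

lemma mmul_one_left: "finite I \<Longrightarrow> meq I (mmul I (dmat (\<lambda>_. 1)) a) a"
  by (simp add: meq_def mmul_dmat_left)

lemma mmul_add_left: "mmul I (\<lambda>i j. a i j + b i j) c i j = mmul I a c i j + mmul I b c i j"
  by (simp add: mmul_def distrib_right sum.distrib)

lemma mmul_add_right: "mmul I a (\<lambda>i j. b i j + c i j) i j = mmul I a b i j + mmul I a c i j"
  by (simp add: mmul_def distrib_left sum.distrib)

lemma fps_psum_mmul_le:
  assumes "r \<ge> 0" "i \<in> I" "j \<in> I" "\<beta> \<ge> 0"
    and "\<And>i j. i \<in> I \<Longrightarrow> j \<in> I \<Longrightarrow> fps_psum r N (a i j) \<le> \<alpha>"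
    and "\<And>i j. i \<in> I \<Longrightarrow> j \<in> I \<Longrightarrow> fps_psum r N (b i j) \<le> \<beta>"
  shows "fps_psum r N (mmul I a b i j) \<le> real (card I) * (\<alpha> * \<beta>)"
proof -
  have \<alpha>: "0 \<le> \<alpha>"
    using fps_psum_nonneg[OF assms(1)] assms(2,3,5) order_trans by blast
  have "fps_psum r N (mmul I a b i j) \<le> (\<Sum>k\<in>I. fps_psum r N (a i k * b k j))"
    unfolding mmul_def by (rule fps_psum_sum_le[OF assms(1)])
  also have "\<dots> \<le> (\<Sum>k\<in>I. (\<alpha> * \<beta> :: real))"
  proof (rule sum_mono)
    fix k assume "k \<in> I"
    then show "fps_psum r N (a i k * b k j) \<le> \<alpha> * \<beta>"
      using assms \<alpha> by (intro order_trans[OF fps_psum_mult_le] mult_mono) (auto intro: fps_psum_nonneg)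
  qed
  finally show ?thesis
    by simp
qed

lemma mmul_diff_mmul:
  "mmul I a b i j - mmul I a' b' i j =
     (\<Sum>k\<in>I. a i k * (b k j - b' k j) + (a i k - a' i k) * b' k j)"
  by (simp add: mmul_def sum_subtractf[symmetric] algebra_simps)

text \<open>Source of causality: multiplying by a series that vanishes at 0 raises the order of
  agreement by one.\<close>

lemma fps_X_power_Suc_dvd_mult:
  fixes f g :: "real fps"
  assumes "fps_nth f 0 = 0" "fps_X ^ n dvd g"
  shows "fps_X ^ Suc n dvd f * g" "fps_X ^ Suc n dvd g * f"
proof -
  have "f = fps_X * fps_shift 1 f"
    using assms(1) by (intro fps_ext) simp
  then have "fps_X dvd f"
    by (metis dvd_triv_left)
  from mult_dvd_mono[OF this assms(2)] show "fps_X ^ Suc n dvd f * g" "fps_X ^ Suc n dvd g * f"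
    by (simp_all add: mult.commute)
qed

lemma fps_eq_0_if_all_X_powers_dvd:
  fixes f :: "real fps"
  assumes "\<And>n. fps_X ^ n dvd f"
  shows "f = 0"
proof (rule fps_ext)
  fix n
  obtain h where "f = fps_X ^ Suc n * h"
    using assms[of "Suc n"] by (elim dvdE)
  then show "fps_nth f n = fps_nth 0 n"
    by (simp add: fps_X_power_mult_nth del: power_Suc)
qed

text \<open>With \<open>w = 1 + z\<close> and \<open>b = diag lam + f\<close>, these equations are the entries of
  \<open>(diag lam + e) w = w b\<close>, together with \<open>f = 0\<close> off the diagonal blocks and \<open>w\<^sup>T w = 1\<close> on them.
  The off-diagonal part of \<open>w\<^sup>T w = 1\<close> is then automatic.\<close>

lemma block_system_solvable:
  fixes e :: "'i \<Rightarrow> 'i \<Rightarrow> real fps" and lam :: "'i \<Rightarrow> real"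
  assumes fin: "finite I"
    and conv: "\<And>i j. i \<in> I \<Longrightarrow> j \<in> I \<Longrightarrow> fps_conv_radius (e i j) > 0"
    and e0: "\<And>i j. i \<in> I \<Longrightarrow> j \<in> I \<Longrightarrow> fps_nth (e i j) 0 = 0"
  shows "\<exists>z f. \<forall>i\<in>I. \<forall>j\<in>I. fps_conv_radius (z i j) > 0 \<and> fps_conv_radius (f i j) > 0 \<and>
           fps_nth (z i j) 0 = 0 \<and> fps_nth (f i j) 0 = 0 \<and>
           (if lam i = lam j
            then f i j = e i j + mmul I e z i j - mmul I z f i j \<and>
                 z i j = fps_const (- 1 / 2) * mmul I (mtr z) z i j
            else f i j = 0 \<and>
                 fps_const (lam i - lam j) * z i j = - (e i j + mmul I e z i j - mmul I z f i j))"
proof -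
  \<comment> \<open>Inside a block the quotient is \<open>1 / 0 = 0\<close> and adds nothing to
    \<open>C\<close>, which bounds every \<open>\<bar>c i j\<bar>\<close>. The summand 1 makes
    \<open>C\<close> at least 1, so one estimate covers the equations with and without
    division.\<close>
  define c where "c = (\<lambda>i j. 1 / (lam i - lam j))"
  define C where "C = 1 + (\<Sum>i\<in>I. \<Sum>j\<in>I. \<bar>c i j\<bar>)"
  define n :: real where "n = real (card I)"
  \<comment> \<open>Chosen so that \<open>C * (n * \<eta>) \<le> 1 / 4\<close>, while
    \<open>\<epsilon>\<close> gives \<open>C * \<epsilon> = \<eta> / 4\<close>. The three terms of
    \<open>G\<close>, multiplied by \<open>C\<close>, then cost at most \<open>\<eta> / 4\<close>,
    \<open>\<eta> / 16\<close> and \<open>\<eta> / 4\<close>. The \<open>n + 1\<close> covers an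
    empty index set.\<close>
  define \<eta> where "\<eta> = 1 / (4 * C * (n + 1))"
  define \<epsilon> where "\<epsilon> = \<eta> / (4 * C)"
  have C1: "C \<ge> 1"
    by (simp add: C_def sum_nonneg)
  have cC: "\<bar>c i j\<bar> \<le> C" if "i \<in> I" "j \<in> I" for i j
  proof -
    have "\<bar>c i j\<bar> \<le> (\<Sum>j\<in>I. \<bar>c i j\<bar>)"
      using fin that by (intro member_le_sum) auto
    also have "\<dots> \<le> (\<Sum>i\<in>I. \<Sum>j\<in>I. \<bar>c i j\<bar>)"
      using fin that by (intro member_le_sum[of i I "\<lambda>i. \<Sum>j\<in>I. \<bar>c i j\<bar>"]) (auto intro: sum_nonneg)
    finally show ?thesis
      by (simp add: C_def)
  qed
  have n0: "n \<ge> 0"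
    by (simp add: n_def)
  have \<eta>0: "\<eta> > 0" and \<epsilon>0: "\<epsilon> > 0"
    using C1 n0 by (simp_all add: \<eta>_def \<epsilon>_def)
  have Cn\<eta>: "C * (n * \<eta>) \<le> 1 / 4"
  proof -
    have "C * (n * \<eta>) = n / (4 * (n + 1))"
      using C1 mult_divide_mult_cancel_left[of C n "4 * (n + 1)"] by (simp add: \<eta>_def ac_simps)
    moreover have "n / (4 * (n + 1)) \<le> 1 / 4"
      using n0 by (simp add: divide_simps)
    ultimately show ?thesis
      by linarith
  qed
  have n\<eta>: "n * \<eta> \<le> 1 / 4"
    using C1 n0 \<eta>0 mult_right_mono[of 1 C "n * \<eta>"] Cn\<eta> by simp
  have C\<epsilon>: "C * \<epsilon> = \<eta> / 4"
    using C1 by (simp add: \<epsilon>_def)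
  have bound: "C * (\<epsilon> + n * (\<epsilon> * \<eta>) + n * (\<eta> * \<eta>)) \<le> \<eta>"
  proof -
    have "C * (\<epsilon> + n * (\<epsilon> * \<eta>) + n * (\<eta> * \<eta>)) = C * \<epsilon> + C * \<epsilon> * (n * \<eta>) + C * (n * \<eta>) * \<eta>"
      by (simp add: algebra_simps)
    also have "\<dots> \<le> \<eta> / 4 + \<eta> / 4 * (1 / 4) + 1 / 4 * \<eta>"
      unfolding C\<epsilon> using \<eta>0 n0 n\<eta> Cn\<eta> by (intro add_mono mult_mono) auto
    also have "\<dots> \<le> \<eta>"
      using \<eta>0 by simp
    finally show ?thesis .
  qed
  have "\<forall>p\<in>I \<times> I. \<exists>r0>0. \<forall>r N. 0 \<le> r \<and> r \<le> r0 \<longrightarrow> fps_psum r N (e (fst p) (snd p)) \<le> \<epsilon>"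
    using fps_psum_small[OF conv e0 \<epsilon>0] by auto
  then obtain r0 where r0: "\<And>p. p \<in> I \<times> I \<Longrightarrow> r0 p > (0::real)"
      "\<And>p r N. p \<in> I \<times> I \<Longrightarrow> 0 \<le> r \<Longrightarrow> r \<le> r0 p \<Longrightarrow> fps_psum r N (e (fst p) (snd p)) \<le> \<epsilon>"
    by metis
  define r where "r = Min (insert 1 (r0 ` (I \<times> I)))"
  have r: "r > 0"
    unfolding r_def using fin r0(1) by (subst Min_gr_iff) auto
  have e_small: "fps_psum r N (e i j) \<le> \<epsilon>" if "i \<in> I" "j \<in> I" for i j N
  proof -
    have "r \<le> r0 (i, j)"
      unfolding r_def using fin that by (intro Min_le) auto
    then show ?thesis
      using r0(2)[of "(i, j)" r N] that r by simp
  qed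
  \<comment> \<open>The two unknown matrices become one family for the fixed point lemma: the tag
    \<open>True\<close> marks \<open>z\<close>, the tag \<open>False\<close> marks
    \<open>f\<close>.\<close>
  define Z where "Z = (\<lambda>(x :: bool \<times> 'i \<times> 'i \<Rightarrow> real fps) i j. x (True, i, j))"
  define F where "F = (\<lambda>(x :: bool \<times> 'i \<times> 'i \<Rightarrow> real fps) i j. x (False, i, j))"
  define G where "G = (\<lambda>x i j. e i j + mmul I e (Z x) i j - mmul I (Z x) (F x) i j)"
  \<comment> \<open>The system solved for its linear part: off the blocks the equation for
    \<open>z\<close> is divided by \<open>lam i - lam j\<close>; on the blocks \<open>z\<close>
    comes from orthogonality and \<open>f\<close> from the intertwining relation.\<close>
  define \<Phi> where "\<Phi> = (\<lambda>x (b, i, j).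
    if b then (if lam i = lam j then fps_const (- 1 / 2) * mmul I (mtr (Z x)) (Z x) i j
               else fps_const (- c i j) * G x i j)
    else (if lam i = lam j then G x i j else 0))"
  define J where "J = (UNIV :: bool set) \<times> I \<times> I"
  define \<B> where "\<B> = {x. \<forall>j\<in>J. fps_nth (x j) 0 = 0 \<and> (\<forall>N. fps_psum r N (x j) \<le> \<eta>)}"
  have B: "fps_nth (Z x i j) 0 = 0" "fps_nth (F x i j) 0 = 0"
      "fps_psum r N (Z x i j) \<le> \<eta>" "fps_psum r N (F x i j) \<le> \<eta>"
    if "x \<in> \<B>" "i \<in> I" "j \<in> I" for x i j N
    using that by (auto simp: \<B>_def J_def Z_def F_def)
  have mmul_0: "fps_nth (mmul I a b i j) 0 = 0"
    if "\<And>i j. i \<in> I \<Longrightarrow> j \<in> I \<Longrightarrow> fps_nth (a i j) 0 = 0" "i \<in> I"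
    for a b :: "'i \<Rightarrow> 'i \<Rightarrow> real fps" and i j
    using that by (simp add: mmul_def fps_sum_nth)
  have G_psum: "C * fps_psum r N (G x i j) \<le> \<eta>" if x: "x \<in> \<B>" and ij: "i \<in> I" "j \<in> I" for x i j N
  proof -
    have "fps_psum r N (mmul I e (Z x) i j) \<le> n * (\<epsilon> * \<eta>)"
      unfolding n_def using r ij \<eta>0 e_small B[OF x] by (intro fps_psum_mmul_le) auto
    moreover have "fps_psum r N (mmul I (Z x) (F x) i j) \<le> n * (\<eta> * \<eta>)"
      unfolding n_def using r ij \<eta>0 e_small B[OF x] by (intro fps_psum_mmul_le) auto
    moreover have "fps_psum r N (G x i j) \<le> fps_psum r N (e i j) + fps_psum r N (mmul I e (Z x) i j)
        + fps_psum r N (mmul I (Z x) (F x) i j)"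
      unfolding G_def using r
      by (intro order_trans[OF fps_psum_diff_le] add_mono fps_psum_add_le order_refl) auto
    ultimately have "fps_psum r N (G x i j) \<le> \<epsilon> + n * (\<epsilon> * \<eta>) + n * (\<eta> * \<eta>)"
      using e_small[OF ij, of N] by linarith
    then have "C * fps_psum r N (G x i j) \<le> C * (\<epsilon> + n * (\<epsilon> * \<eta>) + n * (\<eta> * \<eta>))"
      using C1 by (intro mult_left_mono) auto
    with bound show ?thesis
      by linarith
  qed
  have G_0: "fps_nth (G x i j) 0 = 0" if x: "x \<in> \<B>" and ij: "i \<in> I" "j \<in> I" for x i j
    using mmul_0[of e i "Z x" j] mmul_0[of "Z x" i "F x" j] B[OF x] ij e0 by (simp add: G_def)
  have maps: "\<Phi> x \<in> \<B>" if x: "x \<in> \<B>" for x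
    unfolding \<B>_def
  proof (intro CollectI ballI conjI allI)
    fix p N assume "p \<in> J"
    then obtain b i j where p: "p = (b, i, j)" and ij: "i \<in> I" "j \<in> I"
      by (auto simp: J_def)
    show "fps_nth (\<Phi> x p) 0 = 0"
      using G_0[OF x ij] mmul_0[of "mtr (Z x)" i "Z x" j] B[OF x] ij by (simp add: p \<Phi>_def mtr_def)
    have "fps_psum r N (G x i j) \<le> C * fps_psum r N (G x i j)"
      using C1 fps_psum_nonneg[of r N "G x i j"] r mult_right_mono[of 1 C] by fastforce
    then have 1: "fps_psum r N (G x i j) \<le> \<eta>"
      using G_psum[OF x ij, of N] by linarith
    have "\<bar>c i j\<bar> * fps_psum r N (G x i j) \<le> C * fps_psum r N (G x i j)"
      using cC[OF ij] r by (intro mult_right_mono fps_psum_nonneg) auto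
    then have 2: "\<bar>c i j\<bar> * fps_psum r N (G x i j) \<le> \<eta>"
      using G_psum[OF x ij, of N] by linarith
    have "fps_psum r N (mmul I (mtr (Z x)) (Z x) i j) \<le> n * (\<eta> * \<eta>)"
      unfolding n_def using r ij \<eta>0 B[OF x] by (intro fps_psum_mmul_le) (auto simp: mtr_def)
    also have "\<dots> \<le> \<eta>"
      using mult_right_mono[OF n\<eta>, of \<eta>] \<eta>0 by (simp add: mult.assoc)
    finally have 3: "fps_psum r N (mmul I (mtr (Z x)) (Z x) i j) \<le> \<eta>" .
    show "fps_psum r N (\<Phi> x p) \<le> \<eta>"
      using 1 2 3 \<eta>0 fps_psum_nonneg[of r N "mmul I (mtr (Z x)) (Z x) i j"] r
      by (auto simp: p \<Phi>_def fps_psum_const_mult)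
  qed
  \<comment> \<open>Every unknown is multiplied by a series vanishing at 0: entries of
    \<open>e\<close> by hypothesis, entries of \<open>z\<close> and \<open>f\<close> by membership
    in \<open>\<B>\<close>. This yields the extra order.\<close>
  have causal: "fps_X ^ Suc m dvd \<Phi> x p - \<Phi> y p"
    if x: "x \<in> \<B>" and y: "y \<in> \<B>" and xy: "\<And>p. p \<in> J \<Longrightarrow> fps_X ^ m dvd x p - y p" and "p \<in> J"
    for x y m p
  proof -
    obtain b i j where p: "p = (b, i, j)" and ij: "i \<in> I" "j \<in> I"
      using \<open>p \<in> J\<close> by (auto simp: J_def)
    have Zd: "fps_X ^ m dvd Z x i j - Z y i j" and Fd: "fps_X ^ m dvd F x i j - F y i j"
      if "i \<in> I" "j \<in> I" for i j
      using xy[of "(True, i, j)"] xy[of "(False, i, j)"] that by (auto simp: J_def Z_def F_def)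
    have "fps_X ^ Suc m dvd mmul I e (Z x) i j - mmul I e (Z y) i j"
      using e0 ij Zd
      by (auto simp: mmul_diff_mmul simp del: power_Suc intro!: dvd_sum fps_X_power_Suc_dvd_mult(1))
    moreover have "fps_X ^ Suc m dvd mmul I (Z x) (F x) i j - mmul I (Z y) (F y) i j"
      unfolding mmul_diff_mmul using B[OF x] B[OF y] ij Zd Fd
      by (intro dvd_sum dvd_add fps_X_power_Suc_dvd_mult) auto
    moreover have "G x i j - G y i j = (mmul I e (Z x) i j - mmul I e (Z y) i j)
        - (mmul I (Z x) (F x) i j - mmul I (Z y) (F y) i j)"
      by (simp add: G_def)
    ultimately have 1: "fps_X ^ Suc m dvd G x i j - G y i j"
      by (metis dvd_diff)
    have 2: "fps_X ^ Suc m dvd mmul I (mtr (Z x)) (Z x) i j - mmul I (mtr (Z y)) (Z y) i j"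
      unfolding mmul_diff_mmul using B[OF x] B[OF y] ij Zd
      by (intro dvd_sum dvd_add fps_X_power_Suc_dvd_mult) (auto simp: mtr_def)
    show ?thesis
      using dvd_mult[OF 1, of "fps_const (- c i j)"] 1 dvd_mult[OF 2, of "fps_const (- 1 / 2)"]
      by (auto simp: p \<Phi>_def right_diff_distrib simp del: power_Suc)
  qed
  obtain x where xB: "x \<in> \<B>" and fix_x: "\<And>p. p \<in> J \<Longrightarrow> \<Phi> x p = x p"
    using fps_fixed_point[of r \<eta> J \<Phi>, folded \<B>_def] r \<eta>0 maps causal by (metis less_imp_le)
  have cl: "fps_const (lam i - lam j) * (fps_const (- c i j) * g) = - g" if "lam i \<noteq> lam j" for i j g
  proof -
    have "(lam i - lam j) * - c i j = - 1"
      using that by (simp add: c_def field_simps)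
    then show ?thesis
      by (metis fps_const_1_eq_1 fps_const_mult fps_const_neg mult.assoc mult_minus1)
  qed
  show ?thesis
  proof (rule exI[of _ "Z x"], rule exI[of _ "F x"], intro ballI)
    fix i j assume ij: "i \<in> I" "j \<in> I"
    have J: "(b, i, j) \<in> J" for b
      using ij by (simp add: J_def)
    have Zx: "Z x i j = (if lam i = lam j then fps_const (- 1 / 2) * mmul I (mtr (Z x)) (Z x) i j
               else fps_const (- c i j) * G x i j)"
      using fix_x[OF J[of True]] by (simp add: \<Phi>_def Z_def)
    have Fx: "F x i j = (if lam i = lam j then G x i j else 0)"
      using fix_x[OF J[of False]] by (simp add: \<Phi>_def F_def)
    show "fps_conv_radius (Z x i j) > 0 \<and> fps_conv_radius (F x i j) > 0 \<and>
           fps_nth (Z x i j) 0 = 0 \<and> fps_nth (F x i j) 0 = 0 \<and>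
           (if lam i = lam j
            then F x i j = e i j + mmul I e (Z x) i j - mmul I (Z x) (F x) i j \<and>
                 Z x i j = fps_const (- 1 / 2) * mmul I (mtr (Z x)) (Z x) i j
            else F x i j = 0 \<and>
                 fps_const (lam i - lam j) * Z x i j = - (e i j + mmul I e (Z x) i j - mmul I (Z x) (F x) i j))"
      using Zx Fx cl[of i j "G x i j"] B[OF xB ij] fps_conv_radius_pos_if_psum_bounded[OF r]
      unfolding G_def by metis
  qed
qed

lemma mmul_orthogonal:
  assumes "finite I" "meq I (mmul I (mtr v) v) (dmat (\<lambda>_. 1))" "meq I (mmul I (mtr w) w) (dmat (\<lambda>_. 1))"
  shows "meq I (mmul I (mtr (mmul I v w)) (mmul I v w)) (dmat (\<lambda>_. 1))"
proof -
  have "meq I (mmul I (mtr (mmul I v w)) (mmul I v w)) (mmul I (mtr w) (mmul I (mmul I (mtr v) v) w))"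
    by (simp add: mtr_mmul mmul_assoc)
  also have "meq I \<dots> (mmul I (mtr w) (mmul I (dmat (\<lambda>_. 1)) w))"
    by (intro mmul_cong assms meq_refl)
  also have "meq I \<dots> (mmul I (mtr w) w)"
    by (rule mmul_cong[OF meq_refl mmul_one_left[OF assms(1)]])
  also have "meq I \<dots> (dmat (\<lambda>_. 1))"
    by (rule assms)
  finally show ?thesis .
qed

lemma mmul_intertwine:
  assumes "meq I (mmul I a v) (mmul I v b)" "meq I (mmul I b w) (mmul I w c)"
  shows "meq I (mmul I a (mmul I v w)) (mmul I (mmul I v w) c)"
proof -
  have "meq I (mmul I (mmul I a v) w) (mmul I (mmul I v b) w)"
    by (intro mmul_cong assms meq_refl)
  moreover have "meq I (mmul I v (mmul I b w)) (mmul I v (mmul I w c))"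
    by (intro mmul_cong assms meq_refl)
  ultimately show ?thesis
    unfolding mmul_assoc by (rule meq_trans)
qed

text \<open>Multiplying the intertwining relation on the left by the transpose of \<open>w\<close>
  gives \<open>b = w^T a w\<close>, a congruence transform of a symmetric matrix.\<close>

lemma symmetric_if_intertwined:
  assumes "finite I" "meq I (mtr a) a" "meq I (mmul I a w) (mmul I w b)"
    and "meq I (mmul I (mtr w) w) (dmat (\<lambda>_. 1))"
  shows "meq I (mtr b) b"
proof -
  have "meq I (mmul I (mtr w) (mmul I a w)) (mmul I (mmul I (mtr w) w) b)"
    unfolding mmul_assoc by (intro mmul_cong assms meq_refl)
  also have "meq I \<dots> (mmul I (dmat (\<lambda>_. 1)) b)"
    by (intro mmul_cong assms meq_refl)
  also have "meq I \<dots> b"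
    by (rule mmul_one_left[OF assms(1)])
  finally have b: "meq I (mmul I (mtr w) (mmul I a w)) b" .
  have "meq I (mtr b) (mtr (mmul I (mtr w) (mmul I a w)))"
    by (rule mtr_cong[OF meq_sym[OF b]])
  also have "meq I \<dots> (mmul I (mtr w) (mmul I (mtr a) w))"
    by (simp add: mtr_mmul mmul_assoc)
  also have "meq I \<dots> (mmul I (mtr w) (mmul I a w))"
    by (intro mmul_cong assms meq_refl)
  also have "meq I \<dots> b"
    by (rule b)
  finally show ?thesis .
qed

text \<open>\<open>lam\<close> may repeat values, and \<open>b\<close> becomes block diagonal along
  its level sets. The relation \<open>a w = w b\<close> restates the solved system entry by entry;
  the work lies in \<open>w^T w = 1\<close>, which the equations impose only on the blocks and which
  symmetry of \<open>a\<close> forces elsewhere.\<close>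

lemma symmetric_fps_splitting:
  fixes a :: "'i \<Rightarrow> 'i \<Rightarrow> real fps" and lam :: "'i \<Rightarrow> real"
  assumes fin: "finite I" and sym: "meq I (mtr a) a"
    and conv: "\<And>i j. i \<in> I \<Longrightarrow> j \<in> I \<Longrightarrow> fps_conv_radius (a i j) > 0"
    and a0: "\<And>i j. i \<in> I \<Longrightarrow> j \<in> I \<Longrightarrow> fps_nth (a i j) 0 = dmat lam i j"
  shows "\<exists>w b. (\<forall>i\<in>I. \<forall>j\<in>I. fps_conv_radius (w i j) > 0 \<and> fps_conv_radius (b i j) > 0 \<and>
                  (lam i \<noteq> lam j \<longrightarrow> b i j = 0)) \<and>
               meq I (mmul I a w) (mmul I w b) \<and> meq I (mmul I (mtr w) w) (dmat (\<lambda>_. 1))"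
proof -
  define L where "L = (\<lambda>i. fps_const (lam i))"
  define e where "e = (\<lambda>i j. a i j - dmat L i j)"
  have "\<exists>z f. \<forall>i\<in>I. \<forall>j\<in>I. fps_conv_radius (z i j) > 0 \<and> fps_conv_radius (f i j) > 0 \<and>
           fps_nth (z i j) 0 = 0 \<and> fps_nth (f i j) 0 = 0 \<and>
           (if lam i = lam j
            then f i j = e i j + mmul I e z i j - mmul I z f i j \<and>
                 z i j = fps_const (- 1 / 2) * mmul I (mtr z) z i j
            else f i j = 0 \<and>
                 fps_const (lam i - lam j) * z i j = - (e i j + mmul I e z i j - mmul I z f i j))"
    using fin
  proof (rule block_system_solvable)
    fix i j assume ij: "i \<in> I" "j \<in> I"
    show "fps_conv_radius (e i j) > 0"
      using conv[OF ij] by (auto simp: e_def dmat_def L_def intro!: fps_conv_radius_pos_diff)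
    show "fps_nth (e i j) 0 = 0"
      using a0[OF ij] by (auto simp: e_def dmat_def L_def)
  qed
  then obtain z f where
      zf_conv: "\<And>i j. i \<in> I \<Longrightarrow> j \<in> I \<Longrightarrow> fps_conv_radius (z i j) > 0"
        "\<And>i j. i \<in> I \<Longrightarrow> j \<in> I \<Longrightarrow> fps_conv_radius (f i j) > 0"
      and f0: "\<And>i j. i \<in> I \<Longrightarrow> j \<in> I \<Longrightarrow> fps_nth (f i j) 0 = 0"
      and zf: "\<And>i j. i \<in> I \<Longrightarrow> j \<in> I \<Longrightarrow>
           (if lam i = lam j
            then f i j = e i j + mmul I e z i j - mmul I z f i j \<and>
                 z i j = fps_const (- 1 / 2) * mmul I (mtr z) z i j
            else f i j = 0 \<and>
                 fps_const (lam i - lam j) * z i j = - (e i j + mmul I e z i j - mmul I z f i j))"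
    by blast
  define w where "w = (\<lambda>i j. dmat (\<lambda>_. 1) i j + z i j)"
  define b where "b = (\<lambda>i j. dmat L i j + f i j)"
  define p where "p = mmul I (mtr w) w"
  have inter: "meq I (mmul I a w) (mmul I w b)"
    unfolding meq_def
  proof (intro ballI)
    fix i j assume ij: "i \<in> I" "j \<in> I"
    have "mmul I a w i j = a i j + mmul I (\<lambda>i j. dmat L i j + e i j) z i j"
      unfolding w_def mmul_add_right e_def using fin ij by (simp add: mmul_dmat_right)
    also have "\<dots> = a i j + L i * z i j + mmul I e z i j"
      unfolding mmul_add_left using fin ij by (simp add: mmul_dmat_left)
    finally have 1: "mmul I a w i j = a i j + L i * z i j + mmul I e z i j" .
    have "mmul I w b i j = b i j + mmul I z (\<lambda>i j. dmat L i j + f i j) i j"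
      unfolding w_def mmul_add_left b_def using fin ij by (simp add: mmul_dmat_left)
    also have "\<dots> = b i j + z i j * L j + mmul I z f i j"
      unfolding mmul_add_right using fin ij by (simp add: mmul_dmat_right)
    finally have 2: "mmul I w b i j = b i j + z i j * L j + mmul I z f i j" .
    have "fps_const (lam i - lam j) = L i - L j"
      by (simp add: L_def)
    then have "(L i - L j) * z i j + (e i j + mmul I e z i j - mmul I z f i j) - f i j = 0"
      using zf[OF ij] by (auto simp: L_def split: if_splits)
    moreover have "a i j = e i j + dmat L i j" "b i j = dmat L i j + f i j"
      by (simp_all add: e_def b_def)
    then have "mmul I a w i j - mmul I w b i j
        = (L i - L j) * z i j + (e i j + mmul I e z i j - mmul I z f i j) - f i j"
      unfolding 1 2 by (simp add: algebra_simps)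
    ultimately show "mmul I a w i j = mmul I w b i j"
      by simp
  qed
  have p_diag: "p i j = dmat (\<lambda>_. 1) i j" if ij: "i \<in> I" "j \<in> I" "lam i = lam j" for i j
  proof -
    have w': "mtr w = (\<lambda>i j. dmat (\<lambda>_. 1) i j + mtr z i j)"
      by (auto simp: fun_eq_iff mtr_def w_def dmat_def)
    have "p i j = w i j + mmul I (mtr z) w i j"
      unfolding p_def w' mmul_add_left using fin ij by (simp add: mmul_dmat_left)
    also have "mmul I (mtr z) w i j = mtr z i j + mmul I (mtr z) z i j"
      unfolding w_def mmul_add_right using fin ij by (simp add: mmul_dmat_right)
    finally have p: "p i j = dmat (\<lambda>_. 1) i j + z i j + z j i + mmul I (mtr z) z i j"
      by (simp add: w_def mtr_def)
    \<comment> \<open>On a block \<open>z\<close> is \<open>- 1 / 2\<close> times the symmetric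
      matrix \<open>z^T z\<close>, so \<open>z + z^T = - z^T z\<close> there. Requiring
      \<open>z\<close> to be symmetric on the blocks removes the freedom of rotating within a
      block.\<close>
    have "mmul I (mtr z) z j i = mmul I (mtr z) z i j"
      using mtr_mmul[of I "mtr z" z] by (simp add: fun_eq_iff mtr_def)
    then have z: "z i j = fps_const (- 1 / 2) * mmul I (mtr z) z i j"
        "z j i = fps_const (- 1 / 2) * mmul I (mtr z) z i j"
      using zf[OF ij(1,2)] zf[OF ij(2,1)] ij(3) by simp_all
    have "z i j + z j i = (fps_const (- 1 / 2) + fps_const (- 1 / 2)) * mmul I (mtr z) z i j"
      using z by (simp only: distrib_right)
    also have "\<dots> = - mmul I (mtr z) z i j"
      by (simp add: fps_const_neg[symmetric] del: fps_const_neg)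
    finally have "z i j + z j i = - mmul I (mtr z) z i j" .
    moreover have "p i j = dmat (\<lambda>_. 1) i j + (z i j + z j i) + mmul I (mtr z) z i j"
      by (simp add: p add.assoc)
    ultimately show ?thesis
      by (simp only:) simp
  qed
  \<comment> \<open>Symmetry of \<open>a\<close> gives \<open>p b = w^T a w = b^T p\<close>, which
    off the blocks reads \<open>(lam i - lam j) p = p f - f^T p\<close>. As \<open>f\<close> is
    block diagonal, the right side involves only off-block entries of \<open>p\<close>, multiplied
    by series vanishing at 0. So the order of vanishing grows by one at each step.\<close>
  have p_off: "fps_X ^ n dvd p i j" if "i \<in> I" "j \<in> I" "lam i \<noteq> lam j" for n i j
    using that
  proof (induction n arbitrary: i j)
    case (Suc n)
    have "meq I (mmul I p b) (mmul I (mtr w) (mmul I a w))"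
      unfolding p_def mmul_assoc by (intro mmul_cong meq_refl meq_sym[OF inter])
    also have "meq I \<dots> (mmul I (mtr w) (mmul I (mtr a) w))"
      by (intro mmul_cong meq_refl meq_sym[OF sym])
    also have "meq I \<dots> (mmul I (mtr (mmul I a w)) w)"
      by (simp add: mtr_mmul mmul_assoc)
    also have "meq I \<dots> (mmul I (mtr (mmul I w b)) w)"
      by (intro mmul_cong meq_refl mtr_cong inter)
    also have "meq I \<dots> (mmul I (mtr b) p)"
      by (simp add: mtr_mmul mmul_assoc p_def)
    finally have "mmul I p b i j = mmul I (mtr b) p i j"
      by (rule meqD[OF _ Suc.prems(1,2)])
    moreover have "mmul I p b i j = p i j * L j + mmul I p f i j"
      unfolding b_def mmul_add_right using fin Suc.prems by (simp add: mmul_dmat_right)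
    moreover have "mmul I (mtr b) p i j = L i * p i j + mmul I (mtr f) p i j"
    proof -
      have "mtr b = (\<lambda>i j. dmat L i j + mtr f i j)"
        by (auto simp: fun_eq_iff mtr_def b_def dmat_def)
      then show ?thesis
        using fin Suc.prems by (simp add: mmul_add_left mmul_dmat_left)
    qed
    ultimately have eq: "fps_const (lam i - lam j) * p i j = mmul I p f i j - mmul I (mtr f) p i j"
      by (simp add: L_def fps_const_sub[symmetric] algebra_simps del: fps_const_sub)
    have "fps_X ^ Suc n dvd p i k * f k j" if "k \<in> I" for k
    proof (cases "lam k = lam j")
      case True
      then show ?thesis
        using that Suc by (intro fps_X_power_Suc_dvd_mult(2) f0 Suc.IH) auto
    qed (use zf[OF that Suc.prems(2)] in simp)
    moreover have "fps_X ^ Suc n dvd mtr f i k * p k j" if "k \<in> I" for k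
    proof (cases "lam k = lam i")
      case True
      then show ?thesis
        unfolding mtr_def using that Suc by (intro fps_X_power_Suc_dvd_mult(1) f0 Suc.IH) auto
    qed (use zf[OF that Suc.prems(1)] in \<open>simp add: mtr_def\<close>)
    ultimately have "fps_X ^ Suc n dvd fps_const (lam i - lam j) * p i j"
      unfolding eq mmul_def by (intro dvd_diff dvd_sum) auto
    from dvd_mult[OF this, of "fps_const (1 / (lam i - lam j))"] show ?case
      using Suc.prems by (simp add: mult.assoc[symmetric] del: power_Suc)
  qed simp
  have orth: "meq I p (dmat (\<lambda>_. 1))"
    unfolding meq_def
  proof (intro ballI)
    fix i j assume ij: "i \<in> I" "j \<in> I"
    show "p i j = dmat (\<lambda>_. 1) i j"
    proof (cases "lam i = lam j")
      case False
      then have "p i j = 0"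
        using p_off ij by (intro fps_eq_0_if_all_X_powers_dvd) auto
      with False show ?thesis
        by (auto simp: dmat_def)
    qed (use p_diag ij in auto)
  qed
  show ?thesis
  proof (rule exI[of _ w], rule exI[of _ b], intro conjI ballI impI)
    fix i j assume ij: "i \<in> I" "j \<in> I"
    show "fps_conv_radius (w i j) > 0" "fps_conv_radius (b i j) > 0"
      using zf_conv[OF ij]
      by (auto simp: w_def b_def dmat_def L_def intro!: fps_conv_radius_pos_add)
    show "b i j = 0" if "lam i \<noteq> lam j"
      using zf[OF ij] that by (auto simp: b_def dmat_def)
  qed (use inter orth in \<open>simp_all add: p_def\<close>)
qed

text \<open>The direct sum of \<open>p\<close> on \<open>S\<close> and \<open>q\<close> on its
  complement; it glues the results of two recursive calls while keeping the original
  indices.\<close>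

definition bjoin :: "'i set \<Rightarrow> ('i \<Rightarrow> 'i \<Rightarrow> 'a) \<Rightarrow> ('i \<Rightarrow> 'i \<Rightarrow> 'a) \<Rightarrow> 'i \<Rightarrow> 'i \<Rightarrow> 'a :: comm_ring_1"
  where "bjoin S p q i j =
    (if i \<in> S \<and> j \<in> S then p i j else if i \<notin> S \<and> j \<notin> S then q i j else 0)"

lemma mtr_bjoin: "mtr (bjoin S p q) = bjoin S (mtr p) (mtr q)"
  by (auto simp: fun_eq_iff mtr_def bjoin_def)

lemma bjoin_dmat: "bjoin S (dmat d) (dmat d) = dmat d"
  by (auto simp: fun_eq_iff dmat_def bjoin_def)

lemma bjoin_cong:
  "meq (I \<inter> S) p p' \<Longrightarrow> meq (I - S) q q' \<Longrightarrow> meq I (bjoin S p q) (bjoin S p' q')"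
  by (auto simp: meq_def bjoin_def)

lemma mmul_bjoin:
  assumes "finite I"
  shows "mmul I (bjoin S p q) (bjoin S p' q') = bjoin S (mmul (I \<inter> S) p p') (mmul (I - S) q q')"
proof (intro ext)
  fix i j
  have "mmul I (bjoin S p q) (bjoin S p' q') i j =
      (\<Sum>k\<in>I \<inter> S. bjoin S p q i k * bjoin S p' q' k j) + (\<Sum>k\<in>I - S. bjoin S p q i k * bjoin S p' q' k j)"
    unfolding mmul_def using assms by (rule sum.Int_Diff)
  then show "mmul I (bjoin S p q) (bjoin S p' q') i j = bjoin S (mmul (I \<inter> S) p p') (mmul (I - S) q q') i j"
    by (simp add: bjoin_def mmul_def)
qed

lemma bjoin_orthogonal:
  assumes "finite I" "meq (I \<inter> S) (mmul (I \<inter> S) (mtr p) p) (dmat (\<lambda>_. 1))"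
    and "meq (I - S) (mmul (I - S) (mtr q) q) (dmat (\<lambda>_. 1))"
  shows "meq I (mmul I (mtr (bjoin S p q)) (bjoin S p q)) (dmat (\<lambda>_. 1))"
  unfolding mtr_bjoin mmul_bjoin[OF assms(1)]
  by (subst bjoin_dmat[symmetric, where S = S]) (intro bjoin_cong assms)

lemma bjoin_diagonalizes:
  assumes fin: "finite I"
    and off: "\<And>i j. i \<in> I \<Longrightarrow> j \<in> I \<Longrightarrow> (i \<in> S) \<noteq> (j \<in> S) \<Longrightarrow> b i j = 0"
    and p: "meq (I \<inter> S) (mmul (I \<inter> S) b p) (mmul (I \<inter> S) p (dmat d))"
    and q: "meq (I - S) (mmul (I - S) b q) (mmul (I - S) q (dmat d'))"
  shows "meq I (mmul I b (bjoin S p q)) (mmul I (bjoin S p q) (dmat (\<lambda>i. if i \<in> S then d i else d' i)))"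
    (is "meq I _ (mmul I _ (dmat ?d))")
proof -
  have "meq I (mmul I b (bjoin S p q)) (mmul I (bjoin S b b) (bjoin S p q))"
    using off by (intro mmul_cong meq_refl) (auto simp: meq_def bjoin_def)
  also have "meq I \<dots> (bjoin S (mmul (I \<inter> S) b p) (mmul (I - S) b q))"
    by (simp add: mmul_bjoin[OF fin])
  also have "meq I \<dots> (bjoin S (mmul (I \<inter> S) p (dmat d)) (mmul (I - S) q (dmat d')))"
    by (intro bjoin_cong p q)
  also have "meq I \<dots> (mmul I (bjoin S p q) (bjoin S (dmat d) (dmat d')))"
    by (simp add: mmul_bjoin[OF fin])
  also have "meq I \<dots> (mmul I (bjoin S p q) (dmat ?d))"
    by (intro mmul_cong meq_refl) (auto simp: meq_def bjoin_def dmat_def)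
  finally show ?thesis .
qed

subsection \<open>The spectral theorem over the reals\<close>

text \<open>The numbering \<open>g\<close> of the index set gives access to the characteristic
  polynomial, which has positive degree and hence a complex root.\<close>

lemma complex_eigenvector_exists:
  fixes a :: "'i \<Rightarrow> 'i \<Rightarrow> complex"
  assumes "finite I" "I \<noteq> {}"
  shows "\<exists>\<mu> y. (\<exists>i\<in>I. y i \<noteq> 0) \<and> (\<forall>i\<in>I. (\<Sum>j\<in>I. a i j * y j) = \<mu> * y i)"
proof -
  define n where "n = card I"
  have n: "n > 0"
    using assms by (auto simp: n_def card_gt_0_iff)
  obtain g where g: "bij_betw g {..<n} I"
    using ex_bij_betw_nat_finite[OF assms(1)] by (auto simp: n_def atLeast0LessThan)
  define h where "h = the_inv_into {..<n} g"
  have hg: "h (g i) = i" if "i < n" for i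
    using g that by (auto simp: h_def bij_betw_def the_inv_into_f_f)
  define A where "A = mat n n (\<lambda>(i, j). a (g i) (g j))"
  have A: "A \<in> carrier_mat n n"
    by (simp add: A_def)
  have "\<not> constant (poly (char_poly A))"
    using degree_monic_char_poly[OF A] n by (simp add: constant_degree)
  then obtain \<mu> where "poly (char_poly A) \<mu> = 0"
    using fundamental_theorem_of_algebra by blast
  then obtain v where v: "eigenvector A v \<mu>"
    using eigenvalue_root_char_poly[OF A] by (auto simp: eigenvalue_def)
  then have v_dim: "v \<in> carrier_vec n" and v0: "v \<noteq> 0\<^sub>v n" and Av: "A *\<^sub>v v = \<mu> \<cdot>\<^sub>v v"
    using A by (auto simp: eigenvector_def)
  obtain i0 where i0: "i0 < n" "vec_index v i0 \<noteq> 0"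
    using v_dim v0 by (metis carrier_vecD eq_vecI index_zero_vec)
  define y where "y = (\<lambda>i. vec_index v (h i))"
  show ?thesis
  proof (intro exI[of _ \<mu>] exI[of _ y] conjI ballI)
    show "\<exists>i\<in>I. y i \<noteq> 0"
      using i0 hg g by (intro bexI[of _ "g i0"]) (auto simp: y_def bij_betw_def)
    fix i assume "i \<in> I"
    then obtain k where k: "k < n" "i = g k"
      using g by (auto simp: bij_betw_def)
    have "(\<Sum>j\<in>I. a i j * y j) = (\<Sum>l<n. a (g k) (g l) * y (g l))"
      using k(2) by (simp add: sum.reindex_bij_betw[OF g, symmetric])
    also have "\<dots> = vec_index (A *\<^sub>v v) k"
      using v_dim k hg by (auto simp: A_def y_def scalar_prod_def atLeast0LessThan intro!: sum.cong)
    also have "\<dots> = \<mu> * y i"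
      using v_dim k hg by (simp add: Av y_def)
    finally show "(\<Sum>j\<in>I. a i j * y j) = \<mu> * y i" .
  qed
qed

text \<open>For a complex eigenvector \<open>y\<close> the Hermitian form of \<open>a\<close> at
  \<open>y\<close> is real and equals \<open>\<mu>\<close> times the positive number
  \<open>|y|^2\<close>, so \<open>\<mu>\<close> is real. Real and imaginary part of \<open>y\<close>
  then solve the same real equation, and one of them is nonzero.\<close>

lemma symmetric_real_eigenvector_exists:
  fixes a :: "'i \<Rightarrow> 'i \<Rightarrow> real"
  assumes fin: "finite I" and ne: "I \<noteq> {}" and sym: "meq I (mtr a) a"
  shows "\<exists>\<mu> x. (\<Sum>i\<in>I. x i * x i) = 1 \<and> (\<forall>i\<in>I. (\<Sum>j\<in>I. a i j * x j) = \<mu> * x i)"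
proof -
  obtain \<mu> y where y: "\<exists>i\<in>I. y i \<noteq> 0"
      "\<And>i. i \<in> I \<Longrightarrow> (\<Sum>j\<in>I. complex_of_real (a i j) * y j) = \<mu> * y i"
    using complex_eigenvector_exists[OF fin ne, of "\<lambda>i j. complex_of_real (a i j)"] by blast
  define S where "S = (\<Sum>i\<in>I. cnj (y i) * y i)"
  define T where "T = (\<Sum>i\<in>I. \<Sum>j\<in>I. cnj (y i) * (complex_of_real (a i j) * y j))"
  have "T = (\<Sum>i\<in>I. cnj (y i) * (\<mu> * y i))"
    unfolding T_def using y(2) by (simp add: sum_distrib_left[symmetric])
  then have T: "T = \<mu> * S"
    by (simp add: S_def sum_distrib_left mult.left_commute)
  have "cnj T = (\<Sum>i\<in>I. \<Sum>j\<in>I. cnj (y j) * (complex_of_real (a i j) * y i))"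
    by (simp add: T_def mult_ac)
  also have "\<dots> = (\<Sum>j\<in>I. \<Sum>i\<in>I. cnj (y j) * (complex_of_real (a i j) * y i))"
    by (rule sum.swap)
  also have "\<dots> = T"
    unfolding T_def using sym by (intro sum.cong refl) (simp add: meq_def mtr_def)
  finally have "cnj T = T" .
  moreover have S_norm: "S = complex_of_real (\<Sum>i\<in>I. (cmod (y i))\<^sup>2)"
    by (simp add: S_def complex_norm_square mult.commute del: of_real_power)
  moreover have "(\<Sum>i\<in>I. (cmod (y i))\<^sup>2) > 0"
  proof -
    obtain i where "i \<in> I" "y i \<noteq> 0"
      using y(1) by blast
    then show ?thesis
      using fin by (intro sum_pos2[of I i]) auto
  qed
  ultimately have "cnj \<mu> = \<mu>"
    unfolding T by (metis complex_cnj_complex_of_real complex_cnj_mult less_irrefl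
      mult_right_cancel of_real_eq_0_iff)
  then obtain m where m: "\<mu> = complex_of_real m"
    by (metis Reals_cnj_iff Reals_cases)
  have ev: "(\<Sum>j\<in>I. a i j * Re (y j)) = m * Re (y i)" "(\<Sum>j\<in>I. a i j * Im (y j)) = m * Im (y i)"
    if "i \<in> I" for i
    using arg_cong[OF y(2)[OF that], of Re] arg_cong[OF y(2)[OF that], of Im] by (simp_all add: m)
  obtain x0 where x0: "\<exists>i\<in>I. x0 i \<noteq> 0" "\<And>i. i \<in> I \<Longrightarrow> (\<Sum>j\<in>I. a i j * x0 j) = m * x0 i"
  proof -
    obtain i where "i \<in> I" "y i \<noteq> 0"
      using y(1) by blast
    then consider "Re (y i) \<noteq> 0" | "Im (y i) \<noteq> 0"
      by (auto simp: complex_eq_iff)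
    then show thesis
      using that[of "\<lambda>i. Re (y i)"] that[of "\<lambda>i. Im (y i)"] ev \<open>i \<in> I\<close> by cases blast+
  qed
  define N where "N = sqrt (\<Sum>i\<in>I. x0 i * x0 i)"
  have "(\<Sum>i\<in>I. x0 i * x0 i) > 0"
  proof -
    obtain i where "i \<in> I" "x0 i \<noteq> 0"
      using x0(1) by blast
    then show ?thesis
      using fin by (intro sum_pos2[of I i]) (auto simp: zero_less_mult_iff)
  qed
  then have N: "N > 0" "(\<Sum>i\<in>I. x0 i * x0 i) = N * N"
    by (simp_all add: N_def)
  show ?thesis
  proof (intro exI[of _ m] exI[of _ "\<lambda>i. x0 i / N"] conjI ballI)
    show "(\<Sum>i\<in>I. x0 i / N * (x0 i / N)) = 1"
      using N by (simp add: sum_divide_distrib[symmetric])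
    show "(\<Sum>j\<in>I. a i j * (x0 j / N)) = m * (x0 i / N)" if "i \<in> I" for i
      using x0(2)[OF that] by (simp add: sum_divide_distrib[symmetric])
  qed
qed

text \<open>The Householder reflection that exchanges \<open>x\<close> and the basis vector of index \<open>i0\<close>.\<close>

lemma householder:
  fixes x :: "'i \<Rightarrow> real"
  assumes fin: "finite I" and i0: "i0 \<in> I" and x: "(\<Sum>i\<in>I. x i * x i) = 1"
  shows "\<exists>h. mtr h = h \<and> meq I (mmul I h h) (dmat (\<lambda>_. 1)) \<and> (\<forall>i\<in>I. h i i0 = x i)"
proof -
  define u where "u = (\<lambda>i. x i - dmat (\<lambda>_. 1) i i0)"
  define s where "s = 2 - 2 * x i0"
  have uu: "(\<Sum>i\<in>I. u i * u i) = s"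
  proof -
    have "(\<Sum>i\<in>I. u i * u i) = (\<Sum>i\<in>I. x i * x i + (if i = i0 then 1 - 2 * x i else 0))"
      by (intro sum.cong refl) (auto simp: u_def dmat_def algebra_simps)
    also have "\<dots> = s"
      using fin i0 x by (simp add: sum.distrib s_def)
    finally show ?thesis .
  qed
  \<comment> \<open>Reflection in the hyperplane orthogonal to \<open>u\<close>, with
    \<open>s = |u|^2\<close>. If \<open>x\<close> already is the basis vector, then
    \<open>s = 0\<close>, the quotient \<open>2 / s\<close> is 0 and \<open>h\<close> is the
    identity.\<close>
  define h where "h = (\<lambda>i j. dmat (\<lambda>_. 1) i j - 2 / s * (u i * u j))"
  have "mtr h = h"
    by (auto simp: fun_eq_iff h_def mtr_def dmat_def)
  moreover have "meq I (mmul I h h) (dmat (\<lambda>_. 1))"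
    unfolding meq_def
  proof (intro ballI)
    fix i j assume ij: "i \<in> I" "j \<in> I"
    have "mmul I h h i j = (\<Sum>k\<in>I. (if k = i then dmat (\<lambda>_. 1) i j - 2 / s * (u i * u j) else 0)
        - (if k = j then 2 / s * (u i * u j) else 0) + 4 / s\<^sup>2 * (u i * u j) * (u k * u k))"
      unfolding mmul_def
      by (intro sum.cong refl) (auto simp: h_def dmat_def algebra_simps power2_eq_square)
    also have "\<dots> = dmat (\<lambda>_. 1) i j - 4 / s * (u i * u j) + 4 / s\<^sup>2 * (u i * u j) * s"
      unfolding sum.distrib sum_subtractf sum_distrib_left[symmetric] uu using fin ij by simp
    also have "\<dots> = dmat (\<lambda>_. 1) i j"
      by (cases "s = 0") (simp_all add: power2_eq_square)
    finally show "mmul I h h i j = dmat (\<lambda>_. 1) i j" .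
  qed
  moreover have "h i i0 = x i" if i: "i \<in> I" for i
  proof (cases "s = 0")
    case True
    then have "\<forall>i\<in>I. u i * u i = 0"
      using uu sum_nonneg_eq_0_iff[OF fin, of "\<lambda>i. u i * u i"] by simp
    then have "u i = 0"
      using i by auto
    with True show ?thesis
      by (simp add: h_def u_def)
  next
    case False
    have "u i0 = - s / 2"
      by (simp add: u_def s_def dmat_def)
    with False show ?thesis
      by (simp add: h_def u_def)
  qed
  ultimately show ?thesis
    by blast
qed

text \<open>Deflation by a reflection whose column \<open>i0\<close> is a unit eigenvector. Both
  products of \<open>v\<close> with its transpose are carried through the induction, because undoing
  a conjugation by \<open>v\<close> later requires \<open>v v^T = 1\<close>.\<close>

theorem symmetric_real_spectral:
  fixes a :: "'i \<Rightarrow> 'i \<Rightarrow> real"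
  assumes "finite I" "meq I (mtr a) a"
  shows "\<exists>v lam. meq I (mmul I a v) (mmul I v (dmat lam)) \<and>
    meq I (mmul I (mtr v) v) (dmat (\<lambda>_. 1)) \<and> meq I (mmul I v (mtr v)) (dmat (\<lambda>_. 1))"
  using assms
proof (induction I arbitrary: a rule: finite_psubset_induct)
  case (psubset I)
  show ?case
  proof (cases "I = {}")
    case False
    then obtain i0 where i0: "i0 \<in> I"
      by blast
    obtain \<mu> x where x: "(\<Sum>i\<in>I. x i * x i) = 1" "\<And>i. i \<in> I \<Longrightarrow> (\<Sum>j\<in>I. a i j * x j) = \<mu> * x i"
      using symmetric_real_eigenvector_exists[OF psubset.hyps False psubset.prems] by blast
    obtain h where h: "mtr h = h" "meq I (mmul I h h) (dmat (\<lambda>_. 1))" "\<And>i. i \<in> I \<Longrightarrow> h i i0 = x i"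
      using householder[OF psubset.hyps i0 x(1)] by blast
    have hT: "meq I (mmul I (mtr h) h) (dmat (\<lambda>_. 1))"
      using h by simp
    define b where "b = mmul I h (mmul I a h)"
    have inter: "meq I (mmul I a h) (mmul I h b)"
    proof -
      have "meq I (mmul I a h) (mmul I (dmat (\<lambda>_. 1)) (mmul I a h))"
        by (rule meq_sym[OF mmul_one_left[OF psubset.hyps]])
      also have "meq I \<dots> (mmul I (mmul I h h) (mmul I a h))"
        by (rule mmul_cong[OF meq_sym[OF h(2)] meq_refl])
      finally show ?thesis
        by (simp add: b_def mmul_assoc)
    qed
    have b_sym: "meq I (mtr b) b"
      by (rule symmetric_if_intertwined[OF psubset.hyps psubset.prems inter hT])
    \<comment> \<open>Column \<open>i0\<close> of \<open>h\<close> is the eigenvector, so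
      \<open>b = h a h\<close> maps the basis vector of index \<open>i0\<close> to
      \<open>\<mu>\<close> times itself; symmetry then clears row \<open>i0\<close> as well.\<close>
    have b_col: "b i i0 = \<mu> * dmat (\<lambda>_. 1) i i0" if "i \<in> I" for i
    proof -
      have "b i i0 = (\<Sum>k\<in>I. h i k * (\<mu> * h k i0))"
        unfolding b_def mmul_def[of I h] using h(3) x(2)
        by (intro sum.cong refl) (simp add: mmul_def)
      also have "\<dots> = \<mu> * mmul I h h i i0"
        by (simp add: mmul_def sum_distrib_left mult.left_commute)
      finally show ?thesis
        using meqD[OF h(2) that i0] by simp
    qed
    have off: "b i j = 0" if "i \<in> I" "j \<in> I" "(i \<in> {i0}) \<noteq> (j \<in> {i0})" for i j
      using that b_col[of i] b_col[of j] meqD[OF b_sym, of i j] by (auto simp: mtr_def dmat_def)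
    have "meq (I - {i0}) (mtr b) b"
      using b_sym by (auto simp: meq_def)
    then obtain v lam where v: "meq (I - {i0}) (mmul (I - {i0}) b v) (mmul (I - {i0}) v (dmat lam))"
        "meq (I - {i0}) (mmul (I - {i0}) (mtr v) v) (dmat (\<lambda>_. 1))"
        "meq (I - {i0}) (mmul (I - {i0}) v (mtr v)) (dmat (\<lambda>_. 1))"
      using psubset.IH[of "I - {i0}" b] i0 by blast
    define w where "w = bjoin {i0} (dmat (\<lambda>_. 1)) v"
    have I1: "I \<inter> {i0} = {i0}"
      using i0 by blast
    have "meq I (mmul I b w) (mmul I w (dmat (\<lambda>i. if i \<in> {i0} then b i0 i0 else lam i)))"
      unfolding w_def
      by (intro bjoin_diagonalizes psubset.hyps v off) (auto simp: I1 meq_def mmul_def dmat_def)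
    from mmul_intertwine[OF inter this]
    have 1: "meq I (mmul I a (mmul I h w)) (mmul I (mmul I h w) (dmat (\<lambda>i. if i \<in> {i0} then b i0 i0 else lam i)))" .
    have one: "meq (I \<inter> {i0}) (mmul (I \<inter> {i0}) (mtr (dmat (\<lambda>_. 1))) (dmat (\<lambda>_. 1))) (dmat (\<lambda>_. 1 :: real))"
      by (simp add: I1 meq_def mmul_def dmat_def)
    have w: "meq I (mmul I (mtr w) w) (dmat (\<lambda>_. 1))"
      unfolding w_def by (intro bjoin_orthogonal psubset.hyps one v)
    have "meq I (mmul I (mtr (mtr w)) (mtr w)) (dmat (\<lambda>_. 1))"
      unfolding w_def mtr_bjoin[of _ _ v] mtr_dmat
      by (intro bjoin_orthogonal psubset.hyps one) (simp add: v)
    moreover have "meq I (mmul I (mtr (mtr h)) (mtr h)) (dmat (\<lambda>_. 1))"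
      using h by simp
    ultimately have wT: "meq I (mmul I (mmul I h w) (mtr (mmul I h w))) (dmat (\<lambda>_. 1))"
      using mmul_orthogonal[OF psubset.hyps, of "mtr w" "mtr h"] by (simp add: mtr_mmul)
    show ?thesis
      using 1 mmul_orthogonal[OF psubset.hyps hT w] wT by blast
  qed (simp add: meq_def)
qed

subsection \<open>Rellich's theorem for power series\<close>

lemma fps_factor_out_order:
  fixes a :: "'i \<Rightarrow> 'i \<Rightarrow> real fps"
  assumes "i1 \<in> I" "j1 \<in> I" "a i1 j1 \<noteq> 0"
  shows "\<exists>k a'. (\<forall>i\<in>I. \<forall>j\<in>I. a i j = fps_X ^ k * a' i j \<and> a' i j = fps_shift k (a i j)) \<and>
    (\<exists>i\<in>I. \<exists>j\<in>I. fps_nth (a' i j) 0 \<noteq> 0)"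
proof -
  define P where "P = (\<lambda>k. \<exists>i\<in>I. \<exists>j\<in>I. fps_nth (a i j) k \<noteq> 0)"
  have "\<exists>k. P k"
    using assms by (auto simp: P_def fps_eq_iff)
  then have P: "P (LEAST k. P k)" and least: "\<And>n. n < (LEAST k. P k) \<Longrightarrow> \<not> P n"
    by (auto intro: LeastI_ex dest: not_less_Least)
  define k where "k = (LEAST k. P k)"
  show ?thesis
  proof (rule exI[of _ k], rule exI[of _ "\<lambda>i j. fps_shift k (a i j)"], intro conjI ballI)
    fix i j assume ij: "i \<in> I" "j \<in> I"
    have "fps_nth (a i j) n = 0" if "n < k" for n
      using least[of n] that ij unfolding P_def k_def by blast
    then show "a i j = fps_X ^ k * fps_shift k (a i j)"
      by (intro fps_ext) (simp add: fps_X_power_mult_nth)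
  qed (use P in \<open>auto simp: P_def k_def\<close>)
qed

text \<open>The eigenvalue clusters of the lowest order coefficient matrix split the index set, and
  the induction hypothesis treats each part. A scalar shift and a power of \<open>fps_X\<close>
  leave eigenvectors unchanged, so both are undone in \<open>d\<close> alone.\<close>

theorem symmetric_fps_diagonalization:
  fixes a :: "'i \<Rightarrow> 'i \<Rightarrow> real fps"
  assumes "finite I" "meq I (mtr a) a"
    and "\<And>i j. i \<in> I \<Longrightarrow> j \<in> I \<Longrightarrow> fps_conv_radius (a i j) > 0"
  shows "\<exists>q d. (\<forall>i\<in>I. \<forall>j\<in>I. fps_conv_radius (q i j) > 0) \<and> (\<forall>j\<in>I. fps_conv_radius (d j) > 0) \<and>
    meq I (mmul I a q) (mmul I q (dmat d)) \<and> meq I (mmul I (mtr q) q) (dmat (\<lambda>_. 1))"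
  using assms
proof (induction I arbitrary: a rule: finite_psubset_induct)
  case (psubset I)
  note fin = psubset.hyps and sym = psubset.prems(1) and conv = psubset.prems(2)
  show ?case
  proof (cases "I = {}")
    case False
    then obtain i0 where i0: "i0 \<in> I"
      by blast
    \<comment> \<open>After subtracting this diagonal entry, entry \<open>(i0, i0)\<close> is zero
      at every order, hence also after the factor \<open>fps_X ^ k\<close> is removed.\<close>
    define c where "c = a i0 i0"
    define a' where "a' = (\<lambda>i j. a i j - dmat (\<lambda>_. c) i j)"
    have c_conv: "fps_conv_radius c > 0"
      using conv i0 by (simp add: c_def)
    have a_eq: "mmul I a q i j = mmul I a' q i j + c * q i j" if "i \<in> I" for q i j
    proof -
      have "a = (\<lambda>i j. a' i j + dmat (\<lambda>_. c) i j)"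
        by (simp add: a'_def)
      then have "mmul I a q i j = mmul I (\<lambda>i j. a' i j + dmat (\<lambda>_. c) i j) q i j"
        by simp
      then show ?thesis
        using fin that by (simp add: mmul_add_left mmul_dmat_left)
    qed
    show ?thesis
    proof (cases "\<forall>i\<in>I. \<forall>j\<in>I. a' i j = 0")
      case True
      show ?thesis
      proof (rule exI[of _ "dmat (\<lambda>_. 1)"], rule exI[of _ "\<lambda>_. c"], intro conjI ballI)
        show "meq I (mmul I a (dmat (\<lambda>_. 1))) (mmul I (dmat (\<lambda>_. 1)) (dmat (\<lambda>_. c)))"
          unfolding meq_def
        proof (intro ballI)
          fix i j assume ij: "i \<in> I" "j \<in> I"
          then show "mmul I a (dmat (\<lambda>_. 1)) i j = mmul I (dmat (\<lambda>_. 1)) (dmat (\<lambda>_. c)) i j"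
            using True fin by (simp add: mmul_dmat_right mmul_dmat_left a'_def) (simp add: dmat_def)
        qed
        show "meq I (mmul I (mtr (dmat (\<lambda>_. 1))) (dmat (\<lambda>_. 1))) (dmat (\<lambda>_. 1 :: real fps))"
          using mmul_one_left[OF fin] by simp
      qed (auto simp: dmat_def c_conv)
    next
      case False
      then obtain k a2 where a2: "\<And>i j. i \<in> I \<Longrightarrow> j \<in> I \<Longrightarrow> a' i j = fps_X ^ k * a2 i j"
          "\<And>i j. i \<in> I \<Longrightarrow> j \<in> I \<Longrightarrow> a2 i j = fps_shift k (a' i j)"
          "\<exists>i\<in>I. \<exists>j\<in>I. fps_nth (a2 i j) 0 \<noteq> 0"
        using fps_factor_out_order[of _ I _ a'] by metis
      have a2_sym: "meq I (mtr a2) a2"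
        using sym a2(2) by (auto simp: meq_def mtr_def a'_def dmat_def)
      have a2_conv: "fps_conv_radius (a2 i j) > 0" if "i \<in> I" "j \<in> I" for i j
        using conv[OF that] a2(2)[OF that] c_conv
        by (auto simp: a'_def dmat_def intro!: fps_conv_radius_pos_diff)
      have a2_i0: "a2 i0 i0 = 0"
        using a2(2)[OF i0 i0] by (simp add: a'_def dmat_def c_def)
      define A0 where "A0 = (\<lambda>i j. fps_nth (a2 i j) 0)"
      have "meq I (mtr A0) A0"
        using a2_sym by (auto simp: meq_def mtr_def A0_def)
      then obtain v0 lam where v0: "meq I (mmul I A0 v0) (mmul I v0 (dmat lam))"
          "meq I (mmul I (mtr v0) v0) (dmat (\<lambda>_. 1))" "meq I (mmul I v0 (mtr v0)) (dmat (\<lambda>_. 1))"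
        using symmetric_real_spectral[OF fin] by blast
      \<comment> \<open>If all eigenvalues agreed, \<open>A0\<close> would be scalar, and its zero
        entry at \<open>(i0, i0)\<close> would make it vanish, although some entry of
        \<open>a2\<close> has a nonzero constant coefficient.\<close>
      have "\<exists>i1\<in>I. \<exists>i2\<in>I. lam i1 \<noteq> lam i2"
      proof (rule ccontr)
        assume "\<not> ?thesis"
        then have lam: "lam i = lam i0" if "i \<in> I" for i
          using that i0 by blast
        have scalar: "A0 i j = dmat (\<lambda>_. lam i0) i j" if ij: "i \<in> I" "j \<in> I" for i j
        proof -
          have "A0 i j = mmul I A0 (dmat (\<lambda>_. 1)) i j"
            using fin ij by (simp add: mmul_dmat_right)
          also have "\<dots> = mmul I A0 (mmul I v0 (mtr v0)) i j"
            by (rule meqD[OF mmul_cong[OF meq_refl meq_sym[OF v0(3)]] ij])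
          also have "\<dots> = mmul I (mmul I v0 (dmat lam)) (mtr v0) i j"
            unfolding mmul_assoc[symmetric] by (rule meqD[OF mmul_cong[OF v0(1) meq_refl] ij])
          also have "\<dots> = (\<Sum>k\<in>I. v0 i k * lam i0 * mtr v0 k j)"
            unfolding mmul_def[of I "mmul I v0 (dmat lam)"] using fin lam
            by (intro sum.cong refl) (simp add: mmul_dmat_right)
          also have "\<dots> = lam i0 * mmul I v0 (mtr v0) i j"
            by (simp add: mmul_def sum_distrib_left mult_ac)
          also have "\<dots> = dmat (\<lambda>_. lam i0) i j"
            using meqD[OF v0(3) ij] by (simp add: dmat_def)
          finally show ?thesis .
        qed
        from scalar[OF i0 i0] have "lam i0 = 0"
          by (simp add: A0_def a2_i0 dmat_def)
        with scalar a2(3) show False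
          by (auto simp: A0_def dmat_def)
      qed
      then obtain i1 i2 where i12: "i1 \<in> I" "i2 \<in> I" "lam i1 \<noteq> lam i2"
        by blast
      define v where "v = (\<lambda>i j. fps_const (v0 i j))"
      have fps_const_sum: "fps_const (\<Sum>k\<in>A. g k) = (\<Sum>k\<in>A. fps_const (g k))" for A :: "'i set" and g :: "'i \<Rightarrow> real"
        by (induction A rule: infinite_finite_induct) (simp_all add: fps_const_add[symmetric] del: fps_const_add)
      have vc: "mmul I (mtr v) v i j = fps_const (mmul I (mtr v0) v0 i j)"
          "mmul I v (mtr v) i j = fps_const (mmul I v0 (mtr v0) i j)" for i j
        by (simp_all add: mmul_def mtr_def v_def fps_const_sum)
      have v_orth: "meq I (mmul I (mtr v) v) (dmat (\<lambda>_. 1))" "meq I (mmul I v (mtr v)) (dmat (\<lambda>_. 1))"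
        using v0(2,3) by (auto simp: meq_def vc dmat_def)
      define a1 where "a1 = mmul I (mtr v) (mmul I a2 v)"
      have inter1: "meq I (mmul I a2 v) (mmul I v a1)"
      proof -
        have "meq I (mmul I a2 v) (mmul I (dmat (\<lambda>_. 1)) (mmul I a2 v))"
          by (rule meq_sym[OF mmul_one_left[OF fin]])
        also have "meq I \<dots> (mmul I (mmul I v (mtr v)) (mmul I a2 v))"
          by (rule mmul_cong[OF meq_sym[OF v_orth(2)] meq_refl])
        finally show ?thesis
          by (simp add: a1_def mmul_assoc)
      qed
      have mmul_conv: "fps_conv_radius (mmul I p q i j) > 0"
        if "\<And>i j. i \<in> I \<Longrightarrow> j \<in> I \<Longrightarrow> fps_conv_radius (p i j) > 0"
          "\<And>i j. i \<in> I \<Longrightarrow> j \<in> I \<Longrightarrow> fps_conv_radius (q i j) > 0" "i \<in> I" "j \<in> I"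
        for p q :: "'i \<Rightarrow> 'i \<Rightarrow> real fps" and i j
        unfolding mmul_def using that by (intro fps_conv_radius_pos_sum fps_conv_radius_pos_mult) auto
      have v_conv: "fps_conv_radius (v i j) > 0" for i j
        by (simp add: v_def)
      have a1_conv: "fps_conv_radius (a1 i j) > 0" if "i \<in> I" "j \<in> I" for i j
        unfolding a1_def using that by (intro mmul_conv a2_conv) (auto simp: mtr_def v_conv)
      have a1_sym: "meq I (mtr a1) a1"
        by (rule symmetric_if_intertwined[OF fin a2_sym inter1 v_orth(1)])
      have a1_0: "fps_nth (a1 i j) 0 = dmat lam i j" if ij: "i \<in> I" "j \<in> I" for i j
      proof -
        have "fps_nth (a1 i j) 0 = mmul I (mtr v0) (mmul I A0 v0) i j"
          by (simp add: a1_def mmul_def fps_sum_nth mtr_def v_def A0_def)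
        also have "\<dots> = mmul I (mtr v0) (mmul I v0 (dmat lam)) i j"
          by (rule meqD[OF mmul_cong[OF meq_refl v0(1)] ij])
        also have "\<dots> = mmul I (mmul I (mtr v0) v0) (dmat lam) i j"
          by (simp add: mmul_assoc)
        also have "\<dots> = mmul I (dmat (\<lambda>_. 1)) (dmat lam) i j"
          by (rule meqD[OF mmul_cong[OF v0(2) meq_refl] ij])
        finally show ?thesis
          using fin ij by (simp add: mmul_dmat_left)
      qed
      obtain w b where wb: "\<And>i j. i \<in> I \<Longrightarrow> j \<in> I \<Longrightarrow> fps_conv_radius (w i j) > 0"
          "\<And>i j. i \<in> I \<Longrightarrow> j \<in> I \<Longrightarrow> fps_conv_radius (b i j) > 0"
          "\<And>i j. i \<in> I \<Longrightarrow> j \<in> I \<Longrightarrow> lam i \<noteq> lam j \<Longrightarrow> b i j = 0"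
          "meq I (mmul I a1 w) (mmul I w b)" "meq I (mmul I (mtr w) w) (dmat (\<lambda>_. 1))"
        using symmetric_fps_splitting[OF fin a1_sym a1_conv a1_0] by blast
      have b_sym: "meq I (mtr b) b"
        by (rule symmetric_if_intertwined[OF fin a1_sym wb(4,5)])
      \<comment> \<open>This level set contains \<open>i1\<close> but not \<open>i2\<close>, so both
        parts of the index set are proper subsets and the induction hypothesis applies to
        each.\<close>
      define S where "S = {i. lam i = lam i1}"
      have b_sym': "meq (I \<inter> S) (mtr b) b" "meq (I - S) (mtr b) b"
        using b_sym by (auto simp: meq_def)
      have sub: "I \<inter> S \<subset> I" "I - S \<subset> I"
      proof -
        have "i2 \<notin> I \<inter> S" "i1 \<notin> I - S"
          using i12 by (auto simp: S_def)
        then show "I \<inter> S \<subset> I" "I - S \<subset> I"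
          using i12 by blast+
      qed
      obtain p d where pd: "\<And>i j. i \<in> I \<inter> S \<Longrightarrow> j \<in> I \<inter> S \<Longrightarrow> fps_conv_radius (p i j) > 0"
          "\<And>j. j \<in> I \<inter> S \<Longrightarrow> fps_conv_radius (d j) > 0"
          "meq (I \<inter> S) (mmul (I \<inter> S) b p) (mmul (I \<inter> S) p (dmat d))"
          "meq (I \<inter> S) (mmul (I \<inter> S) (mtr p) p) (dmat (\<lambda>_. 1))"
        using psubset.IH[OF sub(1) b_sym'(1)] wb(2) by (metis IntD1)
      obtain q d' where qd: "\<And>i j. i \<in> I - S \<Longrightarrow> j \<in> I - S \<Longrightarrow> fps_conv_radius (q i j) > 0"
          "\<And>j. j \<in> I - S \<Longrightarrow> fps_conv_radius (d' j) > 0"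
          "meq (I - S) (mmul (I - S) b q) (mmul (I - S) q (dmat d'))"
          "meq (I - S) (mmul (I - S) (mtr q) q) (dmat (\<lambda>_. 1))"
        using psubset.IH[OF sub(2) b_sym'(2)] wb(2) by (metis DiffD1)
      define z where "z = bjoin S p q"
      define D where "D = (\<lambda>i. if i \<in> S then d i else d' i)"
      have bz: "meq I (mmul I b z) (mmul I z (dmat D))"
        unfolding z_def D_def using wb(3) by (intro bjoin_diagonalizes fin pd qd) (auto simp: S_def)
      have z_orth: "meq I (mmul I (mtr z) z) (dmat (\<lambda>_. 1))"
        unfolding z_def by (intro bjoin_orthogonal fin pd qd)
      have z_conv: "fps_conv_radius (z i j) > 0" if "i \<in> I" "j \<in> I" for i j
        using that pd(1) qd(1) by (auto simp: z_def bjoin_def)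
      define Q where "Q = mmul I v (mmul I w z)"
      have Q: "meq I (mmul I a2 Q) (mmul I Q (dmat D))"
        unfolding Q_def by (rule mmul_intertwine[OF inter1 mmul_intertwine[OF wb(4) bz]])
      show ?thesis
      proof (rule exI[of _ Q], rule exI[of _ "\<lambda>j. fps_X ^ k * D j + c"], intro conjI ballI)
        show "fps_conv_radius (Q i j) > 0" if "i \<in> I" "j \<in> I" for i j
          unfolding Q_def using that by (intro mmul_conv v_conv wb z_conv) auto
        show "fps_conv_radius (fps_X ^ k * D j + c) > 0" if "j \<in> I" for j
          using that pd(2) qd(2)
          by (intro fps_conv_radius_pos_add fps_conv_radius_pos_mult c_conv) (auto simp: D_def)
        show "meq I (mmul I (mtr Q) Q) (dmat (\<lambda>_. 1))"
          unfolding Q_def by (intro mmul_orthogonal fin v_orth wb z_orth)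
        show "meq I (mmul I a Q) (mmul I Q (dmat (\<lambda>j. fps_X ^ k * D j + c)))"
          unfolding meq_def
        proof (intro ballI)
          fix i j assume ij: "i \<in> I" "j \<in> I"
          have "mmul I a' Q i j = fps_X ^ k * mmul I a2 Q i j"
            using a2(1) ij by (simp add: mmul_def sum_distrib_left mult.assoc)
          also have "mmul I a2 Q i j = Q i j * D j"
            using meqD[OF Q ij] fin ij by (simp add: mmul_dmat_right)
          finally show "mmul I a Q i j = mmul I Q (dmat (\<lambda>j. fps_X ^ k * D j + c)) i j"
            using fin ij by (simp add: a_eq mmul_dmat_right algebra_simps)
        qed
      qed
    qed
  qed (simp add: meq_def)
qed

subsection \<open>Leading terms of analytic functions\<close>

lemma has_fps_expansion_eventually_eq:
  "f has_fps_expansion F \<Longrightarrow> g has_fps_expansion F \<Longrightarrow> \<forall>\<^sub>F x in nhds 0. f x = g x"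
  unfolding has_fps_expansion_def by (auto elim: eventually_elim2)

lemma has_fps_expansion_factor_order:
  fixes f :: "real \<Rightarrow> real"
  assumes f: "f has_fps_expansion F" and F: "F \<noteq> 0"
  shows "\<exists>k g G. g has_fps_expansion G \<and> g 0 \<noteq> 0 \<and> fps_nth G 0 \<noteq> 0 \<and> (\<forall>\<^sub>F x in nhds 0. f x = x ^ k * g x)"
proof -
  define k where "k = subdegree F"
  define G where "G = fps_shift k F"
  have G0: "fps_nth G 0 \<noteq> 0"
    using F by (simp add: G_def k_def)
  have G: "eval_fps G has_fps_expansion G"
    using f by (intro eval_fps_has_fps_expansion) (simp add: G_def has_fps_expansion_def)
  have "(\<lambda>x. x ^ k * eval_fps G x) has_fps_expansion (fps_X ^ k * G)"
    by (intro has_fps_expansion_mult has_fps_expansion_fps_X_power G)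
  also have "fps_X ^ k * G = F"
    using subdegree_decompose[of F] by (simp add: G_def k_def mult.commute)
  finally have "\<forall>\<^sub>F x in nhds 0. f x = x ^ k * eval_fps G x"
    by (rule has_fps_expansion_eventually_eq[OF f])
  moreover have "eval_fps G 0 \<noteq> 0"
    using G0 by (simp add: eval_fps_at_0)
  ultimately show ?thesis
    using G G0 by blast
qed

lemma has_fps_expansion_tendsto:
  "f has_fps_expansion F \<Longrightarrow> (f \<longlongrightarrow> f 0) (at 0 within A)" for f :: "real \<Rightarrow> real"
  using has_fps_expansion_imp_continuous[of f F A] by (simp add: continuous_within)

lemma eventually_nhds_at_within: "eventually P (nhds x) \<Longrightarrow> eventually P (at x within A)"
  by (simp add: eventually_at_filter eventually_mono)

text \<open>One-sided identity theorem: with a nonzero expansion, \<open>f = x^k g\<close> with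
  \<open>g 0 \<noteq> 0\<close> has no zeros at small positive points. It carries identities known
  for positive arguments to a full neighbourhood of 0.\<close>

lemma has_fps_expansion_zero_at_right:
  fixes f :: "real \<Rightarrow> real"
  assumes f: "f has_fps_expansion F" and z: "\<exists>\<^sub>F x in at_right 0. f x = 0"
  shows "F = 0" "\<forall>\<^sub>F x in nhds 0. f x = 0"
proof -
  show "F = 0"
  proof (rule ccontr)
    assume "F \<noteq> 0"
    then obtain k g G where g: "g has_fps_expansion G" "g 0 \<noteq> 0" "\<forall>\<^sub>F x in nhds 0. f x = x ^ k * g x"
      using has_fps_expansion_factor_order[OF f] by blast
    have "\<forall>\<^sub>F x in at_right 0. g x \<noteq> 0"
      using has_fps_expansion_tendsto[OF g(1), of "{0<..}"] g(2) by (rule tendsto_imp_eventually_ne)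
    moreover have "\<forall>\<^sub>F x in at_right 0. f x = x ^ k * g x"
      using g(3) by (rule eventually_nhds_at_within)
    moreover have "\<forall>\<^sub>F x in at_right (0::real). x \<noteq> 0"
      by (simp add: eventually_at_filter)
    ultimately have "\<forall>\<^sub>F x in at_right 0. f x \<noteq> 0"
      by eventually_elim simp
    with z show False
      by (simp add: frequently_def)
  qed
  with f show "\<forall>\<^sub>F x in nhds 0. f x = 0"
    using has_fps_expansion_eventually_eq[of f 0 "\<lambda>_. 0"] by simp
qed

lemma has_fps_expansion_eq_at_right:
  fixes f g :: "real \<Rightarrow> real"
  assumes "f has_fps_expansion F" "g has_fps_expansion G" "\<forall>\<^sub>F x in at_right 0. f x = g x"
  shows "F = G" "\<forall>\<^sub>F x in nhds 0. f x = g x"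
proof -
  have "\<exists>\<^sub>F x in at_right 0. f x - g x = 0"
    using assms(3) by (intro eventually_frequently) (simp_all add: trivial_limit_at_right_real)
  from has_fps_expansion_zero_at_right[OF has_fps_expansion_diff[OF assms(1,2)] this]
  show "F = G" "\<forall>\<^sub>F x in nhds 0. f x = g x"
    by simp_all
qed

text \<open>After division by \<open>x ^ j\<close> the sides tend to \<open>c\<close> and to
  \<open>0 ^ (k - j) * d\<close>, and the latter is 0 unless \<open>j = k\<close>. The limit
  \<open>d\<close> may be 0, the case needed to exclude poles. The filter is \<open>at 0\<close> for
  the definition of \<open>lead_term\<close> and \<open>at_right 0\<close> for comparing
  spectra.\<close>

lemma leading_terms_unique_le:
  fixes f g :: "real \<Rightarrow> real"
  assumes "F = at_right 0 \<or> F = at 0"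
    and f: "(f \<longlongrightarrow> c) F" and g: "(g \<longlongrightarrow> d) F" and c: "c \<noteq> 0" and jk: "j \<le> k"
    and eq: "\<forall>\<^sub>F x in F. x ^ j * f x = x ^ k * g x"
  shows "j = k \<and> c = d"
proof -
  have F: "F \<noteq> bot"
    using assms(1) at_neq_bot trivial_limit_at_right_real by metis
  have F0: "((\<lambda>x. x) \<longlongrightarrow> 0) F" "\<forall>\<^sub>F x in F. x \<noteq> (0::real)"
    using assms(1) by (auto simp: eventually_at_filter tendsto_ident_at)
  have "\<forall>\<^sub>F x in F. f x = x ^ (k - j) * g x"
    using eq F0(2)
  proof eventually_elim
    case (elim x)
    have "x ^ k = x ^ j * x ^ (k - j)"
      using jk by (simp add: power_add[symmetric])
    with elim show ?case
      by simp
  qed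
  with f have lim: "((\<lambda>x. x ^ (k - j) * g x) \<longlongrightarrow> c) F"
    using tendsto_cong by fast
  have "((\<lambda>x. x ^ (k - j) * g x) \<longlongrightarrow> 0 ^ (k - j) * d) F"
    by (intro tendsto_intros F0 g)
  then have "c = 0 ^ (k - j) * d"
    using lim F tendsto_unique by blast
  with c jk show ?thesis
    by (cases "k = j") (auto simp: power_0_left split: if_splits)
qed

lemma leading_terms_unique:
  fixes f g :: "real \<Rightarrow> real"
  assumes "F = at_right 0 \<or> F = at 0"
    and "(f \<longlongrightarrow> c) F" "(g \<longlongrightarrow> d) F" "c \<noteq> 0" "d \<noteq> 0"
    and "\<forall>\<^sub>F x in F. x ^ j * f x = x ^ k * g x"
  shows "j = k \<and> c = d"
proof (cases "j \<le> k")
  case True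
  then show ?thesis
    using leading_terms_unique_le[OF assms(1,2,3,4) _ assms(6)] by simp
next
  case False
  have "\<forall>\<^sub>F x in F. x ^ k * g x = x ^ j * f x"
    using assms(6) by eventually_elim simp
  from leading_terms_unique_le[OF assms(1,3,2,5) _ this] False show ?thesis
    by simp
qed

text \<open>The shifted series \<open>h\<close> is the difference quotient of \<open>g\<close> at 0,
  so \<open>g x - g 0\<close> is the required remainder of order \<open>x\<close>. Any other
  representation has the same exponent and coefficient by comparison of limits.\<close>

lemma lead_term_eqI:
  assumes g: "g has_fps_expansion G" and g0: "g 0 \<noteq> 0" and fg: "\<forall>\<^sub>F x in nhds 0. f x = x ^ k * g x"
  shows "lead_term f = (\<lambda>x. g 0 * x ^ k)"
proof -
  have g_lim: "(g \<longlongrightarrow> g 0) (at 0)"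
    by (rule has_fps_expansion_tendsto[OF g])
  have fg': "\<forall>\<^sub>F x in at 0. f x = x ^ k * g x"
    using fg by (rule eventually_nhds_at_within)
  have nz: "\<not> (\<forall>\<^sub>F x in nhds 0. f x = 0)"
  proof
    assume "\<forall>\<^sub>F x in nhds 0. f x = 0"
    then have "\<forall>\<^sub>F x in at 0. f x = 0"
      by (rule eventually_nhds_at_within)
    moreover note fg'
    moreover have "\<forall>\<^sub>F x in at 0. g x \<noteq> 0"
      using g_lim g0 by (rule tendsto_imp_eventually_ne)
    moreover have "\<forall>\<^sub>F x in at (0::real). x \<noteq> 0"
      by (simp add: eventually_at_filter)
    ultimately have "\<forall>\<^sub>F x in at (0::real). False"
      by eventually_elim simp
    then show False
      by simp
  qed
  define h where "h = eval_fps (fps_shift 1 G)"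
  have h: "h has_fps_expansion fps_shift 1 G"
    unfolding h_def using g by (intro eval_fps_has_fps_expansion) (simp add: has_fps_expansion_def)
  have "(\<lambda>x. x * h x + g 0) has_fps_expansion (fps_X * fps_shift 1 G + fps_const (g 0))"
    by (intro fps_expansion_intros h)
  also have "fps_X * fps_shift 1 G + fps_const (g 0) = G"
  proof (rule fps_ext)
    have "g 0 = eval_fps G 0"
      using eventually_nhds_x_imp_x[of "\<lambda>z. eval_fps G z = g z" 0] g
      by (simp add: has_fps_expansion_def)
    then show "fps_nth (fps_X * fps_shift 1 G + fps_const (g 0)) n = fps_nth G n" for n
      by (cases n) (simp_all add: eval_fps_at_0)
  qed
  finally have gh: "\<forall>\<^sub>F x in nhds 0. g x = x * h x + g 0"
    by (rule has_fps_expansion_eventually_eq[OF g])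
  have "(\<lambda>x. g x - g 0) \<in> O[at 0](\<lambda>x. x)"
  proof (rule bigoI_tendsto)
    have "\<forall>\<^sub>F x in at 0. h x = (g x - g 0) / x"
      using eventually_nhds_at_within[OF gh] eventually_neq_at_within[of 0 0 UNIV]
      by eventually_elim simp
    moreover have "(h \<longlongrightarrow> h 0) (at 0)"
      by (rule has_fps_expansion_tendsto[OF h])
    ultimately show "((\<lambda>x. (g x - g 0) / x) \<longlongrightarrow> h 0) (at 0)"
      using tendsto_cong by fast
  qed (simp add: eventually_neq_at_within)
  then have ex: "\<exists>(\<alpha>::nat) c r. c \<noteq> 0 \<and> r \<in> O[at 0](\<lambda>x. x) \<and>
      (\<forall>\<^sub>F x in at 0. f x = x ^ \<alpha> * (c + r x)) \<and> (\<lambda>x. g 0 * x ^ k) = (\<lambda>x. c * x ^ \<alpha>)"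
    using g0 fg' by (intro exI[of _ k] exI[of _ "g 0"] exI[of _ "\<lambda>x. g x - g 0"]) simp
  have "(THE l. \<exists>(\<alpha>::nat) c r. c \<noteq> 0 \<and> r \<in> O[at 0](\<lambda>x. x) \<and>
      (\<forall>\<^sub>F x in at 0. f x = x ^ \<alpha> * (c + r x)) \<and> l = (\<lambda>x. c * x ^ \<alpha>)) = (\<lambda>x. g 0 * x ^ k)"
  proof (rule the_equality, rule ex, elim exE conjE)
    fix l \<alpha> c r
    assume c: "c \<noteq> 0" and r: "r \<in> O[at 0](\<lambda>x. x :: real)"
      and f: "\<forall>\<^sub>F x in at 0. f x = x ^ \<alpha> * (c + r x)" and l: "l = (\<lambda>x. c * x ^ \<alpha>)"
    from r obtain C where C: "\<forall>\<^sub>F x in at 0. norm (r x) \<le> C * norm x"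
      by (elim landau_o.bigE)
    have "(r \<longlongrightarrow> 0) (at 0)"
      by (rule Lim_null_comparison[OF C])
        (rule tendsto_mult_right_zero[OF tendsto_norm_zero[OF tendsto_ident_at]])
    then have "((\<lambda>x. c + r x) \<longlongrightarrow> c + 0) (at 0)"
      by (intro tendsto_intros)
    moreover have "\<forall>\<^sub>F x in at 0. x ^ \<alpha> * (c + r x) = x ^ k * g x"
      using f fg' by eventually_elim simp
    ultimately have "\<alpha> = k \<and> c = g 0"
      using leading_terms_unique[of "at 0" "\<lambda>x. c + r x" c g "g 0" \<alpha> k] g_lim c g0 by simp
    then show "l = (\<lambda>x. g 0 * x ^ k)"
      by (simp add: l)
  qed
  with nz show ?thesis
    unfolding lead_term_def by presburger
qed

text \<open>The factors \<open>a\<close> and \<open>b\<close> share a nonzero limit, so they alter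
  neither the order nor the ratio of the leading coefficients. If one function is the zero germ, the
  other vanishes on the right and hence near 0.\<close>

lemma lead_term_eq_if_asymptotic:
  assumes f: "analytic_at_0 f" and g: "analytic_at_0 g"
    and a: "(a \<longlongrightarrow> q) (at_right 0)" and b: "(b \<longlongrightarrow> q) (at_right 0)" and q: "q \<noteq> 0"
    and eq: "\<forall>\<^sub>F x in at_right 0. f x * a x = g x * b x"
  shows "lead_term f = lead_term g"
proof -
  obtain F G where F: "f has_fps_expansion F" and G: "g has_fps_expansion G"
    using f g by (auto simp: analytic_at_0_def)
  have a0: "\<forall>\<^sub>F x in at_right 0. a x \<noteq> 0" and b0: "\<forall>\<^sub>F x in at_right 0. b x \<noteq> 0"
    using a b q by (auto intro: tendsto_imp_eventually_ne)
  show ?thesis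
  proof (cases "F = 0 \<or> G = 0")
    case True
    have ev: "\<forall>\<^sub>F x in at_right 0. f x = 0 \<and> g x = 0"
    proof (cases "F = 0")
      case True
      then have "\<forall>\<^sub>F x in nhds 0. f x = 0"
        using has_fps_expansion_eventually_eq[of f 0 "\<lambda>_. 0"] F by simp
      then have "\<forall>\<^sub>F x in at_right 0. f x = 0"
        by (rule eventually_nhds_at_within)
      then show ?thesis
        using eq b0 by eventually_elim auto
    next
      case False
      with True have "G = 0"
        by simp
      then have "\<forall>\<^sub>F x in nhds 0. g x = 0"
        using has_fps_expansion_eventually_eq[of g 0 "\<lambda>_. 0"] G by simp
      then have "\<forall>\<^sub>F x in at_right 0. g x = 0"
        by (rule eventually_nhds_at_within)
      then show ?thesis
        using eq a0 by eventually_elim auto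
    qed
    have "\<exists>\<^sub>F x in at_right 0. f x = 0" "\<exists>\<^sub>F x in at_right 0. g x = 0"
      using ev by (auto intro!: eventually_frequently elim!: eventually_mono)
    then have "\<forall>\<^sub>F x in nhds 0. f x = 0" "\<forall>\<^sub>F x in nhds 0. g x = 0"
      using has_fps_expansion_zero_at_right F G by blast+
    then show ?thesis
      by (simp add: lead_term_def)
  next
    case False
    then obtain j f' F' where f': "f' has_fps_expansion F'" "f' 0 \<noteq> 0" "\<forall>\<^sub>F x in nhds 0. f x = x ^ j * f' x"
      using has_fps_expansion_factor_order[OF F] by blast
    from False obtain k g' G' where g': "g' has_fps_expansion G'" "g' 0 \<noteq> 0" "\<forall>\<^sub>F x in nhds 0. g x = x ^ k * g' x"
      using has_fps_expansion_factor_order[OF G] by blast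
    have "((\<lambda>x. f' x * a x) \<longlongrightarrow> f' 0 * q) (at_right 0)" "((\<lambda>x. g' x * b x) \<longlongrightarrow> g' 0 * q) (at_right 0)"
      by (intro tendsto_mult a b has_fps_expansion_tendsto[OF f'(1)] has_fps_expansion_tendsto[OF g'(1)])+
    moreover have "\<forall>\<^sub>F x in at_right 0. x ^ j * (f' x * a x) = x ^ k * (g' x * b x)"
      using eq eventually_nhds_at_within[OF f'(3)] eventually_nhds_at_within[OF g'(3)]
      by eventually_elim simp
    ultimately have "j = k \<and> f' 0 * q = g' 0 * q"
      using f'(2) g'(2) q by (intro leading_terms_unique[of "at_right 0"]) auto
    then show ?thesis
      using q lead_term_eqI[OF f'] lead_term_eqI[OF g'] by simp
  qed
qed

text \<open>A quotient of analytic functions has at worst a pole, and the finite limit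
  \<open>l\<close> rules it out: the order of \<open>d\<close> cannot exceed that of
  \<open>f\<close>.\<close>

lemma analytic_quotient_extends:
  assumes f: "analytic_at_0 f" and d: "analytic_at_0 d"
    and d0: "\<forall>\<^sub>F t in at_right 0. d t \<noteq> 0" and eq: "\<forall>\<^sub>F t in at_right 0. d t * x t = f t"
    and x: "(x \<longlongrightarrow> l) (at_right 0)"
  shows "\<exists>y. analytic_at_0 y \<and> (\<forall>\<^sub>F t in at_right 0. y t = x t)"
proof -
  obtain F D where F: "f has_fps_expansion F" and D: "d has_fps_expansion D"
    using f d by (auto simp: analytic_at_0_def)
  have "D \<noteq> 0"
  proof
    assume "D = 0"
    then have "\<forall>\<^sub>F t in nhds 0. d t = 0"
      using has_fps_expansion_eventually_eq[of d 0 "\<lambda>_. 0"] D by simp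
    from eventually_nhds_at_within[OF this, of "{0<..}"] d0
    have "\<forall>\<^sub>F t in at_right (0::real). False"
      by eventually_elim simp
    then show False
      by (simp add: trivial_limit_at_right_real)
  qed
  then obtain k e E where e: "e has_fps_expansion E" "e 0 \<noteq> 0" "fps_nth E 0 \<noteq> 0"
      "\<forall>\<^sub>F t in nhds 0. d t = t ^ k * e t"
    using has_fps_expansion_factor_order[OF D] by blast
  note e_right = eventually_nhds_at_within[OF e(4), of "{0<..}"]
  have e_ne: "\<forall>\<^sub>F t in at_right 0. e t \<noteq> 0"
    using has_fps_expansion_tendsto[OF e(1)] e(2) by (rule tendsto_imp_eventually_ne)
  have pos: "\<forall>\<^sub>F t in at_right (0::real). t > 0"
    by (simp add: eventually_at_filter)
  show ?thesis
  proof (cases "F = 0")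
    case True
    then have "\<forall>\<^sub>F t in nhds 0. f t = 0"
      using has_fps_expansion_eventually_eq[of f 0 "\<lambda>_. 0"] F by simp
    from eventually_nhds_at_within[OF this, of "{0<..}"] d0 eq
    have "\<forall>\<^sub>F t in at_right 0. 0 = x t"
      by eventually_elim simp
    then show ?thesis
      by (intro exI[of _ "\<lambda>_. 0"]) (auto simp: analytic_at_0_def)
  next
    case False
    then obtain j g G where g: "g has_fps_expansion G" "g 0 \<noteq> 0" "\<forall>\<^sub>F t in nhds 0. f t = t ^ j * g t"
      using has_fps_expansion_factor_order[OF F] by blast
    note g_right = eventually_nhds_at_within[OF g(3), of "{0<..}"]
    have "k \<le> j"
    proof (rule ccontr)
      assume "\<not> k \<le> j"
      moreover have "((\<lambda>t. e t * x t) \<longlongrightarrow> e 0 * l) (at_right 0)"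
        by (intro tendsto_mult x has_fps_expansion_tendsto[OF e(1)])
      moreover have "\<forall>\<^sub>F t in at_right 0. t ^ j * g t = t ^ k * (e t * x t)"
        using eq e_right g_right by eventually_elim simp
      ultimately show False
        using leading_terms_unique_le[of "at_right 0" g "g 0" "\<lambda>t. e t * x t" "e 0 * l" j k]
          has_fps_expansion_tendsto[OF g(1)] g(2) by auto
    qed
    define y where "y = (\<lambda>t. t ^ (j - k) * g t * inverse (e t))"
    have "y has_fps_expansion fps_X ^ (j - k) * G * inverse E"
      unfolding y_def using e(3) by (intro has_fps_expansion_mult has_fps_expansion_fps_X_power
        has_fps_expansion_inverse g e)
    moreover have "\<forall>\<^sub>F t in at_right 0. y t = x t"
      using eq e_right g_right e_ne pos
    proof eventually_elim
      case (elim t)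
      have "t ^ j = t ^ k * t ^ (j - k)"
        using \<open>k \<le> j\<close> by (simp add: power_add[symmetric])
      with elim have "e t * x t = t ^ (j - k) * g t"
        by simp
      with elim show ?case
        by (simp add: y_def field_simps)
    qed
    ultimately show ?thesis
      by (auto simp: analytic_at_0_def)
  qed
qed

lemma analytic_at_0_const: "analytic_at_0 (\<lambda>_. c)"
  unfolding analytic_at_0_def by blast

lemma analytic_at_0_diff: "analytic_at_0 f \<Longrightarrow> analytic_at_0 g \<Longrightarrow> analytic_at_0 (\<lambda>x. f x - g x)"
  unfolding analytic_at_0_def by (blast intro: has_fps_expansion_diff)

lemma analytic_at_0_mult: "analytic_at_0 f \<Longrightarrow> analytic_at_0 g \<Longrightarrow> analytic_at_0 (\<lambda>x. f x * g x)"
  unfolding analytic_at_0_def by (blast intro: has_fps_expansion_mult)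

lemma analytic_at_0_sum:
  "(\<And>k. k \<in> A \<Longrightarrow> analytic_at_0 (f k)) \<Longrightarrow> analytic_at_0 (\<lambda>x. \<Sum>k\<in>A. f k x)"
proof -
  assume "\<And>k. k \<in> A \<Longrightarrow> analytic_at_0 (f k)"
  then have "\<forall>k\<in>A. \<exists>F. f k has_fps_expansion F"
    by (simp add: analytic_at_0_def)
  then obtain F where "\<forall>k\<in>A. f k has_fps_expansion F k"
    using bchoice[of A "\<lambda>k F. f k has_fps_expansion F"] by blast
  then have "(\<lambda>x. \<Sum>k\<in>A. f k x) has_fps_expansion (\<Sum>k\<in>A. F k)"
    by (intro has_fps_expansion_sum) simp
  then show ?thesis
    unfolding analytic_at_0_def ..
qed

lemma analytic_at_0_prod:
  "(\<And>k. k \<in> A \<Longrightarrow> analytic_at_0 (f k)) \<Longrightarrow> analytic_at_0 (\<lambda>x. \<Prod>k\<in>A. f k x)"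
proof -
  assume "\<And>k. k \<in> A \<Longrightarrow> analytic_at_0 (f k)"
  then have "\<forall>k\<in>A. \<exists>F. f k has_fps_expansion F"
    by (simp add: analytic_at_0_def)
  then obtain F where "\<forall>k\<in>A. f k has_fps_expansion F k"
    using bchoice[of A "\<lambda>k F. f k has_fps_expansion F"] by blast
  then have "(\<lambda>x. \<Prod>k\<in>A. f k x) has_fps_expansion (\<Prod>k\<in>A. F k)"
    by (intro has_fps_expansion_prod) simp
  then show ?thesis
    unfolding analytic_at_0_def ..
qed

subsection \<open>Rellich's theorem for analytic matrices\<close>

text \<open>The diagonalizing series are evaluated. Each entry of a matrix identity between series
  becomes an identity of functions near 0, because functions with the same expansion agree
  there.\<close>

lemma analytic_eigensystem_exists:
  assumes "sym_analytic_mat n K"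
  shows "\<exists>lam u. analytic_eigensystem n K lam u"
proof -
  have K: "\<forall>\<^sub>F t in nhds 0. K t \<in> carrier_mat n n \<and> transpose_mat (K t) = K t"
    and ex: "\<forall>i<n. \<forall>j<n. \<exists>F. (\<lambda>t. K t $$ (i, j)) has_fps_expansion F"
    using assms by (auto simp: sym_analytic_mat_def analytic_at_0_def)
  from ex obtain a where a: "\<And>i j. i < n \<Longrightarrow> j < n \<Longrightarrow> (\<lambda>t. K t $$ (i, j)) has_fps_expansion a i j"
    by metis
  have "meq {..<n} (mtr a) a"
    unfolding meq_def mtr_def
  proof (intro ballI)
    fix i j assume "i \<in> {..<n}" "j \<in> {..<n}"
    then have ij: "i < n" "j < n"
      by simp_all
    have "\<forall>\<^sub>F t in nhds 0. K t $$ (j, i) = K t $$ (i, j)"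
      using K
    proof eventually_elim
      case (elim t)
      then show ?case
        using ij by (metis carrier_matD index_transpose_mat(1))
    qed
    then show "a j i = a i j"
      using ij by (intro has_fps_expansion_eq_at_right(1)[OF a a] eventually_nhds_at_within)
  qed
  moreover have "fps_conv_radius (a i j) > 0" if "i \<in> {..<n}" "j \<in> {..<n}" for i j
    using a that by (simp add: has_fps_expansion_def)
  ultimately have "\<exists>q d. (\<forall>i\<in>{..<n}. \<forall>j\<in>{..<n}. fps_conv_radius (q i j) > 0) \<and>
      (\<forall>j\<in>{..<n}. fps_conv_radius (d j) > 0) \<and>
      meq {..<n} (mmul {..<n} a q) (mmul {..<n} q (dmat d)) \<and>
      meq {..<n} (mmul {..<n} (mtr q) q) (dmat (\<lambda>_. 1))"
    by (intro symmetric_fps_diagonalization finite_lessThan)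
  then obtain q d where qd: "\<forall>i\<in>{..<n}. \<forall>j\<in>{..<n}. fps_conv_radius (q i j) > 0"
      "\<forall>j\<in>{..<n}. fps_conv_radius (d j) > 0"
    and diag: "meq {..<n} (mmul {..<n} a q) (mmul {..<n} q (dmat d))"
    and orth: "meq {..<n} (mmul {..<n} (mtr q) q) (dmat (\<lambda>_. 1))"
    by (elim exE conjE)
  have conv: "\<And>i j. i < n \<Longrightarrow> j < n \<Longrightarrow> fps_conv_radius (q i j) > 0"
      "\<And>j. j < n \<Longrightarrow> fps_conv_radius (d j) > 0"
    using qd by simp_all
  define u where "u = (\<lambda>k t. vec n (\<lambda>i. eval_fps (q i k) t))"
  define lam where "lam = (\<lambda>k. eval_fps (d k))"
  have q: "eval_fps (q i k) has_fps_expansion q i k" if "i < n" "k < n" for i k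
    using conv that by (intro eval_fps_has_fps_expansion)
  have d: "eval_fps (d k) has_fps_expansion d k" if "k < n" for k
    using conv that by (intro eval_fps_has_fps_expansion)
  have "\<forall>\<^sub>F t in nhds 0. \<forall>i\<in>{..<n}. \<forall>k\<in>{..<n}.
      (\<Sum>j<n. K t $$ (i, j) * eval_fps (q j k) t) = eval_fps (q i k) t * eval_fps (d k) t"
  proof (intro eventually_ball_finite finite_lessThan ballI)
    fix i k assume "i \<in> {..<n}" "k \<in> {..<n}"
    then have ik: "i < n" "k < n"
      by simp_all
    have eq: "(\<Sum>j<n. a i j * q j k) = q i k * d k"
      using meqD[OF diag, of i k] ik by (simp add: mmul_dmat_right) (simp add: mmul_def)
    have "(\<lambda>t. \<Sum>j<n. K t $$ (i, j) * eval_fps (q j k) t) has_fps_expansion q i k * d k"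
      unfolding eq[symmetric] using ik by (intro has_fps_expansion_sum has_fps_expansion_mult a q) auto
    moreover have "(\<lambda>t. eval_fps (q i k) t * eval_fps (d k) t) has_fps_expansion q i k * d k"
      using ik by (intro has_fps_expansion_mult q d)
    ultimately show "\<forall>\<^sub>F t in nhds 0.
        (\<Sum>j<n. K t $$ (i, j) * eval_fps (q j k) t) = eval_fps (q i k) t * eval_fps (d k) t"
      by (rule has_fps_expansion_eventually_eq)
  qed
  moreover have "\<forall>\<^sub>F t in nhds 0. \<forall>j\<in>{..<n}. \<forall>k\<in>{..<n}.
      (\<Sum>i<n. eval_fps (q i j) t * eval_fps (q i k) t) = (if j = k then 1 else 0)"
  proof (intro eventually_ball_finite finite_lessThan ballI)
    fix j k assume "j \<in> {..<n}" "k \<in> {..<n}"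
    then have jk: "j < n" "k < n"
      by simp_all
    have "(\<lambda>t. \<Sum>i<n. eval_fps (q i j) t * eval_fps (q i k) t) has_fps_expansion (\<Sum>i<n. q i j * q i k)"
      using jk by (intro has_fps_expansion_sum has_fps_expansion_mult q) auto
    also have "(\<Sum>i<n. q i j * q i k) = (if j = k then 1 else 0)"
      using meqD[OF orth, of j k] jk by (simp add: mmul_def mtr_def dmat_def)
    finally have "(\<lambda>t. \<Sum>i<n. eval_fps (q i j) t * eval_fps (q i k) t) has_fps_expansion (if j = k then 1 else 0)" .
    moreover have "(\<lambda>_::real. if j = k then 1 else 0) has_fps_expansion (if j = k then 1 else (0 :: real fps))"
      by simp
    ultimately show "\<forall>\<^sub>F t in nhds 0.
        (\<Sum>i<n. eval_fps (q i j) t * eval_fps (q i k) t) = (if j = k then 1 else 0)"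
      by (rule has_fps_expansion_eventually_eq)
  qed
  ultimately have ev: "\<forall>\<^sub>F t in nhds 0.
      (\<forall>k<n. u k t \<in> carrier_vec n \<and> eigenvector (K t) (u k t) (lam k t)) \<and>
      (\<forall>j<n. \<forall>k<n. u j t \<bullet> u k t = (if j = k then 1 else 0))"
    using K
  proof eventually_elim
    case (elim t)
    have orth: "u j t \<bullet> u k t = (if j = k then 1 else 0)" if "j < n" "k < n" for j k
      using elim(2) that by (simp add: u_def scalar_prod_def atLeast0LessThan)
    have "eigenvector (K t) (u k t) (lam k t)" if k: "k < n" for k
    proof -
      have "u k t \<noteq> 0\<^sub>v n"
      proof
        assume "u k t = 0\<^sub>v n"
        then have "u k t \<bullet> u k t = 0"
          by simp
        with orth[OF k k] show False
          by simp
      qed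
      moreover have "K t *\<^sub>v u k t = lam k t \<cdot>\<^sub>v u k t"
      proof (rule eq_vecI)
        show "dim_vec (K t *\<^sub>v u k t) = dim_vec (lam k t \<cdot>\<^sub>v u k t)"
          using elim(3) by (auto simp: u_def)
        fix i assume "i < dim_vec (lam k t \<cdot>\<^sub>v u k t)"
        then have i: "i < n"
          by (simp add: u_def)
        have "vec_index (K t *\<^sub>v u k t) i = (\<Sum>j<n. K t $$ (i, j) * eval_fps (q j k) t)"
          using i elim(3) by (auto simp: u_def scalar_prod_def atLeast0LessThan)
        also have "\<dots> = eval_fps (q i k) t * eval_fps (d k) t"
          using elim(1) i k by simp
        finally show "vec_index (K t *\<^sub>v u k t) i = vec_index (lam k t \<cdot>\<^sub>v u k t) i"
          using i by (simp add: u_def lam_def mult.commute)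
      qed
      ultimately show ?thesis
        using elim(3) by (auto simp: eigenvector_def u_def)
    qed
    with orth show ?case
      by (simp add: u_def)
  qed
  have "analytic_at_0 (\<lambda>t. vec_index (u k t) i)" if "k < n" "i < n" for k i
    using q[OF that(2,1)] that by (auto simp: analytic_at_0_def u_def)
  moreover have "analytic_at_0 (lam k)" if "k < n" for k
    using d[OF that] by (auto simp: analytic_at_0_def lam_def)
  ultimately have "analytic_eigensystem n K lam u"
    using ev unfolding analytic_eigensystem_def by simp
  then show ?thesis
    by blast
qed

subsection \<open>Comparison of asymptotic spectral equivalents\<close>

text \<open>Existence turns the \<open>SOME\<close> of \<open>ase\<close> into a genuine
  eigensystem. The later comparison works for arbitrary eigensystems, so it does not matter which
  one was selected.\<close>

lemma ase_via_eigensystem: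
  assumes "sym_analytic_mat n K"
  obtains lam u where "analytic_eigensystem n K lam u"
    and "ase n K = (\<lambda>\<epsilon>. mat n n (\<lambda>(i, j).
      \<Sum>k<n. lead_term (lam k) \<epsilon> * (vec_index (u k 0) i * vec_index (u k 0) j)))"
proof -
  define p where "p = (SOME (lam, u). analytic_eigensystem n K lam u)"
  have "\<exists>p. case p of (lam, u) \<Rightarrow> analytic_eigensystem n K lam u"
    using analytic_eigensystem_exists[OF assms] by auto
  then have "case p of (lam, u) \<Rightarrow> analytic_eigensystem n K lam u"
    unfolding p_def by (rule someI_ex)
  then have "analytic_eigensystem n K (fst p) (snd p)"
    by (simp add: case_prod_beta)
  then show thesis
    by (rule that) (simp add: ase_def p_def[symmetric] case_prod_beta)
qed

text \<open>Orthonormality says that the transpose is a one-sided inverse, and for a square matrix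
  it is then two-sided. This allows one limiting eigenbasis to be expanded in the other.\<close>

lemma orthonormal_complete:
  fixes v :: "nat \<Rightarrow> nat \<Rightarrow> real"
  assumes "\<And>j k. j < n \<Longrightarrow> k < n \<Longrightarrow> (\<Sum>i<n. v j i * v k i) = (if j = k then 1 else 0)"
    and ij: "i < n" "j < n"
  shows "(\<Sum>k<n. v k i * v k j) = (if i = j then 1 else 0)"
proof -
  define V where "V = mat n n (\<lambda>(k, i). v k i)"
  have V: "V \<in> carrier_mat n n"
    by (simp add: V_def)
  have "V * transpose_mat V = 1\<^sub>m n"
    by (rule eq_matI) (auto simp: V_def scalar_prod_def atLeast0LessThan assms(1))
  then have "transpose_mat V * V = 1\<^sub>m n"
    using mat_mult_left_right_inverse[OF V] V by simp
  from arg_cong[OF this, of "\<lambda>A. A $$ (i, j)"] ij show ?thesis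
    by (simp add: V_def scalar_prod_def atLeast0LessThan)
qed

lemma analytic_eigensystemD:
  assumes "analytic_eigensystem n K lam u"
  shows "k < n \<Longrightarrow> analytic_at_0 (lam k)"
    and "k < n \<Longrightarrow> i < n \<Longrightarrow> ((\<lambda>t. vec_index (u k t) i) \<longlongrightarrow> vec_index (u k 0) i) (at_right 0)"
    and "\<forall>\<^sub>F t in at_right 0. \<forall>k<n. u k t \<in> carrier_vec n \<and> eigenvector (K t) (u k t) (lam k t)"
    and "j < n \<Longrightarrow> k < n \<Longrightarrow> (\<Sum>i<n. vec_index (u j 0) i * vec_index (u k 0) i) = (if j = k then 1 else 0)"
proof -
  show "analytic_at_0 (lam k)" if "k < n"
    using assms that by (simp add: analytic_eigensystem_def)
  show "((\<lambda>t. vec_index (u k t) i) \<longlongrightarrow> vec_index (u k 0) i) (at_right 0)" if "k < n" "i < n"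
  proof -
    have "analytic_at_0 (\<lambda>t. vec_index (u k t) i)"
      using assms that by (simp add: analytic_eigensystem_def)
    then show ?thesis
      unfolding analytic_at_0_def by (auto dest: has_fps_expansion_tendsto)
  qed
  have ev: "\<forall>\<^sub>F t in nhds 0. (\<forall>k<n. u k t \<in> carrier_vec n \<and> eigenvector (K t) (u k t) (lam k t)) \<and>
      (\<forall>j<n. \<forall>k<n. Matrix.scalar_prod (u j t) (u k t) = (if j = k then 1 else 0))"
    using assms by (simp add: analytic_eigensystem_def)
  then show "\<forall>\<^sub>F t in at_right 0. \<forall>k<n. u k t \<in> carrier_vec n \<and> eigenvector (K t) (u k t) (lam k t)"
    by (intro eventually_nhds_at_within) (auto elim: eventually_mono)
  \<comment> \<open>The filter \<open>nhds 0\<close> includes the point 0, so orthonormality holds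
    for the limiting vectors themselves.\<close>
  have at0: "u k 0 \<in> carrier_vec n" "Matrix.scalar_prod (u j 0) (u k 0) = (if j = k then 1 else 0)"
    if "j < n" "k < n" for j k
    using eventually_nhds_x_imp_x[OF ev] that by auto
  show "(\<Sum>i<n. vec_index (u j 0) i * vec_index (u k 0) i) = (if j = k then 1 else 0)"
    if "j < n" "k < n"
    using at0[OF that] by (simp add: scalar_prod_def atLeast0LessThan)
qed

lemma tendsto_bilinear:
  fixes P :: "real \<Rightarrow> real mat"
  assumes P: "\<And>i j. i < n \<Longrightarrow> j < n \<Longrightarrow> ((\<lambda>t. P t $$ (i, j)) \<longlongrightarrow> (if i = j then 1 else 0)) F"
    and dims: "\<forall>\<^sub>F t in F. P t \<in> carrier_mat n n \<and> x t \<in> carrier_vec n \<and> y t \<in> carrier_vec n"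
    and x: "\<And>i. i < n \<Longrightarrow> ((\<lambda>t. vec_index (x t) i) \<longlongrightarrow> x' i) F"
    and y: "\<And>i. i < n \<Longrightarrow> ((\<lambda>t. vec_index (y t) i) \<longlongrightarrow> y' i) F"
  shows "((\<lambda>t. Matrix.scalar_prod (x t) (P t *\<^sub>v y t)) \<longlongrightarrow> (\<Sum>i<n. x' i * y' i)) F"
proof -
  have "\<forall>\<^sub>F t in F. (\<Sum>i<n. vec_index (x t) i * (\<Sum>j<n. P t $$ (i, j) * vec_index (y t) j))
      = Matrix.scalar_prod (x t) (P t *\<^sub>v y t)"
    using dims by eventually_elim (auto simp: scalar_prod_def atLeast0LessThan intro!: sum.cong)
  moreover have "((\<lambda>t. \<Sum>i<n. vec_index (x t) i * (\<Sum>j<n. P t $$ (i, j) * vec_index (y t) j)) \<longlongrightarrow>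
      (\<Sum>i<n. x' i * (\<Sum>j<n. (if i = j then 1 else 0) * y' j))) F"
    by (intro tendsto_sum tendsto_mult x y P) auto
  moreover have "(\<Sum>i<n. x' i * (\<Sum>j<n. (if i = j then 1 else 0) * y' j)) = (\<Sum>i<n. x' i * y' i)"
    by (simp add: if_distrib[of "\<lambda>x. x * _"] cong: if_cong)
  ultimately show ?thesis
    by (simp add: tendsto_cong)
qed

text \<open>The overlaps \<open>c k l\<close> form an orthogonal matrix that intertwines the two
  diagonal matrices of leading terms, so neither multiple eigenvalues nor the numbering of the
  spectra need attention. Of \<open>P\<close> and \<open>R\<close> only the intertwining relation
  and the limits from the right enter.\<close>

theorem ase_eqI:
  assumes K: "sym_analytic_mat n K" and K': "sym_analytic_mat n K'"
    and PR: "\<forall>\<^sub>F t in at_right 0. P t \<in> carrier_mat n n \<and> R t \<in> carrier_mat n n \<and> K t * P t = R t * K' t"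
    and P: "\<And>i j. i < n \<Longrightarrow> j < n \<Longrightarrow> ((\<lambda>t. P t $$ (i, j)) \<longlongrightarrow> (if i = j then 1 else 0)) (at_right 0)"
    and R: "\<And>i j. i < n \<Longrightarrow> j < n \<Longrightarrow> ((\<lambda>t. R t $$ (i, j)) \<longlongrightarrow> (if i = j then 1 else 0)) (at_right 0)"
  shows "ase n K = ase n K'"
proof -
  obtain lam u where es: "analytic_eigensystem n K lam u"
    and ase: "ase n K = (\<lambda>\<epsilon>. mat n n (\<lambda>(i, j).
      \<Sum>k<n. lead_term (lam k) \<epsilon> * (vec_index (u k 0) i * vec_index (u k 0) j)))"
    by (rule ase_via_eigensystem[OF K])
  obtain lam' u' where es': "analytic_eigensystem n K' lam' u'"
    and ase': "ase n K' = (\<lambda>\<epsilon>. mat n n (\<lambda>(i, j).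
      \<Sum>k<n. lead_term (lam' k) \<epsilon> * (vec_index (u' k 0) i * vec_index (u' k 0) j)))"
    by (rule ase_via_eigensystem[OF K'])
  note D = analytic_eigensystemD[OF es] and D' = analytic_eigensystemD[OF es']
  have sym: "\<forall>\<^sub>F t in at_right 0. K t \<in> carrier_mat n n \<and> transpose_mat (K t) = K t"
    and sym': "\<forall>\<^sub>F t in at_right 0. K' t \<in> carrier_mat n n \<and> transpose_mat (K' t) = K' t"
    using K K' by (simp_all add: sym_analytic_mat_def eventually_nhds_at_within)
  define v where "v = (\<lambda>k i. vec_index (u k 0) i)"
  define v' where "v' = (\<lambda>k i. vec_index (u' k 0) i)"
  define c where "c = (\<lambda>k l. \<Sum>i<n. v k i * v' l i)"
  \<comment> \<open>The factor \<open>c k l\<close> merges two cases: orthogonal limiting vectors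
    give 0 on both sides, all others force equal leading terms.\<close>
  have lt: "lead_term (lam k) \<epsilon> * c k l = lead_term (lam' l) \<epsilon> * c k l" if kl: "k < n" "l < n" for k l \<epsilon>
  proof (cases "c k l = 0")
    case False
    have "lead_term (lam k) = lead_term (lam' l)"
    proof (rule lead_term_eq_if_asymptotic[OF D(1)[OF kl(1)] D'(1)[OF kl(2)] _ _ False])
      have dims: "\<forall>\<^sub>F t in at_right 0. P t \<in> carrier_mat n n \<and> u k t \<in> carrier_vec n \<and> u' l t \<in> carrier_vec n"
          "\<forall>\<^sub>F t in at_right 0. R t \<in> carrier_mat n n \<and> u k t \<in> carrier_vec n \<and> u' l t \<in> carrier_vec n"
        using PR D(3) D'(3) by (eventually_elim, use kl in blast)+
      show "((\<lambda>t. Matrix.scalar_prod (u k t) (P t *\<^sub>v u' l t)) \<longlongrightarrow> c k l) (at_right 0)"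
        unfolding c_def v_def v'_def using kl by (intro tendsto_bilinear P dims D(2) D'(2))
      show "((\<lambda>t. Matrix.scalar_prod (u k t) (R t *\<^sub>v u' l t)) \<longlongrightarrow> c k l) (at_right 0)"
        unfolding c_def v_def v'_def using kl by (intro tendsto_bilinear R dims D(2) D'(2))
      show "\<forall>\<^sub>F t in at_right 0. lam k t * Matrix.scalar_prod (u k t) (P t *\<^sub>v u' l t)
          = lam' l t * Matrix.scalar_prod (u k t) (R t *\<^sub>v u' l t)"
        using PR D(3) D'(3) sym sym'
      proof eventually_elim
        case (elim t)
        have dim: "K t \<in> carrier_mat n n" "K' t \<in> carrier_mat n n" "P t \<in> carrier_mat n n" "R t \<in> carrier_mat n n"
            "u k t \<in> carrier_vec n" "u' l t \<in> carrier_vec n"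
          using elim kl by auto
        have eig: "K t *\<^sub>v u k t = lam k t \<cdot>\<^sub>v u k t" "K' t *\<^sub>v u' l t = lam' l t \<cdot>\<^sub>v u' l t"
          using elim kl by (auto simp: eigenvector_def)
        \<comment> \<open>By symmetry \<open>K t\<close> moves between the two arguments of the
          scalar product, acting on the left by \<open>lam k t\<close>; on the right the
          intertwining relation replaces \<open>K P\<close> by \<open>R K'\<close> and brings out
          \<open>lam' l t\<close>.\<close>
        have "lam k t * Matrix.scalar_prod (u k t) (P t *\<^sub>v u' l t)
            = Matrix.scalar_prod (transpose_mat (K t) *\<^sub>v u k t) (P t *\<^sub>v u' l t)"
          using elim(4) dim by (simp add: eig)
        also have "\<dots> = Matrix.scalar_prod (u k t) (K t *\<^sub>v (P t *\<^sub>v u' l t))"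
          using dim by (intro transpose_vec_mult_scalar) auto
        also have "K t *\<^sub>v (P t *\<^sub>v u' l t) = R t *\<^sub>v (K' t *\<^sub>v u' l t)"
          using dim elim(1) by (metis assoc_mult_mat_vec)
        also have "Matrix.scalar_prod (u k t) \<dots> = lam' l t * Matrix.scalar_prod (u k t) (R t *\<^sub>v u' l t)"
          using dim by (simp add: eig mult_mat_vec)
        finally show ?case .
      qed
    qed
    then show ?thesis
      by simp
  qed simp
  have complete: "(\<Sum>k<n. v k i * c k l) = v' l i" if "i < n" "l < n" for i l
  proof -
    have "(\<Sum>k<n. v k i * c k l) = (\<Sum>k<n. \<Sum>j<n. v k i * v k j * v' l j)"
      by (simp add: c_def sum_distrib_left mult.assoc)
    also have "\<dots> = (\<Sum>j<n. \<Sum>k<n. v k i * v k j * v' l j)"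
      by (rule sum.swap)
    also have "\<dots> = (\<Sum>j<n. (if i = j then 1 else 0) * v' l j)"
      using orthonormal_complete[of n v i] D(4) that(1)
      by (intro sum.cong refl) (simp add: sum_distrib_right[symmetric] v_def)
    finally show ?thesis
      using that by (simp add: if_distrib[of "\<lambda>x. x * _"] cong: if_cong)
  qed
  have complete': "(\<Sum>l<n. c k l * v' l i) = v k i" if "i < n" "k < n" for i k
  proof -
    have "(\<Sum>l<n. c k l * v' l i) = (\<Sum>l<n. \<Sum>j<n. v k j * (v' l j * v' l i))"
      by (simp add: c_def sum_distrib_right mult.assoc)
    also have "\<dots> = (\<Sum>j<n. \<Sum>l<n. v k j * (v' l j * v' l i))"
      by (rule sum.swap)
    also have "\<dots> = (\<Sum>j<n. v k j * (if j = i then 1 else 0))"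
      using orthonormal_complete[of n v' _ i] D'(4) that(1)
      by (intro sum.cong refl) (simp add: sum_distrib_left[symmetric] v'_def)
    finally show ?thesis
      using that by (simp add: if_distrib[of "\<lambda>x. _ * x"] cong: if_cong)
  qed
  have "(\<Sum>k<n. lead_term (lam k) \<epsilon> * (v k i * v k j)) = (\<Sum>l<n. lead_term (lam' l) \<epsilon> * (v' l i * v' l j))"
    if "i < n" "j < n" for i j \<epsilon>
  proof -
    \<comment> \<open>Only the factor \<open>v k j\<close> is expanded in the primed basis. Once
      \<open>lam k\<close> has been exchanged for \<open>lam' l\<close>, the sum over
      \<open>k\<close> turns the remaining \<open>v k i\<close> into \<open>v' l i\<close>.\<close>
    have "(\<Sum>k<n. lead_term (lam k) \<epsilon> * (v k i * v k j))
        = (\<Sum>k<n. \<Sum>l<n. lead_term (lam k) \<epsilon> * c k l * v k i * v' l j)"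
    proof (intro sum.cong refl)
      fix k assume "k \<in> {..<n}"
      then have "v k j = (\<Sum>l<n. c k l * v' l j)"
        using complete' that by simp
      then show "lead_term (lam k) \<epsilon> * (v k i * v k j) = (\<Sum>l<n. lead_term (lam k) \<epsilon> * c k l * v k i * v' l j)"
        by (simp add: sum_distrib_left mult_ac)
    qed
    also have "\<dots> = (\<Sum>k<n. \<Sum>l<n. lead_term (lam' l) \<epsilon> * c k l * v k i * v' l j)"
      using lt by (intro sum.cong refl) simp
    also have "\<dots> = (\<Sum>l<n. \<Sum>k<n. lead_term (lam' l) \<epsilon> * c k l * v k i * v' l j)"
      by (rule sum.swap)
    also have "\<dots> = (\<Sum>l<n. lead_term (lam' l) \<epsilon> * ((\<Sum>k<n. v k i * c k l) * v' l j))"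
      by (simp add: sum_distrib_left sum_distrib_right mult_ac)
    finally show ?thesis
      using complete that by simp
  qed
  then show ?thesis
    unfolding ase ase' by (auto simp: fun_eq_iff v_def v'_def)
qed

section \<open>Determinants, adjugates and inverses of matrix functions\<close>

lemma analytic_at_0_det:
  assumes "\<And>t. A t \<in> carrier_mat m m"
    and "\<And>i j. i < m \<Longrightarrow> j < m \<Longrightarrow> analytic_at_0 (\<lambda>t. A t $$ (i, j))"
  shows "analytic_at_0 (\<lambda>t. det (A t))"
  unfolding det_def'[OF assms(1)]
  by (intro analytic_at_0_sum analytic_at_0_mult analytic_at_0_const analytic_at_0_prod assms(2))
    (auto dest: permutes_in_image)

lemma tendsto_det:
  fixes A :: "real \<Rightarrow> real mat"
  assumes "\<And>t. A t \<in> carrier_mat m m" "B \<in> carrier_mat m m"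
    and "\<And>i j. i < m \<Longrightarrow> j < m \<Longrightarrow> ((\<lambda>t. A t $$ (i, j)) \<longlongrightarrow> B $$ (i, j)) F"
  shows "((\<lambda>t. det (A t)) \<longlongrightarrow> det B) F"
  unfolding det_def'[OF assms(1)] det_def'[OF assms(2)]
  by (intro tendsto_sum tendsto_mult tendsto_const tendsto_prod assms(3)) (auto dest: permutes_in_image)

lemma adj_mat_index:
  "A \<in> carrier_mat m m \<Longrightarrow> i < m \<Longrightarrow> j < m \<Longrightarrow>
    adj_mat A $$ (i, j) = (- 1) ^ (j + i) * det (mat_delete A j i)"
  by (auto simp: adj_mat_def cofactor_def)

lemma mat_delete_entry:
  "A \<in> carrier_mat m m \<Longrightarrow> i' < m - 1 \<Longrightarrow> j' < m - 1 \<Longrightarrow>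
    mat_delete A i j $$ (i', j') = A $$ (if i' < i then i' else Suc i', if j' < j then j' else Suc j')"
  by (auto simp: mat_delete_def)

lemma analytic_at_0_adj_mat:
  assumes A: "\<And>t. A t \<in> carrier_mat m m" and ij: "i < m" "j < m"
    and ana: "\<And>i j. i < m \<Longrightarrow> j < m \<Longrightarrow> analytic_at_0 (\<lambda>t. A t $$ (i, j))"
  shows "analytic_at_0 (\<lambda>t. adj_mat (A t) $$ (i, j))"
  unfolding adj_mat_index[OF A ij]
proof (intro analytic_at_0_mult analytic_at_0_const analytic_at_0_det[of _ "m - 1"])
  show "mat_delete (A t) j i \<in> carrier_mat (m - 1) (m - 1)" for t
    using A by (intro mat_delete_carrier) 
  fix i' j' assume "i' < m - 1" "j' < m - 1"
  then show "analytic_at_0 (\<lambda>t. mat_delete (A t) j i $$ (i', j'))"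
    unfolding mat_delete_entry[OF A \<open>i' < m - 1\<close> \<open>j' < m - 1\<close>] by (intro ana) auto
qed

lemma tendsto_adj_mat:
  fixes A :: "real \<Rightarrow> real mat"
  assumes A: "\<And>t. A t \<in> carrier_mat m m" and B: "B \<in> carrier_mat m m" and ij: "i < m" "j < m"
    and lim: "\<And>i j. i < m \<Longrightarrow> j < m \<Longrightarrow> ((\<lambda>t. A t $$ (i, j)) \<longlongrightarrow> B $$ (i, j)) F"
  shows "((\<lambda>t. adj_mat (A t) $$ (i, j)) \<longlongrightarrow> adj_mat B $$ (i, j)) F"
  unfolding adj_mat_index[OF A ij] adj_mat_index[OF B ij]
proof (intro tendsto_mult tendsto_const tendsto_det[of _ "m - 1"])
  show "mat_delete (A t) j i \<in> carrier_mat (m - 1) (m - 1)" for t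
    using A by (intro mat_delete_carrier)
  show "mat_delete B j i \<in> carrier_mat (m - 1) (m - 1)"
    using B by (intro mat_delete_carrier)
  fix i' j' assume "i' < m - 1" "j' < m - 1"
  then show "((\<lambda>t. mat_delete (A t) j i $$ (i', j')) \<longlongrightarrow> mat_delete B j i $$ (i', j')) F"
    unfolding mat_delete_entry[OF A \<open>i' < m - 1\<close> \<open>j' < m - 1\<close>]
      mat_delete_entry[OF B \<open>i' < m - 1\<close> \<open>j' < m - 1\<close>] by (intro lim) auto
qed

text \<open>The adjugate formula follows by cancelling \<open>A\<close> from
  \<open>A * adj_mat A\<close>. It expresses the inverse through polynomials in the entries, from
  which its limit can be read off.\<close>

lemma mat_inverse_nonsingular:
  fixes A :: "real mat"
  assumes A: "A \<in> carrier_mat m m" and d: "det A \<noteq> 0"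
  shows "the (mat_inverse A) \<in> carrier_mat m m"
    and "A * the (mat_inverse A) = 1\<^sub>m m" and "the (mat_inverse A) * A = 1\<^sub>m m"
    and "the (mat_inverse A) = (1 / det A) \<cdot>\<^sub>m adj_mat A"
proof -
  obtain B where B: "mat_inverse A = Some B"
    using mat_inverse(1)[OF A] det_non_zero_imp_unit[OF A d] by fastforce
  note B' = mat_inverse(2)[OF A B]
  show "the (mat_inverse A) \<in> carrier_mat m m" "A * the (mat_inverse A) = 1\<^sub>m m"
      "the (mat_inverse A) * A = 1\<^sub>m m"
    using B B' by auto
  note adj = adj_mat[OF A]
  have "adj_mat A = B * A * adj_mat A"
    using B' adj by simp
  also have "\<dots> = B * (A * adj_mat A)"
    using A B' adj by (intro assoc_mult_mat) auto
  also have "\<dots> = det A \<cdot>\<^sub>m B"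
    using B' adj mult_smult_distrib[of B m m "1\<^sub>m m" m] right_mult_one_mat[of B m m] by simp
  finally have "adj_mat A = det A \<cdot>\<^sub>m B" .
  then show "the (mat_inverse A) = (1 / det A) \<cdot>\<^sub>m adj_mat A"
    using d B by (auto intro!: eq_matI)
qed

subsection \<open>The Schur complement of the scaled matrix\<close>

lemma transpose_smult: "transpose_mat (c \<cdot>\<^sub>m A) = c \<cdot>\<^sub>m transpose_mat A"
  by (intro eq_matI) auto

text \<open>Block elimination with \<open>X\<close> given only through \<open>X * A = C\<close>.
  Transposing gives \<open>A * X^T = B\<close>, so the right factor, which is the inverse transpose
  of the unit lower triangular one, clears the upper right block. Symmetry of \<open>X * B\<close>
  makes the Schur complement symmetric.\<close>

lemma block_congruence:
  fixes A B C E X :: "real mat"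
  assumes A: "A \<in> carrier_mat m m" and B: "B \<in> carrier_mat m k" and C: "C \<in> carrier_mat k m"
    and E: "E \<in> carrier_mat k k" and X: "X \<in> carrier_mat k m"
    and XA: "X * A = C" and AT: "transpose_mat A = A" and CB: "C = transpose_mat B"
  shows "transpose_mat (X * B) = X * B"
    and "four_block_mat A B C E * four_block_mat (1\<^sub>m m) (- transpose_mat X) (0\<^sub>m k m) (1\<^sub>m k)
       = four_block_mat (1\<^sub>m m) (0\<^sub>m m k) X (1\<^sub>m k) * four_block_mat A (0\<^sub>m m k) (0\<^sub>m k m) (E - X * B)"
proof -
  define Y where "Y = transpose_mat X"
  have Y: "Y \<in> carrier_mat m k"
    using X by (simp add: Y_def)
  have AY: "A * Y = B"
  proof -
    have "A * Y = transpose_mat (X * A)"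
      unfolding Y_def using transpose_mult[OF X A] AT by simp
    then show ?thesis
      by (simp add: XA CB)
  qed
  have CY: "C * Y = X * B"
    unfolding XA[symmetric] AY[symmetric] using X A Y by (rule assoc_mult_mat)
  show "transpose_mat (X * B) = X * B"
    unfolding transpose_mult[OF X B] CB[symmetric] Y_def[symmetric] by (rule CY)
  have XB: "X * B \<in> carrier_mat k k"
    using X B by simp
  have AY': "A * - Y + B * 1\<^sub>m k = 0\<^sub>m m k"
    using A Y B by (subst uminus_mult_right_mat) (auto simp: AY)
  have "- M + E = E - M" if "M \<in> carrier_mat k k" for M
    using that E by (intro eq_matI) auto
  then have CY': "C * - Y + E * 1\<^sub>m k = E - X * B"
    using C Y E XB by (subst uminus_mult_right_mat) (auto simp: CY)
  have "four_block_mat A B C E * four_block_mat (1\<^sub>m m) (- Y) (0\<^sub>m k m) (1\<^sub>m k)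
      = four_block_mat A (0\<^sub>m m k) C (E - X * B)"
    using A B C E Y AY' CY' by (subst mult_four_block_mat) auto
  also have "\<dots> = four_block_mat (1\<^sub>m m) (0\<^sub>m m k) X (1\<^sub>m k) * four_block_mat A (0\<^sub>m m k) (0\<^sub>m k m) (E - X * B)"
  proof -
    define M where "M = E - X * B"
    have M: "M \<in> carrier_mat k k"
      unfolding M_def by (rule minus_carrier_mat[OF XB])
    have "1\<^sub>m m * A + 0\<^sub>m m k * 0\<^sub>m k m = A"
      using A by simp
    moreover have "1\<^sub>m m * 0\<^sub>m m k + 0\<^sub>m m k * M = 0\<^sub>m m k"
      using M by simp
    moreover have "X * A + 1\<^sub>m k * 0\<^sub>m k m = C"
      using XA C by simp
    moreover have "X * 0\<^sub>m m k + 1\<^sub>m k * M = M"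
      using X M by simp
    ultimately show ?thesis
      unfolding M_def[symmetric]
        mult_four_block_mat[OF one_carrier_mat zero_carrier_mat X one_carrier_mat A zero_carrier_mat zero_carrier_mat M]
      by simp
  qed
  finally show "four_block_mat A B C E * four_block_mat (1\<^sub>m m) (- transpose_mat X) (0\<^sub>m k m) (1\<^sub>m k)
       = four_block_mat (1\<^sub>m m) (0\<^sub>m m k) X (1\<^sub>m k) * four_block_mat A (0\<^sub>m m k) (0\<^sub>m k m) (E - X * B)"
    by (simp add: Y_def)
qed

text \<open>Here \<open>X = c C A^(-1) D^(-1)\<close>, so column \<open>j\<close> carries the power
  \<open>s / 2 - \<gamma> j\<close> of \<open>t\<close>. The scaling \<open>D\<close> cancels in
  \<open>X * (D * B)\<close>, and the Schur complement of the scaled matrix is \<open>c * c\<close>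
  times that of the unscaled one. The facts are those that the block congruence asks for.\<close>

lemma scaled_schur_complement:
  fixes A B C E :: "real mat" and t :: real and s :: int and \<gamma> :: "nat \<Rightarrow> real"
  assumes t: "t > 0" and A: "A \<in> carrier_mat m m" and B: "B \<in> carrier_mat m k"
    and C: "C \<in> carrier_mat k m" and E: "E \<in> carrier_mat k k"
    and AT: "transpose_mat A = A" and CB: "C = transpose_mat B" and d: "det A \<noteq> 0"
  defines "D \<equiv> Delta_m m \<gamma> t" and "c \<equiv> t powr (real_of_int s / 2)"
  defines "X \<equiv> mat k m (\<lambda>(i, j). c * (C * the (mat_inverse A)) $$ (i, j) * t powr - \<gamma> j)"
  shows "four_block_mat D (0\<^sub>m m k) (0\<^sub>m k m) (c \<cdot>\<^sub>m 1\<^sub>m k) * four_block_mat A B C E *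
          four_block_mat D (0\<^sub>m m k) (0\<^sub>m k m) (c \<cdot>\<^sub>m 1\<^sub>m k)
       = four_block_mat (D * A * D) (c \<cdot>\<^sub>m (D * B)) (c \<cdot>\<^sub>m (C * D)) ((t powi s) \<cdot>\<^sub>m E)"
    and "X * (D * A * D) = c \<cdot>\<^sub>m (C * D)"
    and "(t powi s) \<cdot>\<^sub>m (E - C * the (mat_inverse A) * B) = (t powi s) \<cdot>\<^sub>m E - X * (c \<cdot>\<^sub>m (D * B))"
    and "det (D * A * D) \<noteq> 0"
    and "transpose_mat (D * A * D) = D * A * D"
    and "c \<cdot>\<^sub>m (C * D) = transpose_mat (c \<cdot>\<^sub>m (D * B))"
proof -
  define I where "I = the (mat_inverse A)"
  have I: "I \<in> carrier_mat m m" "I * A = 1\<^sub>m m"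
    using mat_inverse_nonsingular[OF A d] by (simp_all add: I_def)
  have D: "D \<in> carrier_mat m m"
    by (simp add: D_def Delta_m_def)
  have DT: "transpose_mat D = D"
    by (auto simp: D_def Delta_m_def mat_diag_def intro!: eq_matI)
  define D' where "D' = mat_diag m (\<lambda>j. t powr - \<gamma> j)"
  have D': "D' \<in> carrier_mat m m"
    by (simp add: D'_def)
  have D'D: "D' * D = 1\<^sub>m m"
    using t by (simp add: D'_def D_def Delta_m_def powr_minus)
  \<comment> \<open>Two real powers with exponent \<open>s / 2\<close> combine to the integer power
    that occurs in \<open>K_prime\<close>.\<close>
  have cc: "c * c = t powi s"
  proof -
    have "c * c = t powr (real_of_int s)"
      using t by (simp add: c_def powr_add[symmetric])
    then show ?thesis
      using t by (simp add: powr_real_of_int')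
  qed
  have CI: "C * I \<in> carrier_mat k m"
    using C I by simp
  have X: "X = c \<cdot>\<^sub>m (C * I * D')"
    unfolding D'_def mat_diag_mult_right[OF CI] using C I by (auto simp: X_def I_def intro!: eq_matI)
  have Xc: "X \<in> carrier_mat k m"
    by (simp add: X_def)
  show "four_block_mat D (0\<^sub>m m k) (0\<^sub>m k m) (c \<cdot>\<^sub>m 1\<^sub>m k) * four_block_mat A B C E *
          four_block_mat D (0\<^sub>m m k) (0\<^sub>m k m) (c \<cdot>\<^sub>m 1\<^sub>m k)
       = four_block_mat (D * A * D) (c \<cdot>\<^sub>m (D * B)) (c \<cdot>\<^sub>m (C * D)) ((t powi s) \<cdot>\<^sub>m E)"
  proof -
    have 1: "c \<cdot>\<^sub>m 1\<^sub>m k * M = c \<cdot>\<^sub>m M" if "M \<in> carrier_mat k l" for M :: "real mat" and l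
      using mult_smult_assoc_mat[of "1\<^sub>m k" k k M l c] left_mult_one_mat[OF that] that by simp
    have 2: "M * (c \<cdot>\<^sub>m 1\<^sub>m k) = c \<cdot>\<^sub>m M" if "M \<in> carrier_mat l k" for M :: "real mat" and l
      using mult_smult_distrib[OF that, of "1\<^sub>m k" k c] right_mult_one_mat[OF that] that by simp
    have "four_block_mat D (0\<^sub>m m k) (0\<^sub>m k m) (c \<cdot>\<^sub>m 1\<^sub>m k) * four_block_mat A B C E
        = four_block_mat (D * A) (D * B) (c \<cdot>\<^sub>m C) (c \<cdot>\<^sub>m E)"
      using A B C E D by (subst mult_four_block_mat) (auto simp: 1)
    moreover have "four_block_mat (D * A) (D * B) (c \<cdot>\<^sub>m C) (c \<cdot>\<^sub>m E) *
        four_block_mat D (0\<^sub>m m k) (0\<^sub>m k m) (c \<cdot>\<^sub>m 1\<^sub>m k)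
        = four_block_mat (D * A * D) (c \<cdot>\<^sub>m (D * B)) (c \<cdot>\<^sub>m C * D) (c \<cdot>\<^sub>m (c \<cdot>\<^sub>m E))"
    proof -
      have 3: "D * A \<in> carrier_mat m m" "D * B \<in> carrier_mat m k" "c \<cdot>\<^sub>m C \<in> carrier_mat k m"
          "c \<cdot>\<^sub>m E \<in> carrier_mat k k" "c \<cdot>\<^sub>m C * D \<in> carrier_mat k m" "D * A * D \<in> carrier_mat m m"
        using A B C D E by auto
      show ?thesis
        unfolding mult_four_block_mat[OF 3(1-4) D zero_carrier_mat zero_carrier_mat smult_carrier_mat[OF one_carrier_mat]]
          2[OF 3(2)] 2[OF 3(4)] right_mult_zero_mat[OF 3(1)] right_mult_zero_mat[OF 3(2)]
          right_mult_zero_mat[OF 3(3)] right_mult_zero_mat[OF 3(4)] right_add_zero_mat[OF 3(5)]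
          right_add_zero_mat[OF 3(6)]
        using 3 by (simp add: left_add_zero_mat[of _ m k] left_add_zero_mat[of _ k k])
    qed
    moreover have "c \<cdot>\<^sub>m C * D = c \<cdot>\<^sub>m (C * D)"
      using C D by (rule mult_smult_assoc_mat)
    moreover have "c \<cdot>\<^sub>m (c \<cdot>\<^sub>m E) = (t powi s) \<cdot>\<^sub>m E"
      unfolding cc[symmetric] by (rule eq_matI) (simp_all add: mult.assoc)
    ultimately show ?thesis
      by simp
  qed
  have XM: "X * (D * M) = c \<cdot>\<^sub>m (C * I * M)" if "M \<in> carrier_mat m l" for M l
  proof -
    have DM: "D * M \<in> carrier_mat m l" "D' * (D * M) \<in> carrier_mat m l"
      using D D' that by auto
    have "X * (D * M) = c \<cdot>\<^sub>m (C * I * D' * (D * M))"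
      unfolding X using CI D' DM by (intro mult_smult_assoc_mat) auto
    also have "C * I * D' * (D * M) = C * I * (D' * (D * M))"
      using CI D' DM(1) by (rule assoc_mult_mat)
    also have "D' * (D * M) = D' * D * M"
      using D' D that by (rule assoc_mult_mat[symmetric])
    also have "\<dots> = M"
      using that by (simp add: D'D)
    finally show ?thesis .
  qed
  have AD: "A * D \<in> carrier_mat m m"
    using A D by simp
  show "X * (D * A * D) = c \<cdot>\<^sub>m (C * D)"
  proof -
    have "X * (D * A * D) = X * (D * (A * D))"
      using D A by (simp add: assoc_mult_mat[OF D A D])
    also have "\<dots> = c \<cdot>\<^sub>m (C * I * (A * D))"
      by (rule XM[OF AD])
    also have "C * I * (A * D) = C * (I * (A * D))"
      using C I(1) AD by (rule assoc_mult_mat)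
    also have "I * (A * D) = I * A * D"
      using I(1) A D by (rule assoc_mult_mat[symmetric])
    also have "\<dots> = D"
      using D by (simp add: I)
    finally show ?thesis .
  qed
  show "(t powi s) \<cdot>\<^sub>m (E - C * the (mat_inverse A) * B) = (t powi s) \<cdot>\<^sub>m E - X * (c \<cdot>\<^sub>m (D * B))"
  proof -
    have "X * (c \<cdot>\<^sub>m (D * B)) = c \<cdot>\<^sub>m (c \<cdot>\<^sub>m (C * I * B))"
      using mult_smult_distrib[OF Xc, of "D * B" k c] D B by (simp add: XM[OF B])
    also have "\<dots> = (t powi s) \<cdot>\<^sub>m (C * I * B)"
      unfolding cc[symmetric] by (rule eq_matI) (simp_all add: mult.assoc)
    finally have "X * (c \<cdot>\<^sub>m (D * B)) = (t powi s) \<cdot>\<^sub>m (C * I * B)" .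
    moreover have "a \<cdot>\<^sub>m (E - M) = a \<cdot>\<^sub>m E - a \<cdot>\<^sub>m M" if "M \<in> carrier_mat k k" for M a
      using E that by (intro eq_matI) (auto simp: right_diff_distrib)
    moreover have "C * I * B \<in> carrier_mat k k"
      using CI B by simp
    ultimately show ?thesis
      by (simp add: I_def)
  qed
  show "det (D * A * D) \<noteq> 0"
  proof -
    have "det D' * det D = 1"
      using det_mult[OF D' D] by (simp add: D'D)
    then have "det D \<noteq> 0"
      by auto
    then show ?thesis
      using A D d by (simp add: det_mult[of _ m])
  qed
  show "transpose_mat (D * A * D) = D * A * D"
  proof -
    have "transpose_mat (D * A * D) = D * (A * D)"
      using transpose_mult[of "D * A" m m D m] transpose_mult[OF D A] A D by (simp add: AT DT)
    then show ?thesis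
      using assoc_mult_mat[OF D A D] by simp
  qed
  show "c \<cdot>\<^sub>m (C * D) = transpose_mat (c \<cdot>\<^sub>m (D * B))"
    unfolding transpose_smult transpose_mult[OF D B] by (simp add: DT CB)
qed

lemma invertible_mat_det_ne_0:
  fixes A :: "'a :: field mat"
  assumes A: "A \<in> carrier_mat m m" and "invertible_mat A"
  shows "det A \<noteq> 0"
proof -
  obtain B where B: "A * B = 1\<^sub>m m" "B * A = 1\<^sub>m (dim_row B)"
    using assms unfolding invertible_mat_def inverts_mat_def by auto
  have "dim_col B = m" "dim_row B = m"
    using arg_cong[OF B(1), of dim_col] arg_cong[OF B(2), of dim_col] A by auto
  then have "B \<in> carrier_mat m m"
    by auto
  from det_mult[OF A this] B(1) show ?thesis
    by auto
qed

lemma tendsto_mat_inverse: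
  fixes A :: "real \<Rightarrow> real mat"
  assumes A: "\<forall>\<^sub>F t in F. A t \<in> carrier_mat m m" and B: "B \<in> carrier_mat m m" and d: "det B \<noteq> 0"
    and lim: "\<And>i j. i < m \<Longrightarrow> j < m \<Longrightarrow> ((\<lambda>t. A t $$ (i, j)) \<longlongrightarrow> B $$ (i, j)) F"
  shows "\<forall>\<^sub>F t in F. det (A t) \<noteq> 0"
    and "i < m \<Longrightarrow> j < m \<Longrightarrow>
      ((\<lambda>t. the (mat_inverse (A t)) $$ (i, j)) \<longlongrightarrow> the (mat_inverse B) $$ (i, j)) F"
proof -
  \<comment> \<open>Agrees with \<open>A\<close> wherever \<open>A\<close> has the right dimension,
    but has that dimension for all \<open>t\<close>, as the limit lemmas for determinants and
    adjugates demand.\<close>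
  define A' where "A' = (\<lambda>t. mat m m (\<lambda>ij. A t $$ ij))"
  have A': "A' t \<in> carrier_mat m m" for t
    by (simp add: A'_def)
  have AA': "\<forall>\<^sub>F t in F. A' t = A t"
    using A by eventually_elim (auto simp: A'_def)
  have lim': "((\<lambda>t. A' t $$ (i, j)) \<longlongrightarrow> B $$ (i, j)) F" if "i < m" "j < m" for i j
    using lim[OF that] that by (simp add: A'_def)
  have det: "((\<lambda>t. det (A' t)) \<longlongrightarrow> det B) F"
    by (rule tendsto_det[OF A' B lim'])
  then have "\<forall>\<^sub>F t in F. det (A' t) \<noteq> 0"
    using d by (rule tendsto_imp_eventually_ne)
  then show ev: "\<forall>\<^sub>F t in F. det (A t) \<noteq> 0"
    using AA' by eventually_elim simp
  show "((\<lambda>t. the (mat_inverse (A t)) $$ (i, j)) \<longlongrightarrow> the (mat_inverse B) $$ (i, j)) F"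
    if ij: "i < m" "j < m"
  proof -
    have inv: "the (mat_inverse M) $$ (i, j) = 1 / det M * adj_mat M $$ (i, j)"
      if "M \<in> carrier_mat m m" "det M \<noteq> 0" for M :: "real mat"
      using mat_inverse_nonsingular(4)[OF that] adj_mat(1)[OF that(1)] ij by simp
    have "\<forall>\<^sub>F t in F. 1 / det (A' t) * adj_mat (A' t) $$ (i, j) = the (mat_inverse (A t)) $$ (i, j)"
      using ev A AA' by eventually_elim (simp add: inv)
    moreover have "((\<lambda>t. 1 / det (A' t) * adj_mat (A' t) $$ (i, j)) \<longlongrightarrow> 1 / det B * adj_mat B $$ (i, j)) F"
      by (intro tendsto_intros det d tendsto_adj_mat[OF A' B ij lim'])
    ultimately show ?thesis
      using tendsto_cong by (fastforce simp: inv[OF B d])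
  qed
qed

section \<open>Equality of the spectral equivalents and analytic continuation of
  \<open>K'\<close>\<close>

theorem theorem7p1:
  fixes n m :: nat and s :: int and \<gamma> :: "nat \<Rightarrow> real" and \<delta> :: real
    and K H11 H12 H21 H22 :: "real \<Rightarrow> real mat"
  assumes "m \<le> n"
    and "sym_analytic_mat n K"
    and "\<delta> > 0"
    and "\<And>\<epsilon>. 0 \<le> \<epsilon> \<Longrightarrow> \<epsilon> < \<delta> \<Longrightarrow>
           H11 \<epsilon> \<in> carrier_mat m m \<and> H12 \<epsilon> \<in> carrier_mat m (n - m) \<and>
           H21 \<epsilon> \<in> carrier_mat (n - m) m \<and> H22 \<epsilon> \<in> carrier_mat (n - m) (n - m)"
    and "\<And>\<epsilon>. 0 \<le> \<epsilon> \<Longrightarrow> \<epsilon> < \<delta> \<Longrightarrow>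
           transpose_mat (H11 \<epsilon>) = H11 \<epsilon> \<and> transpose_mat (H22 \<epsilon>) = H22 \<epsilon> \<and>
           H21 \<epsilon> = transpose_mat (H12 \<epsilon>)"
    and "mat_cont_right_0 m m H11"
    and "mat_cont_right_0 m (n - m) H12"
    and "mat_cont_right_0 (n - m) m H21"
    and "mat_cont_right_0 (n - m) (n - m) H22"
    and "invertible_mat (H11 0)"
    and "\<And>i j. i \<le> j \<Longrightarrow> j < m \<Longrightarrow> \<gamma> i \<le> \<gamma> j"
    and "\<And>i. i < m \<Longrightarrow> \<gamma> i < real_of_int s / 2"
    and "\<And>\<epsilon>. 0 < \<epsilon> \<Longrightarrow> \<epsilon> < \<delta> \<Longrightarrow>
           K \<epsilon> = Delta n m \<gamma> s \<epsilon> * four_block_mat (H11 \<epsilon>) (H12 \<epsilon>) (H21 \<epsilon>) (H22 \<epsilon>)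
                 * Delta n m \<gamma> s \<epsilon>"
  shows "(\<exists>K'. sym_analytic_extension n (K_prime n m \<gamma> s H11 H12 H21 H22) K') \<and>
         (\<forall>K'. sym_analytic_extension n (K_prime n m \<gamma> s H11 H12 H21 H22) K' \<longrightarrow>
               ase n K = ase n K')"
proof -
  note dims = assms(4) and syms = assms(5) and K_eq = assms(13)
  define k where "k = n - m"
  have n: "n = m + k"
    using assms(1) by (simp add: k_def)
  define Kp where "Kp = K_prime n m \<gamma> s H11 H12 H21 H22"
  define X where "X = (\<lambda>t. mat k m (\<lambda>(i, j). t powr (real_of_int s / 2) *
    (H21 t * the (mat_inverse (H11 t))) $$ (i, j) * t powr - \<gamma> j))"
  \<comment> \<open>\<open>P\<close> is the inverse transpose of \<open>R\<close> written out, so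
    that \<open>K P = R K'\<close> is the factorization of \<open>K\<close> with no inverse left to
    handle.\<close>
  define P where "P = (\<lambda>t. four_block_mat (1\<^sub>m m) (- transpose_mat (X t)) (0\<^sub>m k m) (1\<^sub>m k))"
  define R where "R = (\<lambda>t. four_block_mat (1\<^sub>m m) (0\<^sub>m m k) (X t) (1\<^sub>m k))"
  \<comment> \<open>These blocks are cut out of \<open>K\<close> and not assembled from the
    \<open>H\<close> blocks, because only the entries of \<open>K\<close> are known to be
    analytic.\<close>
  define K11 where "K11 = (\<lambda>t. mat m m (\<lambda>(i, j). K t $$ (i, j)))"
  define K21 where "K21 = (\<lambda>t. mat k m (\<lambda>(i, j). K t $$ (i + m, j)))"
  have X: "X t \<in> carrier_mat k m" for t
    by (simp add: X_def)
  have K11: "K11 t \<in> carrier_mat m m" for t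
    by (simp add: K11_def)
  have K21: "K21 t \<in> carrier_mat k m" for t
    by (simp add: K21_def)
  have small: "\<forall>\<^sub>F t in at_right 0. 0 < t \<and> t < \<delta>"
    using assms(3) by (auto simp: eventually_at_right_field)
  have H0: "H11 0 \<in> carrier_mat m m"
    using dims[of 0] assms(3) by simp
  have d0: "det (H11 0) \<noteq> 0"
    by (rule invertible_mat_det_ne_0[OF H0 assms(10)])
  have H11_dim: "\<forall>\<^sub>F t in at_right 0. H11 t \<in> carrier_mat m m"
    using small dims by (auto elim: eventually_mono)
  have H11_lim: "((\<lambda>t. H11 t $$ (i, j)) \<longlongrightarrow> H11 0 $$ (i, j)) (at_right 0)" if "i < m" "j < m" for i j
    using assms(6) that by (simp add: mat_cont_right_0_def continuous_within)
  have H21_lim: "((\<lambda>t. H21 t $$ (i, j)) \<longlongrightarrow> H21 0 $$ (i, j)) (at_right 0)" if "i < k" "j < m" for i j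
    using assms(8) that by (simp add: mat_cont_right_0_def continuous_within k_def)
  have inv_ev: "\<forall>\<^sub>F t in at_right 0. det (H11 t) \<noteq> 0"
    by (rule tendsto_mat_inverse(1)[OF H11_dim H0 d0 H11_lim])
  have inv_lim: "((\<lambda>t. the (mat_inverse (H11 t)) $$ (i, j)) \<longlongrightarrow> the (mat_inverse (H11 0)) $$ (i, j)) (at_right 0)"
    if "i < m" "j < m" for i j
    by (rule tendsto_mat_inverse(2)[OF H11_dim H0 d0 H11_lim that])

  \<comment> \<open>The last conjunct expresses the entries of \<open>K'\<close> through those of
    \<open>K\<close> and \<open>X\<close> alone, which reduces the continuation of \<open>K'\<close>
    to that of \<open>X\<close>. The conjuncts on \<open>K11\<close> and \<open>K21\<close>
    determine \<open>X\<close> from \<open>K\<close>.\<close>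
  have main: "\<forall>\<^sub>F t in at_right 0. Kp t \<in> carrier_mat n n \<and> transpose_mat (Kp t) = Kp t \<and>
      K t * P t = R t * Kp t \<and> X t * K11 t = K21 t \<and> det (K11 t) \<noteq> 0 \<and>
      (\<forall>i<n. \<forall>j<n. Kp t $$ (i, j) = (if i < m \<and> j < m then K t $$ (i, j)
         else if i \<ge> m \<and> j \<ge> m then K t $$ (i, j) - (\<Sum>l<m. X t $$ (i - m, l) * K t $$ (l, j)) else 0))"
    using small inv_ev
  proof eventually_elim
    case (elim t)
    then have t: "0 < t" "t < \<delta>" and d: "det (H11 t) \<noteq> 0"
      by auto
    define D where "D = Delta_m m \<gamma> t"
    define c where "c = t powr (real_of_int s / 2)"
    have D: "D \<in> carrier_mat m m"
      by (simp add: D_def Delta_m_def)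
    have A: "H11 t \<in> carrier_mat m m" and B: "H12 t \<in> carrier_mat m k" and C: "H21 t \<in> carrier_mat k m"
      and E: "H22 t \<in> carrier_mat k k"
      using dims[of t] t by (auto simp: k_def)
    have AT: "transpose_mat (H11 t) = H11 t" and CB: "H21 t = transpose_mat (H12 t)"
      and ET: "transpose_mat (H22 t) = H22 t"
      using syms[of t] t by auto
    note S = scaled_schur_complement(1-3,6)[where \<gamma> = \<gamma> and s = s, OF t(1) A B C E AT CB d, folded D_def c_def]
      and S' = scaled_schur_complement(4,5)[where \<gamma> = \<gamma>, OF t(1) A B C E AT CB d, folded D_def]
    have X_eq: "mat k m (\<lambda>(i, j). c * (H21 t * the (mat_inverse (H11 t))) $$ (i, j) * t powr - \<gamma> j) = X t"
      by (simp add: X_def c_def)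
    define a where "a = D * H11 t * D"
    define b where "b = c \<cdot>\<^sub>m (D * H12 t)"
    define e where "e = (t powi s) \<cdot>\<^sub>m H22 t"
    have dim: "a \<in> carrier_mat m m" "b \<in> carrier_mat m k" "c \<cdot>\<^sub>m (H21 t * D) \<in> carrier_mat k m" "e \<in> carrier_mat k k"
      using A B C D E by (auto simp: a_def b_def e_def)
    note S = S[unfolded X_eq, folded a_def b_def e_def] and S' = S'[folded a_def]
    have Kt: "K t = four_block_mat a b (c \<cdot>\<^sub>m (H21 t * D)) e"
      using K_eq[OF t] S(1) by (simp add: Delta_def D_def c_def k_def)
    have Kpt: "Kp t = four_block_mat a (0\<^sub>m m k) (0\<^sub>m k m) (e - X t * b)"
      using S(3) by (simp add: Kp_def K_prime_def k_def[symmetric] D_def[symmetric] a_def[symmetric])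
    note BC = block_congruence[OF dim X[of t] S(2) S'(2) S(4)]
    have XB: "X t * b \<in> carrier_mat k k"
      using X[of t] dim(2) by (rule mult_carrier_mat)
    define z where "z = e - X t * b"
    have z: "z \<in> carrier_mat k k"
      unfolding z_def by (rule minus_carrier_mat[OF XB])
    note Kpt = Kpt[folded z_def] and BC = BC[folded z_def]
    have 1: "Kp t \<in> carrier_mat n n"
      unfolding Kpt n by (rule four_block_carrier_mat[OF dim(1) z])
    have 2: "transpose_mat (Kp t) = Kp t"
    proof -
      have eT: "transpose_mat e = e"
        by (simp add: e_def transpose_smult ET)
      have "transpose_mat z = z"
        unfolding z_def transpose_minus[OF dim(4) XB] BC(1) eT ..
      then show ?thesis
        unfolding Kpt transpose_four_block_mat[OF dim(1) zero_carrier_mat zero_carrier_mat z] S'(2)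
        by simp
    qed
    have 3: "K t * P t = R t * Kp t"
      unfolding Kt Kpt P_def R_def by (rule BC(2))
    have K11a: "K11 t = a"
      using dim by (auto simp: K11_def Kt intro!: eq_matI)
    have K21c: "K21 t = c \<cdot>\<^sub>m (H21 t * D)"
      using dim C D by (auto simp: K21_def Kt intro!: eq_matI)
    have 4: "X t * K11 t = K21 t" "det (K11 t) \<noteq> 0"
      using S(2) S'(1) by (simp_all add: K11a K21c)
    have 5: "Kp t $$ (i, j) = (if i < m \<and> j < m then K t $$ (i, j)
         else if i \<ge> m \<and> j \<ge> m then K t $$ (i, j) - (\<Sum>l<m. X t $$ (i - m, l) * K t $$ (l, j)) else 0)"
      if ij: "i < n" "j < n" for i j
    proof (cases "i \<ge> m \<and> j \<ge> m")
      case True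
      have "(X t * b) $$ (i - m, j - m) = (\<Sum>l<m. X t $$ (i - m, l) * b $$ (l, j - m))"
        using X[of t] dim ij True by (auto simp: scalar_prod_def atLeast0LessThan n intro!: sum.cong)
      also have "\<dots> = (\<Sum>l<m. X t $$ (i - m, l) * K t $$ (l, j))"
        using dim(1,4) ij True by (intro sum.cong refl) (auto simp: Kt n)
      moreover have "z $$ (i - m, j - m) = e $$ (i - m, j - m) - (X t * b) $$ (i - m, j - m)"
        using XB True ij unfolding z_def by (intro index_minus_mat) (auto simp: n)
      moreover have "Kp t $$ (i, j) = z $$ (i - m, j - m)" "K t $$ (i, j) = e $$ (i - m, j - m)"
        using True ij dim(1,4) z by (auto simp: Kpt Kt n)
      ultimately show ?thesis
        using True by simp
    next
      case False
      then show ?thesis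
        using ij dim(1,4) z by (auto simp: Kpt Kt n)
    qed
    show ?case
      using 1 2 3 4 5 by blast
  qed

  \<comment> \<open>An entry in column \<open>j\<close> is a factor with a finite limit times
    \<open>t powr (s / 2 - \<gamma> j)\<close>; the strict bound on \<open>\<gamma> j\<close> makes
    this exponent positive.\<close>
  have X_lim: "((\<lambda>t. X t $$ (i, j)) \<longlongrightarrow> 0) (at_right 0)" if ij: "i < k" "j < m" for i j
  proof -
    define y where "y = (\<lambda>t. \<Sum>l<m. H21 t $$ (i, l) * the (mat_inverse (H11 t)) $$ (l, j))"
    have "(y \<longlongrightarrow> (\<Sum>l<m. H21 0 $$ (i, l) * the (mat_inverse (H11 0)) $$ (l, j))) (at_right 0)"
      unfolding y_def using ij by (intro tendsto_sum tendsto_mult H21_lim inv_lim) auto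
    moreover have "((\<lambda>t. t powr (real_of_int s / 2 - \<gamma> j)) \<longlongrightarrow> 0) (at_right 0)"
    proof (rule tendsto_zero_powrI)
      show "((\<lambda>t. t) \<longlongrightarrow> 0) (at_right (0::real))"
        by (rule tendsto_ident_at)
      show "\<forall>\<^sub>F t in at_right 0. 0 \<le> (t::real)"
        using small by eventually_elim simp
    qed (use assms(12)[OF ij(2)] in auto)
    ultimately have "((\<lambda>t. t powr (real_of_int s / 2 - \<gamma> j) * y t) \<longlongrightarrow>
        0 * (\<Sum>l<m. H21 0 $$ (i, l) * the (mat_inverse (H11 0)) $$ (l, j))) (at_right 0)"
      by (rule tendsto_mult[rotated])
    moreover have "\<forall>\<^sub>F t in at_right 0. t powr (real_of_int s / 2 - \<gamma> j) * y t = X t $$ (i, j)"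
      using small inv_ev
    proof eventually_elim
      case (elim t)
      then have t: "0 < t" "t < \<delta>"
        by auto
      have dim: "H21 t \<in> carrier_mat k m" "the (mat_inverse (H11 t)) \<in> carrier_mat m m"
        using dims[of t] t mat_inverse_nonsingular(1)[of "H11 t" m] elim by (auto simp: k_def)
      then have "(H21 t * the (mat_inverse (H11 t))) $$ (i, j) = y t"
        using ij by (auto simp: y_def scalar_prod_def atLeast0LessThan intro!: sum.cong)
      moreover have "t powr (real_of_int s / 2 - \<gamma> j) = t powr (real_of_int s / 2) * t powr - \<gamma> j"
        by (simp add: powr_add[symmetric])
      ultimately show ?case
        using ij by (simp add: X_def)
    qed
    ultimately show ?thesis
      using tendsto_cong by fastforce
  qed

  have "ase n K = ase n K'" if K': "sym_analytic_extension n Kp K'" for K'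
  proof (rule ase_eqI[OF assms(2)])
    show "sym_analytic_mat n K'"
      using K' by (simp add: sym_analytic_extension_def)
    have "\<forall>\<^sub>F t in at_right 0. K' t = Kp t"
      using K' by (simp add: sym_analytic_extension_def)
    then show "\<forall>\<^sub>F t in at_right 0. P t \<in> carrier_mat n n \<and> R t \<in> carrier_mat n n \<and> K t * P t = R t * K' t"
      using main by eventually_elim (simp add: P_def R_def n)
    fix i j assume ij: "i < n" "j < n"
    have dimX: "dim_row (X t) = k" "dim_col (X t) = m" for t
      using X by auto
    show "((\<lambda>t. P t $$ (i, j)) \<longlongrightarrow> (if i = j then 1 else 0)) (at_right 0)"
    proof (cases "i < m \<and> j \<ge> m")
      case True
      then have "((\<lambda>t. - X t $$ (j - m, i)) \<longlongrightarrow> - 0) (at_right 0)"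
        using ij by (intro tendsto_minus X_lim) (auto simp: n)
      moreover have "P t $$ (i, j) = - X t $$ (j - m, i)" for t
      proof -
        have "j - m < k"
          using True ij unfolding n by linarith
        then show ?thesis
          using True ij by (simp add: P_def n dimX)
      qed
      ultimately show ?thesis
        using True by simp
    next
      case False
      then have "P t $$ (i, j) = (if i = j then 1 else 0)" for t
        using ij by (auto simp: P_def n dimX)
      then show ?thesis
        by simp
    qed
    show "((\<lambda>t. R t $$ (i, j)) \<longlongrightarrow> (if i = j then 1 else 0)) (at_right 0)"
    proof (cases "i \<ge> m \<and> j < m")
      case True
      then have "((\<lambda>t. X t $$ (i - m, j)) \<longlongrightarrow> 0) (at_right 0)"
        using ij by (intro X_lim) (auto simp: n)
      with True ij show ?thesis
        by (simp add: R_def n dimX)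
    next
      case False
      then have "R t $$ (i, j) = (if i = j then 1 else 0)" for t
        using ij by (auto simp: R_def n dimX)
      then show ?thesis
        by simp
    qed
  qed

  moreover have "\<exists>K'. sym_analytic_extension n Kp K'"
  proof -
    have K_ana: "analytic_at_0 (\<lambda>t. K t $$ (i, j))" if "i < n" "j < n" for i j
      using assms(2) that by (simp add: sym_analytic_mat_def)
    have K11_ana: "analytic_at_0 (\<lambda>t. K11 t $$ (i, j))" if "i < m" "j < m" for i j
      using K_ana[of i j] that by (simp add: K11_def n)
    \<comment> \<open>Multiplying \<open>X * K11 = K21\<close> by the adjugate of \<open>K11\<close>
      gives \<open>det K11\<close> times \<open>X\<close> as \<open>K21 * adj_mat K11\<close>, with
      analytic functions of the entries of \<open>K\<close> on both sides of the quotient. The limit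
      0 of \<open>X\<close> excludes a pole.\<close>
    have "\<exists>y. analytic_at_0 y \<and> (\<forall>\<^sub>F t in at_right 0. y t = X t $$ (i, j))" if ij: "i < k" "j < m" for i j
    proof (rule analytic_quotient_extends[where d = "\<lambda>t. det (K11 t)" and l = 0
          and f = "\<lambda>t. \<Sum>l<m. K t $$ (i + m, l) * adj_mat (K11 t) $$ (l, j)"])
      show "analytic_at_0 (\<lambda>t. det (K11 t))"
        by (rule analytic_at_0_det[OF K11 K11_ana])
      show "analytic_at_0 (\<lambda>t. \<Sum>l<m. K t $$ (i + m, l) * adj_mat (K11 t) $$ (l, j))"
        using ij by (intro analytic_at_0_sum analytic_at_0_mult K_ana analytic_at_0_adj_mat[OF K11] K11_ana)
          (auto simp: n)
      show "\<forall>\<^sub>F t in at_right 0. det (K11 t) \<noteq> 0"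
        using main by eventually_elim simp
      show "\<forall>\<^sub>F t in at_right 0. det (K11 t) * X t $$ (i, j)
          = (\<Sum>l<m. K t $$ (i + m, l) * adj_mat (K11 t) $$ (l, j))"
        using main
      proof eventually_elim
        case (elim t)
        note adj = adj_mat[OF K11, of t]
        have "K21 t * adj_mat (K11 t) = X t * (K11 t * adj_mat (K11 t))"
          using elim assoc_mult_mat[OF X K11 adj(1), of t t] by simp
        also have "\<dots> = det (K11 t) \<cdot>\<^sub>m X t"
          using adj(2) mult_smult_distrib[OF X[of t], of "1\<^sub>m m" m "det (K11 t)"] right_mult_one_mat[OF X[of t]] by simp
        finally have "(K21 t * adj_mat (K11 t)) $$ (i, j) = (det (K11 t) \<cdot>\<^sub>m X t) $$ (i, j)"
          by simp
        moreover have "(K21 t * adj_mat (K11 t)) $$ (i, j) = (\<Sum>l<m. K t $$ (i + m, l) * adj_mat (K11 t) $$ (l, j))"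
          using ij adj(1) by (auto simp: K21_def scalar_prod_def atLeast0LessThan intro!: sum.cong)
        moreover have "(det (K11 t) \<cdot>\<^sub>m X t) $$ (i, j) = det (K11 t) * X t $$ (i, j)"
          using ij X[of t] by simp
        ultimately show ?case
          by simp
      qed
      show "((\<lambda>t. X t $$ (i, j)) \<longlongrightarrow> 0) (at_right 0)"
        by (rule X_lim[OF ij])
    qed
    then obtain x where x: "\<And>i j. i < k \<Longrightarrow> j < m \<Longrightarrow> analytic_at_0 (x i j)"
        "\<And>i j. i < k \<Longrightarrow> j < m \<Longrightarrow> \<forall>\<^sub>F t in at_right 0. x i j t = X t $$ (i, j)"
      by metis
    \<comment> \<open>The entry formula for \<open>K'\<close> with \<open>X\<close> replaced by its
      analytic continuation \<open>x\<close>.\<close>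
    define g where "g = (\<lambda>i j t. if i < m \<and> j < m then K t $$ (i, j)
        else if i \<ge> m \<and> j \<ge> m then K t $$ (i, j) - (\<Sum>l<m. x (i - m) l t * K t $$ (l, j)) else 0)"
    define G where "G = (\<lambda>t. mat n n (\<lambda>(i, j). g i j t))"
    have g_ana: "analytic_at_0 (g i j)" if ij: "i < n" "j < n" for i j
    proof -
      consider "i < m \<and> j < m" | "i \<ge> m \<and> j \<ge> m" | "\<not> (i < m \<and> j < m)" "\<not> (i \<ge> m \<and> j \<ge> m)"
        by blast
      then show ?thesis
      proof cases
        case 1
        then show ?thesis
          using K_ana[OF ij] by (simp add: g_def)
      next
        case 2
        then have "g i j = (\<lambda>t. K t $$ (i, j) - (\<Sum>l<m. x (i - m) l t * K t $$ (l, j)))"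
          by (auto simp: g_def fun_eq_iff)
        then show ?thesis
          using 2 ij by (auto intro!: analytic_at_0_diff analytic_at_0_sum analytic_at_0_mult K_ana x(1) simp: n)
      next
        case 3
        then have "g i j = (\<lambda>t. 0)"
          by (auto simp: g_def fun_eq_iff)
        then show ?thesis
          by (simp add: analytic_at_0_const)
      qed
    qed
    have "\<forall>\<^sub>F t in at_right 0. \<forall>i\<in>{..<k}. \<forall>j\<in>{..<m}. x i j t = X t $$ (i, j)"
      using x(2) by (intro eventually_ball_finite finite_lessThan ballI) auto
    then have GK: "\<forall>\<^sub>F t in at_right 0. G t = Kp t"
      using main
    proof eventually_elim
      case (elim t)
      show ?case
      proof (rule eq_matI)
        fix i j assume "i < dim_row (Kp t)" "j < dim_col (Kp t)"
        then have ij: "i < n" "j < n"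
          using elim(2) by auto
        have "(\<Sum>l<m. x (i - m) l t * K t $$ (l, j)) = (\<Sum>l<m. X t $$ (i - m, l) * K t $$ (l, j))" if "i \<ge> m"
          using elim(1) ij that by (intro sum.cong refl) (auto simp: n)
        then show "G t $$ (i, j) = Kp t $$ (i, j)"
          using elim(2) ij by (auto simp: G_def g_def)
      qed (use elim(2) in \<open>auto simp: G_def\<close>)
    qed
    \<comment> \<open>Symmetry is inherited from \<open>Kp\<close> only for small positive
      \<open>t\<close>; the identity theorem extends it to a neighbourhood of 0.\<close>
    have "\<forall>\<^sub>F t in nhds 0. \<forall>i\<in>{..<n}. \<forall>j\<in>{..<n}. g j i t = g i j t"
    proof (intro eventually_ball_finite finite_lessThan ballI)
      fix i j assume "i \<in> {..<n}" "j \<in> {..<n}"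
      then have ij: "i < n" "j < n"
        by simp_all
      have ev: "\<forall>\<^sub>F t in at_right 0. g j i t = g i j t"
        using GK main
      proof eventually_elim
        case (elim t)
        have "transpose_mat (G t) $$ (i, j) = G t $$ (i, j)"
          using elim by simp
        then show ?case
          using ij by (simp add: G_def)
      qed
      obtain F1 F2 where "g j i has_fps_expansion F1" "g i j has_fps_expansion F2"
        using g_ana[OF ij] g_ana[OF ij(2,1)] by (auto simp: analytic_at_0_def)
      then show "\<forall>\<^sub>F t in nhds 0. g j i t = g i j t"
        using ev by (rule has_fps_expansion_eq_at_right(2))
    qed
    then have "\<forall>\<^sub>F t in nhds 0. G t \<in> carrier_mat n n \<and> transpose_mat (G t) = G t"
      by eventually_elim (auto simp: G_def intro!: eq_matI)
    then have "sym_analytic_mat n G"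
      using g_ana by (simp add: sym_analytic_mat_def G_def)
    with GK show ?thesis
      unfolding sym_analytic_extension_def by blast
  qed
  ultimately show ?thesis
    by (simp add: Kp_def)
qed

end
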